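(* Let $X$ be a diffeological space and $G$ a diffeological group. The functor $$\mathsf{Cons}:\mathsf{Coc}(X,G)\to\mathsf{DiffPrin}_G(X)$$ from the groupoid of $G$-cocycles on $X$ to the groupoid of diffeological principal $G$-bundles over $X$ is an equivalence of groupoids.
   Context: Diffeology. A cartesian space is a smooth manifold diffeomorphic to $\mathbb{R}^n$ for some $n\ge 0$; $\mathsf{Cart}$ is the category of cartesian spaces and smooth maps, regarded as small. A good open cover of a manifold is an open cover $\{U_i\}$ by cartesian spaces all of whose finite non-empty intersections are cartesian spaces. A diffeological space is a set $X$ with a collection of functions $p:U\to X$, $U\in\mathsf{Cart}$, called plots, such that (1) every map $\mathbb{R}^0\to X$ is a plot; (2) if $p:U\to X$ is a plot and $f:V\to U$ is smooth, then $pf$ is a plot; (3) if $p:U\to X$ is a function and $p|_{U_i}$ is a plot for every member of some good open cover $\{U_i\subseteq U\}$, then $p$ is a plot. A function $f:X\to Y$ is smooth if $fp$ is a plot of $Y$ for every plot $p$ of $X$. Cartesian spaces carry the diffeology of smooth maps. Limits and colimits are formed on underlying sets: a function into a limit is a plot iff all its components are; a function $U\to\mathrm{colim}\,F$ (in particular into a coproduct or a quotient) is a plot iff on the members of some good open cover of $U$ it lifts to plots of the terms of the diagram. A subduction is a surjective smooth map $\pi:P\to X$ such that for every plot $p:U\to X$ there are a good open cover $\{U_i\subseteq U\}$ and plots $p_i:U_i\to P$ with $\pi p_i=p|_{U_i}$. A diffeological group is a group with a diffeology for which multiplication and inversion are smooth. A diffeological principal $G$-bundle over $X$ is a subduction $\pi:P\to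 X$, with $P$ carrying a smooth right $G$-action, such that $(p,g)\mapsto(p,p\cdot g)$ is a diffeomorphism $P\times G\to P\times_X P$. Morphisms are $G$-equivariant smooth maps over $X$; this is the groupoid $\mathsf{DiffPrin}_G(X)$. Cocycles. $\mathsf{Plot}(X)$ has as objects the plots $p_0:U_{p_0}\to X$ and as morphisms $p_1\to p_0$ the smooth maps $f_0:U_{p_1}\to U_{p_0}$ with $p_0f_0=p_1$ ("maps of plots"). A $G$-cocycle is a family $g=\{g_{f_0}\}$ of smooth maps $g_{f_0}:U_{p_1}\to G$, one for each map of plots $f_0:U_{p_1}\to U_{p_0}$, with $g_{f_0f_1}=(g_{f_0}\circ f_1)\cdot g_{f_1}$ for all composable $U_{p_2}\xrightarrow{f_1}U_{p_1}\xrightarrow{f_0}U_{p_0}$. A morphism $h:g\to g'$ is a family of smooth maps $h_{p_0}:U_{p_0}\to G$, one for each plot, with $g'_{f_0}\cdot h_{p_1}=(h_{p_0}\circ f_0)\cdot g_{f_0}$ for every map of plots $f_0:U_{p_1}\to U_{p_0}$; composition is $(h'\circ h)_{p_0}=h'_{p_0}\cdot h_{p_0}$. This is the groupoid $\mathsf{Coc}(X,G)$. The functor $\mathsf{Cons}$. For a cocycle $g$, let $\widehat P=\coprod_{p_0\in\mathsf{Plot}(X)}U_{p_0}\times G$ with elements $(x_{p_0},k_0)$, $x_{p_0}\in U_{p_0}$, $k_0\in G$; let $\sim$ be the smallest equivalence relation with $(x_{p_1},k_1)\sim(x_{p_0},k_0)$ whenever there is a map of plots $f_0:U_{p_1}\to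 U_{p_0}$ with $f_0(x_{p_1})=x_{p_0}$ and $k_0=g_{f_0}(x_{p_1})\cdot k_1$. Then $\mathsf{Cons}(g)$ is $\pi:P=\widehat P/{\sim}\to X$, $\pi[x_{p_0},k_0]=p_0(x_{p_0})$, with action $[x_{p_0},k_0]\cdot k=[x_{p_0},k_0k]$. For $h:g\to g'$, $\mathsf{Cons}(h)[x_{p_0},k_0]=[x_{p_0},h_{p_0}(x_{p_0})\cdot k_0]$. *)

theory Defs
  imports "HOL-Analysis.Analysis" "HOL-Algebra.Group"
begin

text \<open>
  Partial maps between carrier sets are represented by extensional functions
  (\<^term>\<open>f \<in> A \<rightarrow>\<^sub>E B\<close>), so that equality of maps, of plots and of cocycles is HOL equality.
\<close>

section \<open>Cartesian spaces\<close>

type_synonym pt = "nat \<Rightarrow> real"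

text \<open>
  The union of all \<^term>\<open>Rn n\<close> is the space of finitely supported real sequences;
  \<^term>\<open>Rn m\<close> is a subspace of \<^term>\<open>Rn n\<close> for \<^term>\<open>m \<le> n\<close>.
\<close>

abbreviation Rn :: "nat \<Rightarrow> pt set" where
  "Rn n \<equiv> topspace (Euclidean_space n)"

definition part_deriv :: "nat \<Rightarrow> (pt \<Rightarrow> real) \<Rightarrow> pt \<Rightarrow> real" where
  "part_deriv i f x = deriv (\<lambda>t. f (x(i := t))) (x i)"

text \<open>\<open>Ck n k W f\<close>: \<open>f\<close> is of class \<open>C\<^sup>k\<close> on the set \<open>W\<close>, which is meant to be open in \<open>Rn n\<close>.\<close>

primrec Ck :: "nat \<Rightarrow> nat \<Rightarrow> pt set \<Rightarrow> (pt \<Rightarrow> real) \<Rightarrow> bool" where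
  "Ck n 0 W f \<longleftrightarrow> continuous_map (subtopology (Euclidean_space n) W) euclideanreal f"
| "Ck n (Suc k) W f \<longleftrightarrow>
     continuous_map (subtopology (Euclidean_space n) W) euclideanreal f \<and>
     (\<forall>i<n. (\<forall>x\<in>W. (\<lambda>t. f (x(i := t))) field_differentiable at (x i)) \<and>
            Ck n k W (part_deriv i f))"

text \<open>
  Smoothness of a map between subsets of Euclidean spaces: near every point of its domain the map
  extends to a smooth map on an open subset of the ambient space. For embedded submanifolds this is
  the usual notion of smooth map of manifolds, and it does not depend on the ambient dimension.
\<close>

definition smooth_map :: "pt set \<Rightarrow> pt set \<Rightarrow> (pt \<Rightarrow> pt) \<Rightarrow> bool" where
  "smooth_map S T f \<longleftrightarrow> f \<in> S \<rightarrow>\<^sub>E T \<and>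
     (\<exists>n. S \<subseteq> Rn n \<and>
        (\<forall>x\<in>S. \<exists>W F. openin (Euclidean_space n) W \<and> x \<in> W \<and>
            (\<forall>j k. Ck n k W (\<lambda>y. F y j)) \<and> (\<forall>y\<in>S \<inter> W. F y = f y)))"

text \<open>
  Cartesian spaces are the smooth submanifolds of the Euclidean spaces that are diffeomorphic to
  some \<^term>\<open>Rn n\<close>. They form a set, and every abstract manifold diffeomorphic to
  some \<^term>\<open>Rn n\<close> is isomorphic to one of them, so this is a small model of the category of
  cartesian spaces.
\<close>

definition cartesian :: "pt set \<Rightarrow> bool" where
  "cartesian U \<longleftrightarrow>
     (\<exists>n f g. smooth_map (Rn n) U f \<and> smooth_map U (Rn n) g \<and>
        (\<forall>x\<in>Rn n. g (f x) = x) \<and> (\<forall>y\<in>U. f (g y) = y))"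

definition good_cover :: "pt set \<Rightarrow> pt set set \<Rightarrow> bool" where
  "good_cover U \<U> \<longleftrightarrow>
     (\<forall>V\<in>\<U>. openin (subtopology (powertop_real UNIV) U) V \<and> cartesian V) \<and> \<Union>\<U> = U \<and>
     (\<forall>\<F>. finite \<F> \<and> \<F> \<noteq> {} \<and> \<F> \<subseteq> \<U> \<and> \<Inter>\<F> \<noteq> {} \<longrightarrow> cartesian (\<Inter>\<F>))"

section \<open>Diffeological spaces\<close>

text \<open>A parametrization is a pair \<open>(U, p)\<close> of a cartesian space and a function on it.\<close>

type_synonym 'a param = "pt set \<times> (pt \<Rightarrow> 'a)"

record 'a dspace =
  points :: "'a set"
  plots :: "'a param set"

definition diffeological_space :: "'a dspace \<Rightarrow> bool" where
  "diffeological_space X \<longleftrightarrow>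
     (\<forall>(U, p)\<in>plots X. cartesian U \<and> p \<in> U \<rightarrow>\<^sub>E points X) \<and>
     (\<forall>p \<in> Rn 0 \<rightarrow>\<^sub>E points X. (Rn 0, p) \<in> plots X) \<and>
     (\<forall>U p V f. (U, p) \<in> plots X \<and> cartesian V \<and> smooth_map V U f \<longrightarrow>
        (V, compose V p f) \<in> plots X) \<and>
     (\<forall>U p \<U>. cartesian U \<and> p \<in> U \<rightarrow>\<^sub>E points X \<and> good_cover U \<U> \<and>
        (\<forall>V\<in>\<U>. (V, restrict p V) \<in> plots X) \<longrightarrow> (U, p) \<in> plots X)"

definition dsmooth :: "'a dspace \<Rightarrow> 'b dspace \<Rightarrow> ('a \<Rightarrow> 'b) \<Rightarrow> bool" where
  "dsmooth X Y f \<longleftrightarrow> f \<in> points X \<rightarrow>\<^sub>E points Y \<and>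
     (\<forall>(U, p)\<in>plots X. (U, compose U f p) \<in> plots Y)"

definition diffeomorphism :: "'a dspace \<Rightarrow> 'b dspace \<Rightarrow> ('a \<Rightarrow> 'b) \<Rightarrow> bool" where
  "diffeomorphism X Y f \<longleftrightarrow> dsmooth X Y f \<and>
     (\<exists>g. dsmooth Y X g \<and> (\<forall>x\<in>points X. g (f x) = x) \<and> (\<forall>y\<in>points Y. f (g y) = y))"

definition subduction :: "'a dspace \<Rightarrow> 'b dspace \<Rightarrow> ('a \<Rightarrow> 'b) \<Rightarrow> bool" where
  "subduction P X \<pi> \<longleftrightarrow> dsmooth P X \<pi> \<and> \<pi> ` points P = points X \<and>
     (\<forall>(U, p)\<in>plots X. \<exists>\<U>. good_cover U \<U> \<and>
        (\<forall>V\<in>\<U>. \<exists>q. (V, q) \<in> plots P \<and> (\<forall>x\<in>V. \<pi> (q x) = p x)))"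

definition cart_space :: "pt set \<Rightarrow> pt dspace" where
  "cart_space U = \<lparr>points = U, plots = {(V, f). cartesian V \<and> smooth_map V U f}\<rparr>"

definition dprod :: "'a dspace \<Rightarrow> 'b dspace \<Rightarrow> ('a \<times> 'b) dspace" where
  "dprod X Y = \<lparr>points = points X \<times> points Y,
     plots = {(U, p). p \<in> U \<rightarrow>\<^sub>E points X \<times> points Y \<and>
                (U, compose U fst p) \<in> plots X \<and> (U, compose U snd p) \<in> plots Y}\<rparr>"

definition dfibprod :: "'a dspace \<Rightarrow> 'b dspace \<Rightarrow> ('a \<Rightarrow> 'c) \<Rightarrow> ('b \<Rightarrow> 'c) \<Rightarrow> ('a \<times> 'b) dspace" where
  "dfibprod P Q \<pi> \<rho> = \<lparr>points = {(p, q). p \<in> points P \<and> q \<in> points Q \<and> \<pi> p = \<rho> q},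
     plots = {(U, r)\<in>plots (dprod P Q). \<forall>x\<in>U. \<pi> (fst (r x)) = \<rho> (snd (r x))}\<rparr>"

definition dcoprod :: "'i set \<Rightarrow> ('i \<Rightarrow> 'a dspace) \<Rightarrow> ('i \<times> 'a) dspace" where
  "dcoprod I F = \<lparr>points = Sigma I (\<lambda>i. points (F i)),
     plots = {(U, p). cartesian U \<and> p \<in> U \<rightarrow>\<^sub>E Sigma I (\<lambda>i. points (F i)) \<and>
        (\<exists>\<U>. good_cover U \<U> \<and>
           (\<forall>V\<in>\<U>. \<exists>i\<in>I. \<exists>q. (V, q) \<in> plots (F i) \<and> (\<forall>x\<in>V. p x = (i, q x))))}\<rparr>"

text \<open>
  The quotient of \<open>X\<close> that identifies the points on which \<open>c\<close> agrees, with \<open>c x\<close> as the name of the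
  class of \<open>x\<close>.
\<close>

definition dquot :: "'a dspace \<Rightarrow> ('a \<Rightarrow> 'b) \<Rightarrow> 'b dspace" where
  "dquot X c = \<lparr>points = c ` points X,
     plots = {(U, p). cartesian U \<and> p \<in> U \<rightarrow>\<^sub>E c ` points X \<and>
        (\<exists>\<U>. good_cover U \<U> \<and>
           (\<forall>V\<in>\<U>. \<exists>q. (V, q) \<in> plots X \<and> (\<forall>x\<in>V. p x = c (q x))))}\<rparr>"

record 'g dgroup = "'g monoid" +
  gplots :: "'g param set"

definition gspace :: "'g dgroup \<Rightarrow> 'g dspace" where
  "gspace G = \<lparr>points = carrier G, plots = gplots G\<rparr>"

definition diffeological_group :: "'g dgroup \<Rightarrow> bool" where
  "diffeological_group G \<longleftrightarrow> group G \<and> diffeological_space (gspace G) \<and>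
     dsmooth (dprod (gspace G) (gspace G)) (gspace G)
       (\<lambda>z\<in>carrier G \<times> carrier G. fst z \<otimes>\<^bsub>G\<^esub> snd z) \<and>
     dsmooth (gspace G) (gspace G) (\<lambda>a\<in>carrier G. inv\<^bsub>G\<^esub> a)"

section \<open>Categories, groupoids and equivalences\<close>

text \<open>Composition \<open>Comp C x y z g f\<close> is \<open>g \<circ> f\<close> for \<open>f : x \<rightarrow> y\<close> and \<open>g : y \<rightarrow> z\<close>.\<close>

record ('o, 'm) category =
  Ob :: "'o set"
  Hom :: "'o \<Rightarrow> 'o \<Rightarrow> 'm set"
  Ident :: "'o \<Rightarrow> 'm"
  Comp :: "'o \<Rightarrow> 'o \<Rightarrow> 'o \<Rightarrow> 'm \<Rightarrow> 'm \<Rightarrow> 'm"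

definition is_category :: "('o, 'm) category \<Rightarrow> bool" where
  "is_category C \<longleftrightarrow>
     (\<forall>x\<in>Ob C. Ident C x \<in> Hom C x x) \<and>
     (\<forall>x\<in>Ob C. \<forall>y\<in>Ob C. \<forall>z\<in>Ob C. \<forall>f\<in>Hom C x y. \<forall>g\<in>Hom C y z.
        Comp C x y z g f \<in> Hom C x z) \<and>
     (\<forall>x\<in>Ob C. \<forall>y\<in>Ob C. \<forall>f\<in>Hom C x y.
        Comp C x x y f (Ident C x) = f \<and> Comp C x y y (Ident C y) f = f) \<and>
     (\<forall>w\<in>Ob C. \<forall>x\<in>Ob C. \<forall>y\<in>Ob C. \<forall>z\<in>Ob C.
        \<forall>f\<in>Hom C w x. \<forall>g\<in>Hom C x y. \<forall>h\<in>Hom C y z.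
        Comp C w y z h (Comp C w x y g f) = Comp C w x z (Comp C x y z h g) f)"

definition is_isomorphism :: "('o, 'm) category \<Rightarrow> 'o \<Rightarrow> 'o \<Rightarrow> 'm \<Rightarrow> bool" where
  "is_isomorphism C x y f \<longleftrightarrow> f \<in> Hom C x y \<and>
     (\<exists>g\<in>Hom C y x. Comp C x y x g f = Ident C x \<and> Comp C y x y f g = Ident C y)"

definition groupoid :: "('o, 'm) category \<Rightarrow> bool" where
  "groupoid C \<longleftrightarrow> is_category C \<and>
     (\<forall>x\<in>Ob C. \<forall>y\<in>Ob C. \<forall>f\<in>Hom C x y. is_isomorphism C x y f)"

record ('o, 'm, 'p, 'n) cat_functor =
  on_Ob :: "'o \<Rightarrow> 'p"
  on_Hom :: "'o \<Rightarrow> 'o \<Rightarrow> 'm \<Rightarrow> 'n"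

definition is_functor ::
    "('o, 'm) category \<Rightarrow> ('p, 'n) category \<Rightarrow> ('o, 'm, 'p, 'n) cat_functor \<Rightarrow> bool" where
  "is_functor C D F \<longleftrightarrow>
     (\<forall>x\<in>Ob C. on_Ob F x \<in> Ob D) \<and>
     (\<forall>x\<in>Ob C. \<forall>y\<in>Ob C. \<forall>f\<in>Hom C x y. on_Hom F x y f \<in> Hom D (on_Ob F x) (on_Ob F y)) \<and>
     (\<forall>x\<in>Ob C. on_Hom F x x (Ident C x) = Ident D (on_Ob F x)) \<and>
     (\<forall>x\<in>Ob C. \<forall>y\<in>Ob C. \<forall>z\<in>Ob C. \<forall>f\<in>Hom C x y. \<forall>g\<in>Hom C y z.
        on_Hom F x z (Comp C x y z g f) =
        Comp D (on_Ob F x) (on_Ob F y) (on_Ob F z) (on_Hom F y z g) (on_Hom F x y f))"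

definition id_functor :: "('o, 'm, 'o, 'm) cat_functor" where
  "id_functor = \<lparr>on_Ob = (\<lambda>x. x), on_Hom = (\<lambda>x y f. f)\<rparr>"

definition comp_functor ::
    "('p, 'n, 'q, 'l) cat_functor \<Rightarrow> ('o, 'm, 'p, 'n) cat_functor \<Rightarrow> ('o, 'm, 'q, 'l) cat_functor" where
  "comp_functor H F = \<lparr>on_Ob = (\<lambda>x. on_Ob H (on_Ob F x)),
     on_Hom = (\<lambda>x y f. on_Hom H (on_Ob F x) (on_Ob F y) (on_Hom F x y f))\<rparr>"

definition naturally_isomorphic ::
    "('o, 'm) category \<Rightarrow> ('p, 'n) category \<Rightarrow>
     ('o, 'm, 'p, 'n) cat_functor \<Rightarrow> ('o, 'm, 'p, 'n) cat_functor \<Rightarrow> bool" where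
  "naturally_isomorphic C D F H \<longleftrightarrow>
     (\<exists>\<eta>. (\<forall>x\<in>Ob C. is_isomorphism D (on_Ob F x) (on_Ob H x) (\<eta> x)) \<and>
        (\<forall>x\<in>Ob C. \<forall>y\<in>Ob C. \<forall>f\<in>Hom C x y.
           Comp D (on_Ob F x) (on_Ob F y) (on_Ob H y) (\<eta> y) (on_Hom F x y f) =
           Comp D (on_Ob F x) (on_Ob H x) (on_Ob H y) (on_Hom H x y f) (\<eta> x)))"

definition equivalence_of_groupoids ::
    "('o, 'm) category \<Rightarrow> ('p, 'n) category \<Rightarrow> ('o, 'm, 'p, 'n) cat_functor \<Rightarrow> bool" where
  "equivalence_of_groupoids C D F \<longleftrightarrow> groupoid C \<and> groupoid D \<and> is_functor C D F \<and>
     (\<exists>H. is_functor D C H \<and>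
        naturally_isomorphic C C id_functor (comp_functor H F) \<and>
        naturally_isomorphic D D (comp_functor F H) id_functor)"

section \<open>Diffeological principal bundles\<close>

record ('p, 'x, 'g) gbundle =
  total :: "'p dspace"
  bproj :: "'p \<Rightarrow> 'x"
  act :: "'p \<times> 'g \<Rightarrow> 'p"

definition principal_bundle :: "'x dspace \<Rightarrow> 'g dgroup \<Rightarrow> ('p, 'x, 'g) gbundle \<Rightarrow> bool" where
  "principal_bundle X G B \<longleftrightarrow>
     diffeological_space (total B) \<and> subduction (total B) X (bproj B) \<and>
     dsmooth (dprod (total B) (gspace G)) (total B) (act B) \<and>
     (\<forall>p\<in>points (total B). act B (p, \<one>\<^bsub>G\<^esub>) = p) \<and>
     (\<forall>p\<in>points (total B). \<forall>k\<in>carrier G. \<forall>l\<in>carrier G.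
        act B (act B (p, k), l) = act B (p, k \<otimes>\<^bsub>G\<^esub> l)) \<and>
     diffeomorphism (dprod (total B) (gspace G))
       (dfibprod (total B) (total B) (bproj B) (bproj B))
       (\<lambda>z\<in>points (total B) \<times> carrier G. (fst z, act B z))"

definition bundle_map ::
    "'g dgroup \<Rightarrow> ('p, 'x, 'g) gbundle \<Rightarrow> ('p, 'x, 'g) gbundle \<Rightarrow> ('p \<Rightarrow> 'p) \<Rightarrow> bool" where
  "bundle_map G B B' f \<longleftrightarrow> dsmooth (total B) (total B') f \<and>
     (\<forall>p\<in>points (total B). bproj B' (f p) = bproj B p) \<and>
     (\<forall>p\<in>points (total B). \<forall>k\<in>carrier G. f (act B (p, k)) = act B' (f p, k))"

text \<open>The total spaces are the diffeological spaces whose points are taken from the type \<open>'p\<close>.\<close>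

definition DiffPrin ::
    "'x dspace \<Rightarrow> 'g dgroup \<Rightarrow> (('p, 'x, 'g) gbundle, 'p \<Rightarrow> 'p) category" where
  "DiffPrin X G = \<lparr>
     Ob = {B. principal_bundle X G B},
     Hom = (\<lambda>B B'. {f. bundle_map G B B' f}),
     Ident = (\<lambda>B. \<lambda>p\<in>points (total B). p),
     Comp = (\<lambda>B B' B'' g f. compose (points (total B)) g f)\<rparr>"

section \<open>Cocycles\<close>

text \<open>
  A map of plots is recorded together with its source and target, as \<open>(p\<^sub>1, p\<^sub>0, f)\<close> with
  \<open>f : p\<^sub>1 \<rightarrow> p\<^sub>0\<close>.
\<close>

type_synonym 'x plot_map = "'x param \<times> 'x param \<times> (pt \<Rightarrow> pt)"

definition plot_maps :: "'x dspace \<Rightarrow> 'x plot_map set" where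
  "plot_maps X = {(p1, p0, f). p1 \<in> plots X \<and> p0 \<in> plots X \<and>
     smooth_map (fst p1) (fst p0) f \<and> (\<forall>x\<in>fst p1. snd p0 (f x) = snd p1 x)}"

definition cocycle :: "'x dspace \<Rightarrow> 'g dgroup \<Rightarrow> ('x plot_map \<Rightarrow> pt \<Rightarrow> 'g) \<Rightarrow> bool" where
  "cocycle X G g \<longleftrightarrow> g \<in> extensional (plot_maps X) \<and>
     (\<forall>(p1, p0, f)\<in>plot_maps X. dsmooth (cart_space (fst p1)) (gspace G) (g (p1, p0, f))) \<and>
     (\<forall>p2 p1 p0 f1 f0. (p2, p1, f1) \<in> plot_maps X \<and> (p1, p0, f0) \<in> plot_maps X \<longrightarrow>
        (\<forall>x\<in>fst p2. g (p2, p0, compose (fst p2) f0 f1) x =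
           g (p1, p0, f0) (f1 x) \<otimes>\<^bsub>G\<^esub> g (p2, p1, f1) x))"

definition cocycle_map ::
    "'x dspace \<Rightarrow> 'g dgroup \<Rightarrow> ('x plot_map \<Rightarrow> pt \<Rightarrow> 'g) \<Rightarrow> ('x plot_map \<Rightarrow> pt \<Rightarrow> 'g) \<Rightarrow>
     ('x param \<Rightarrow> pt \<Rightarrow> 'g) \<Rightarrow> bool" where
  "cocycle_map X G g g' h \<longleftrightarrow> h \<in> extensional (plots X) \<and>
     (\<forall>p\<in>plots X. dsmooth (cart_space (fst p)) (gspace G) (h p)) \<and>
     (\<forall>(p1, p0, f)\<in>plot_maps X. \<forall>x\<in>fst p1.
        g' (p1, p0, f) x \<otimes>\<^bsub>G\<^esub> h p1 x = h p0 (f x) \<otimes>\<^bsub>G\<^esub> g (p1, p0, f) x)"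

definition Coc ::
    "'x dspace \<Rightarrow> 'g dgroup \<Rightarrow> ('x plot_map \<Rightarrow> pt \<Rightarrow> 'g, 'x param \<Rightarrow> pt \<Rightarrow> 'g) category" where
  "Coc X G = \<lparr>
     Ob = {g. cocycle X G g},
     Hom = (\<lambda>g g'. {h. cocycle_map X G g g' h}),
     Ident = (\<lambda>g. \<lambda>p\<in>plots X. \<lambda>x\<in>fst p. \<one>\<^bsub>G\<^esub>),
     Comp = (\<lambda>g g' g'' h' h. \<lambda>p\<in>plots X. \<lambda>x\<in>fst p. h' p x \<otimes>\<^bsub>G\<^esub> h p x)\<rparr>"

section \<open>The functor from cocycles to bundles\<close>

type_synonym ('x, 'g) prebundle_pt = "'x param \<times> (pt \<times> 'g)"

definition prebundle :: "'x dspace \<Rightarrow> 'g dgroup \<Rightarrow> ('x, 'g) prebundle_pt dspace" where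
  "prebundle X G = dcoprod (plots X) (\<lambda>p. dprod (cart_space (fst p)) (gspace G))"

definition cons_rel ::
    "'x dspace \<Rightarrow> 'g dgroup \<Rightarrow> ('x plot_map \<Rightarrow> pt \<Rightarrow> 'g) \<Rightarrow> ('x, 'g) prebundle_pt rel" where
  "cons_rel X G g = \<Inter>{r. equiv (points (prebundle X G)) r \<and>
     (\<forall>(p1, p0, f)\<in>plot_maps X. \<forall>x\<in>fst p1. \<forall>k\<in>carrier G.
        ((p1, x, k), (p0, f x, g (p1, p0, f) x \<otimes>\<^bsub>G\<^esub> k)) \<in> r)}"

text \<open>
  The equivalence classes are renamed along an injection \<open>\<iota>\<close> into the type \<open>'p\<close> from which the
  points of total spaces are taken. Bundles with points in an arbitrary type \<open>'q\<close> are covered by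
  taking a sum type with second summand \<open>'q\<close> for \<open>'p\<close> and \<^const>\<open>Inl\<close> for \<open>\<iota>\<close>.
\<close>

definition cons_class ::
    "(('x, 'g) prebundle_pt set \<Rightarrow> 'p) \<Rightarrow> 'x dspace \<Rightarrow> 'g dgroup \<Rightarrow>
     ('x plot_map \<Rightarrow> pt \<Rightarrow> 'g) \<Rightarrow> ('x, 'g) prebundle_pt \<Rightarrow> 'p" where
  "cons_class \<iota> X G g z = \<iota> (cons_rel X G g `` {z})"

definition cons_space ::
    "(('x, 'g) prebundle_pt set \<Rightarrow> 'p) \<Rightarrow> 'x dspace \<Rightarrow> 'g dgroup \<Rightarrow>
     ('x plot_map \<Rightarrow> pt \<Rightarrow> 'g) \<Rightarrow> 'p dspace" where
  "cons_space \<iota> X G g = dquot (prebundle X G) (cons_class \<iota> X G g)"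

text \<open>
  The functions below are defined on classes; \<open>THE\<close> picks the value that is common to all
  representatives.
\<close>

definition cons_bundle ::
    "(('x, 'g) prebundle_pt set \<Rightarrow> 'p) \<Rightarrow> 'x dspace \<Rightarrow> 'g dgroup \<Rightarrow>
     ('x plot_map \<Rightarrow> pt \<Rightarrow> 'g) \<Rightarrow> ('p, 'x, 'g) gbundle" where
  "cons_bundle \<iota> X G g = \<lparr>
     total = cons_space \<iota> X G g,
     bproj = (\<lambda>u\<in>points (cons_space \<iota> X G g).
        THE y. \<exists>p x k. (p, x, k) \<in> points (prebundle X G) \<and>
          u = cons_class \<iota> X G g (p, x, k) \<and> y = snd p x),
     act = (\<lambda>(u, l)\<in>points (cons_space \<iota> X G g) \<times> carrier G.
        THE v. \<exists>p x k. (p, x, k) \<in> points (prebundle X G) \<and>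
          u = cons_class \<iota> X G g (p, x, k) \<and> v = cons_class \<iota> X G g (p, x, k \<otimes>\<^bsub>G\<^esub> l))\<rparr>"

definition cons_map ::
    "(('x, 'g) prebundle_pt set \<Rightarrow> 'p) \<Rightarrow> 'x dspace \<Rightarrow> 'g dgroup \<Rightarrow>
     ('x plot_map \<Rightarrow> pt \<Rightarrow> 'g) \<Rightarrow> ('x plot_map \<Rightarrow> pt \<Rightarrow> 'g) \<Rightarrow> ('x param \<Rightarrow> pt \<Rightarrow> 'g) \<Rightarrow>
     'p \<Rightarrow> 'p" where
  "cons_map \<iota> X G g g' h = (\<lambda>u\<in>points (cons_space \<iota> X G g).
     THE v. \<exists>p x k. (p, x, k) \<in> points (prebundle X G) \<and>
       u = cons_class \<iota> X G g (p, x, k) \<and> v = cons_class \<iota> X G g' (p, x, h p x \<otimes>\<^bsub>G\<^esub> k))"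

definition Cons_functor ::
    "(('x, 'g) prebundle_pt set \<Rightarrow> 'p) \<Rightarrow> 'x dspace \<Rightarrow> 'g dgroup \<Rightarrow>
     ('x plot_map \<Rightarrow> pt \<Rightarrow> 'g, 'x param \<Rightarrow> pt \<Rightarrow> 'g, ('p, 'x, 'g) gbundle, 'p \<Rightarrow> 'p) cat_functor" where
  "Cons_functor \<iota> X G = \<lparr>on_Ob = cons_bundle \<iota> X G, on_Hom = cons_map \<iota> X G\<rparr>"

end

theory Submission
  imports Defs
begin

text \<open>
  For a cocycle \<open>g\<close> and a plot \<open>p\<close>, transport along the map of plots that sends the one-point plot at
  \<open>p x\<close> to \<open>x\<close> identifies the fibre of \<open>Cons g\<close> over \<open>p x\<close> with \<open>G\<close>; this decides the generated
  equivalence relation, so that \<open>Cons g\<close> is a principal bundle whose plots are locally of the form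
  \<open>v \<mapsto> [v, k v]\<close> in the component of their own projection. A bundle map
  \<open>\<phi> : Cons g \<rightarrow> Cons g'\<close> comes from the unique \<open>h\<close> with \<open>\<phi> [x, 1] = [x, h x]\<close>.

  Essential surjectivity amounts to lifting every plot \<open>p : U \<rightarrow> X\<close> to the total space of a bundle: from
  such lifts \<open>\<sigma>\<close>, the equation \<open>\<sigma>\<^bsub>p1\<^esub> = (\<sigma>\<^bsub>p0\<^esub> \<circ> f) \<cdot> g\<^bsub>f\<^esub>\<close> defines a cocycle. For \<open>U\<close> a Euclidean
  space, lifts exist on small boxes. Two lifts on overlapping boxes differ by a smooth map to \<open>G\<close>,
  which extends beyond the overlap after composition with a smooth retraction, so lifts can be glued
  one coordinate at a time; the same device makes lifts on an exhaustion by cubes compatible.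

  Boxes are diffeomorphic to Euclidean spaces and closed under intersection; this gives good
  refinements of arbitrary open covers, and lets smoothness be tested locally.
\<close>

section \<open>Smooth functions on open sets of Euclidean spaces\<close>

text \<open>The lifts are chosen plot by plot, with no coherence between them: the cocycle records
  by how much they fail to be compatible. All the geometry thus lies in lifting one plot at a time.
  Two difficulties shape that part. A bundle is not assumed to be locally trivial over
  \<open>X\<close>, so lifts exist only locally on the domain of a plot. And two lifts differ by a
  map into an arbitrary diffeological group, where values cannot be averaged or cut off as with a
  partition of unity. So the argument of such a map is modified instead of its value, which calls
  for explicit smooth functions that are the identity on one side and bounded on the other.

  Bundle maps are invertible without further hypotheses. This makes the target a groupoid, and it
  lets essential surjectivity stop at a mere bundle map.\<close>

lemma Rn_iff: "x \<in> Rn n \<longleftrightarrow> (\<forall>i\<ge>n. x i = 0)"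
  by (simp add: topspace_Euclidean_space)

lemma openin_Rn_iff: "openin (Euclidean_space n) W \<longleftrightarrow> openin (top_of_set (Rn n)) W"
  by (simp add: Euclidean_space_def euclidean_product_topology)

lemma openin_Rn_subset: "openin (Euclidean_space n) W \<Longrightarrow> W \<subseteq> Rn n"
  by (rule openin_subset)

lemma continuous_map_Rn_iff:
  assumes "W \<subseteq> Rn n"
  shows "continuous_map (subtopology (Euclidean_space n) W) euclideanreal f \<longleftrightarrow> continuous_on W f"
proof -
  have "subtopology (Euclidean_space n) W = top_of_set W"
    using assms by (simp add: Euclidean_space_def euclidean_product_topology subtopology_subtopology
        Int_absorb1)
  then show ?thesis by simp
qed

lemma fun_upd_continuous: "continuous_on A (\<lambda>t. (x::pt)(i := t))"
proof (rule continuous_on_coordinatewise_then_product)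
  show "continuous_on A (\<lambda>t. (x(i := t)) j)" for j
    by (cases "j = i") (auto intro: continuous_intros)
qed

lemma continuous_on_coord: "continuous_on A (\<lambda>x::pt. x j)"
  by (rule continuous_on_subset[OF continuous_on_product_coordinates subset_UNIV])

lemma openin_Rn_fun_upd:
  assumes "openin (Euclidean_space n) W" "x \<in> W" "i < n"
  shows "\<forall>\<^sub>F t in nhds (x i). x(i := t) \<in> W"
proof -
  obtain T where T: "open T" "W = Rn n \<inter> T"
    using assms(1) unfolding openin_Rn_iff openin_open by auto
  have "open ((\<lambda>t. x(i := t)) -` T)"
    using fun_upd_continuous[of UNIV x i] T(1) by (simp add: continuous_on_open_vimage)
  moreover have "x i \<in> (\<lambda>t. x(i := t)) -` T" using assms T by auto
  moreover have "x(i := t) \<in> Rn n" for t using assms T by (auto simp: Rn_iff)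
  ultimately show ?thesis
    unfolding eventually_nhds using T(2) by auto
qed

lemma Ck_continuous:
  assumes "openin (Euclidean_space n) W" "Ck n k W f"
  shows "continuous_on W f"
  using assms continuous_map_Rn_iff[OF openin_Rn_subset] by (cases k) auto

lemma Ck_SucD:
  assumes "Ck n (Suc k) W f" "i < n" "x \<in> W"
  shows "((\<lambda>t. f (x(i := t))) has_real_derivative part_deriv i f x) (at (x i))"
  using assms unfolding part_deriv_def by (auto simp: field_differentiable_derivI)

text \<open>Derivatives are taken along the lines \<open>t \<mapsto> x(i := t)\<close>, which stay
  in the open set \<open>W\<close> for \<open>t\<close> near \<open>x i\<close>. Hence the values on
  \<open>W\<close> determine the derivatives on \<open>W\<close>, at every order.\<close>

lemma Ck_cong:
  assumes "openin (Euclidean_space n) W" "Ck n k W f" "\<And>x. x \<in> W \<Longrightarrow> f x = g x"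
  shows "Ck n k W g"
  using assms(2,3)
proof (induction k arbitrary: f g)
  case 0
  then show ?case
    using continuous_map_Rn_iff[OF openin_Rn_subset[OF assms(1)]] by (auto cong: continuous_on_cong)
next
  case (Suc k)
  have ev: "\<forall>\<^sub>F t in nhds (x i). f (x(i := t)) = g (x(i := t))" if "i < n" "x \<in> W" for i x
    using openin_Rn_fun_upd[OF assms(1) that(2,1)] by eventually_elim (use Suc.prems in auto)
  have cont: "continuous_on W g"
    using Ck_continuous[OF assms(1) Suc.prems(1)] Suc.prems(2) by (auto cong: continuous_on_cong)
  have "(\<lambda>t. g (x(i := t))) field_differentiable at (x i)" if "i < n" "x \<in> W" for i x
    using Ck_SucD[OF Suc.prems(1) that] DERIV_cong_ev[OF refl ev[OF that] refl]
    unfolding field_differentiable_def by blast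
  moreover have "Ck n k W (part_deriv i g)" if "i < n" for i
  proof (rule Suc.IH)
    show "Ck n k W (part_deriv i f)" using Suc.prems that by auto
    show "part_deriv i f x = part_deriv i g x" if "x \<in> W" for x
      unfolding part_deriv_def using ev[OF \<open>i < n\<close> that] by (simp add: deriv_cong_ev)
  qed
  ultimately show ?case
    using cont continuous_map_Rn_iff[OF openin_Rn_subset[OF assms(1)]] by auto
qed

text \<open>Any family \<open>f'\<close> that gives the derivatives on \<open>W\<close> may stand in
  for \<open>part_deriv\<close>, whose values outside \<open>W\<close> are irrelevant. Later
  induction steps exhibit such formulas instead of computing with \<open>deriv\<close>.\<close>

lemma Ck_SucI:
  assumes "openin (Euclidean_space n) W" "continuous_on W f"
    and "\<And>i x. i < n \<Longrightarrow> x \<in> W \<Longrightarrow> ((\<lambda>t. f (x(i := t))) has_real_derivative f' i x) (at (x i))"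
    and "\<And>i. i < n \<Longrightarrow> Ck n k W (f' i)"
  shows "Ck n (Suc k) W f"
proof -
  have "part_deriv i f x = f' i x" if "i < n" "x \<in> W" for i x
    unfolding part_deriv_def using assms(3)[OF that] by (rule DERIV_imp_deriv)
  then have "Ck n k W (part_deriv i f)" if "i < n" for i
    using Ck_cong[OF assms(1) assms(4)[OF that], of "part_deriv i f"] that by auto
  moreover have "(\<lambda>t. f (x(i := t))) field_differentiable at (x i)" if "i < n" "x \<in> W" for i x
    using assms(3)[OF that] unfolding field_differentiable_def by blast
  ultimately show ?thesis
    using assms(2) continuous_map_Rn_iff[OF openin_Rn_subset[OF assms(1)]] by auto
qed

lemma Ck_Suc_imp:
  assumes "Ck n (Suc k) W f"
  shows "Ck n k W f"
  using assms
proof (induction k arbitrary: f)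
  case (Suc k)
  then show ?case by (metis Ck.simps(2))
qed auto

lemma Ck_subset:
  assumes "Ck n k W f" "V \<subseteq> W"
  shows "Ck n k V f"
  using assms(1)
proof (induction k arbitrary: f)
  case 0
  then show ?case
    using assms(2) by (simp add: continuous_map_from_subtopology_mono)
next
  case (Suc k)
  then show ?case
    using assms(2) by (auto simp: subset_iff intro: continuous_map_from_subtopology_mono)
qed

section \<open>Arithmetic and elementary functions of class C^k\<close>

lemma Ck_const: "openin (Euclidean_space n) W \<Longrightarrow> Ck n k W (\<lambda>x. c)"
proof (induction k arbitrary: c)
  case 0
  then show ?case by simp
next
  case (Suc k)
  show ?case
    by (rule Ck_SucI[OF Suc.prems, where f' = "\<lambda>i x. 0"]) (auto intro: Suc)
qed

lemma Ck_coord: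
  assumes "openin (Euclidean_space n) W"
  shows "Ck n k W (\<lambda>x. x j)"
proof (cases k)
  case 0
  then show ?thesis
    using continuous_map_Rn_iff[OF openin_Rn_subset[OF assms]] by (simp add: continuous_on_coord)
next
  case (Suc k')
  show ?thesis unfolding Suc
    by (rule Ck_SucI[OF assms continuous_on_coord, where f' = "\<lambda>i x. if i = j then 1 else 0"])
      (use Ck_const[OF assms] in \<open>auto simp: fun_upd_def intro!: derivative_eq_intros\<close>)
qed

lemma Ck_add:
  assumes "openin (Euclidean_space n) W" "Ck n k W f" "Ck n k W g"
  shows "Ck n k W (\<lambda>x. f x + g x)"
  using assms(2,3)
proof (induction k arbitrary: f g)
  case 0
  then show ?case by (auto intro: continuous_map_add)
next
  case (Suc k)
  show ?case
  proof (rule Ck_SucI[OF assms(1), where f' = "\<lambda>i x. part_deriv i f x + part_deriv i g x"])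
    show "continuous_on W (\<lambda>x. f x + g x)"
      using Suc.prems Ck_continuous[OF assms(1)] by (blast intro: continuous_on_add)
    show "((\<lambda>t. f (x(i := t)) + g (x(i := t))) has_real_derivative
             part_deriv i f x + part_deriv i g x) (at (x i))" if "i < n" "x \<in> W" for i x
      using Ck_SucD[OF Suc.prems(1) that] Ck_SucD[OF Suc.prems(2) that] by (rule DERIV_add)
    show "Ck n k W (\<lambda>x. part_deriv i f x + part_deriv i g x)" if "i < n" for i
      using Suc that by auto
  qed
qed

lemma Ck_mult:
  assumes "openin (Euclidean_space n) W" "Ck n k W f" "Ck n k W g"
  shows "Ck n k W (\<lambda>x. f x * g x)"
  using assms(2,3)
proof (induction k arbitrary: f g)
  case 0
  then show ?case by (auto intro: continuous_map_real_mult)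
next
  case (Suc k)
  show ?case
  proof (rule Ck_SucI[OF assms(1),
        where f' = "\<lambda>i x. f x * part_deriv i g x + part_deriv i f x * g x"])
    show "continuous_on W (\<lambda>x. f x * g x)"
      using Suc.prems Ck_continuous[OF assms(1)] by (blast intro: continuous_on_mult)
    show "((\<lambda>t. f (x(i := t)) * g (x(i := t))) has_real_derivative
             f x * part_deriv i g x + part_deriv i f x * g x) (at (x i))" if "i < n" "x \<in> W" for i x
      by (rule DERIV_cong[OF DERIV_mult'[OF Ck_SucD[OF Suc.prems(1) that] Ck_SucD[OF Suc.prems(2) that]]])
        simp
    show "Ck n k W (\<lambda>x. f x * part_deriv i g x + part_deriv i f x * g x)" if "i < n" for i
      using Suc.prems that
      by (intro Ck_add[OF assms(1)] Suc.IH) (auto simp del: Ck.simps simp: Ck_Suc_imp, auto)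
  qed
qed

lemma Ck_sum:
  assumes "openin (Euclidean_space n) W" "finite A" "\<And>j. j \<in> A \<Longrightarrow> Ck n k W (f j)"
  shows "Ck n k W (\<lambda>x. \<Sum>j\<in>A. f j x)"
  using assms(2,3)
  by (induction A rule: finite_induct) (auto intro: Ck_const[OF assms(1)] Ck_add[OF assms(1)])

lemma Ck_minus:
  assumes "openin (Euclidean_space n) W" "Ck n k W f"
  shows "Ck n k W (\<lambda>x. - f x)"
  using Ck_mult[OF assms(1) Ck_const[OF assms(1), where c = "-1"] assms(2)] by simp

lemma Ck_diff:
  assumes "openin (Euclidean_space n) W" "Ck n k W f" "Ck n k W g"
  shows "Ck n k W (\<lambda>x. f x - g x)"
  using Ck_add[OF assms(1,2) Ck_minus[OF assms(1,3)]] by simp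

text \<open>The regularity of \<open>\<phi>'\<close> is asked only of its composite with
  \<open>f\<close>. For functions whose derivative is again expressed through functions of the same
  kind, such as \<open>exp\<close>, \<open>inverse\<close> and \<open>flat\<close>, that is just the
  induction hypothesis, so no general chain rule is involved.\<close>

lemma Ck_Suc_compose_real:
  assumes W: "openin (Euclidean_space n) W" and f: "Ck n (Suc k) W f"
    and d: "\<And>x. x \<in> W \<Longrightarrow> (\<phi> has_real_derivative \<phi>' (f x)) (at (f x))"
    and \<phi>': "Ck n k W (\<lambda>x. \<phi>' (f x))"
  shows "Ck n (Suc k) W (\<lambda>x. \<phi> (f x))"
proof (rule Ck_SucI[OF W, where f' = "\<lambda>i x. \<phi>' (f x) * part_deriv i f x"])
  have "continuous_on (f ` W) \<phi>"
    using d by (auto intro!: continuous_at_imp_continuous_on DERIV_isCont)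
  then show "continuous_on W (\<lambda>x. \<phi> (f x))"
    using continuous_on_compose2[OF _ Ck_continuous[OF W f]] by blast
  show "((\<lambda>t. \<phi> (f (x(i := t)))) has_real_derivative \<phi>' (f x) * part_deriv i f x) (at (x i))"
    if "i < n" "x \<in> W" for i x
    by (rule DERIV_chain2[OF _ Ck_SucD[OF f that]]) (use d[OF that(2)] in simp)
  show "Ck n k W (\<lambda>x. \<phi>' (f x) * part_deriv i f x)" if "i < n" for i
    using Ck_mult[OF W \<phi>'] f that by auto
qed

lemma Ck_inverse:
  assumes W: "openin (Euclidean_space n) W" and f: "Ck n k W f" and "\<And>x. x \<in> W \<Longrightarrow> f x \<noteq> 0"
  shows "Ck n k W (\<lambda>x. inverse (f x))"
  using f
proof (induction k)
  case 0
  then show ?case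
    using assms(3) by (simp add: continuous_map_Rn_iff[OF openin_Rn_subset[OF W]] continuous_on_inverse)
next
  case (Suc k)
  note IH = Suc.IH[OF Ck_Suc_imp[OF Suc.prems]]
  show ?case
    by (rule Ck_Suc_compose_real[OF W Suc.prems, where \<phi> = inverse and \<phi>' = "\<lambda>t. - (inverse t * inverse t)"])
      (use assms(3) in \<open>auto intro!: Ck_minus[OF W] Ck_mult[OF W] IH derivative_eq_intros\<close>)
qed

lemma Ck_exp:
  assumes W: "openin (Euclidean_space n) W" and f: "Ck n k W f"
  shows "Ck n k W (\<lambda>x. exp (f x))"
  using f
proof (induction k)
  case 0
  then show ?case
    by (simp add: continuous_map_Rn_iff[OF openin_Rn_subset[OF W]] continuous_on_exp)
next
  case (Suc k)
  show ?case
    by (rule Ck_Suc_compose_real[OF W Suc.prems, where \<phi>' = exp])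
      (use Suc.IH[OF Ck_Suc_imp[OF Suc.prems]] in auto)
qed

lemma Ck_ln:
  assumes W: "openin (Euclidean_space n) W" and f: "Ck n k W f" and pos: "\<And>x. x \<in> W \<Longrightarrow> f x > 0"
  shows "Ck n k W (\<lambda>x. ln (f x))"
proof (cases k)
  case 0
  then show ?thesis
    using f pos
    by (fastforce simp: continuous_map_Rn_iff[OF openin_Rn_subset[OF W]] intro: continuous_on_ln)
next
  case (Suc k')
  have f': "Ck n (Suc k') W f" using f Suc by simp
  show ?thesis unfolding Suc
  proof (rule Ck_Suc_compose_real[OF W f', where \<phi>' = inverse])
    show "(ln has_real_derivative inverse (f x)) (at (f x))" if "x \<in> W" for x
      using DERIV_ln[OF pos[OF that]] .
    show "Ck n k' W (\<lambda>x. inverse (f x))"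
      using Ck_inverse[OF W Ck_Suc_imp[OF f']] pos by force
  qed
qed

text \<open>The exponent \<open>m\<close> makes the span of this family closed under differentiation.\<close>

definition flat :: "nat \<Rightarrow> real \<Rightarrow> real" where
  "flat m t = (if t > 0 then exp (- inverse t) * inverse t ^ m else 0)"

text \<open>With \<open>u = 1 / t\<close> this is the decay of \<open>u ^ m / exp u\<close> at
  infinity.\<close>

lemma flat_tendsto_0: "(flat m \<longlongrightarrow> 0) (at_right 0)"
proof -
  have "((\<lambda>u::real. u ^ m / exp u) \<longlongrightarrow> 0) at_top"
    by (rule tendsto_power_div_exp_0)
  then have "((\<lambda>t::real. inverse t ^ m / exp (inverse t)) \<longlongrightarrow> 0) (at_right 0)"
    by (rule filterlim_compose[OF _ filterlim_inverse_at_top_right])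
  then show ?thesis
    by (rule Lim_transform_eventually)
      (auto simp: flat_def exp_minus field_simps eventually_at_filter)
qed

text \<open>Away from 0 the defining formulas are differentiated. At 0 the right difference quotient
  of \<open>flat m\<close> is \<open>flat (Suc m)\<close>, which tends to 0, and the left one
  vanishes.\<close>

lemma flat_has_derivative:
  "(flat m has_real_derivative flat (m + 2) t - real m * flat (m + 1) t) (at t)"
proof (cases "t = 0")
  case False
  show ?thesis
  proof (cases "t > 0")
    case True
    have e: "((\<lambda>t. exp (- inverse t)) has_real_derivative exp (- inverse t) * inverse t ^ 2) (at t)"
      using True by (auto intro!: derivative_eq_intros simp: power2_eq_square)
    have p: "((\<lambda>t. inverse t ^ m) has_real_derivative - (real m * inverse t ^ (m + 1))) (at t)"
    proof (cases m)
      case (Suc l)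
      show ?thesis unfolding Suc
        by (rule DERIV_cong[OF DERIV_power_Suc[OF DERIV_inverse]])
          (use True in \<open>auto simp: power_add power2_eq_square\<close>)
    qed simp
    have "((\<lambda>t. exp (- inverse t) * inverse t ^ m) has_real_derivative
        flat (m + 2) t - real m * flat (m + 1) t) (at t)"
      by (rule DERIV_cong[OF DERIV_mult'[OF e p]])
        (use True in \<open>simp add: flat_def power_add power2_eq_square algebra_simps\<close>)
    moreover have "\<forall>\<^sub>F s in nhds t. flat m s = exp (- inverse s) * inverse s ^ m"
      using eventually_nhds_in_open[of "{0<..}" t] True
      by (auto simp: flat_def elim!: eventually_mono)
    ultimately show ?thesis by (subst DERIV_cong_ev[OF refl _ refl])
  next
    case f: False
    with False have "t < 0" by simp
    have "((\<lambda>t. 0) has_real_derivative flat (m + 2) t - real m * flat (m + 1) t) (at t)"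
      using \<open>t < 0\<close> by (auto simp: flat_def)
    moreover have "\<forall>\<^sub>F s in nhds t. flat m s = 0"
      using eventually_nhds_in_open[of "{..<0}" t] \<open>t < 0\<close>
      by (auto simp: flat_def elim!: eventually_mono)
    ultimately show ?thesis by (subst DERIV_cong_ev[OF refl _ refl])
  qed
next
  case True
  have "((\<lambda>s. (flat m s - flat m 0) / (s - 0)) \<longlongrightarrow> 0) (at_right 0)"
    by (rule Lim_transform_eventually[OF flat_tendsto_0[of "Suc m"]])
      (auto simp: flat_def field_simps eventually_at_filter)
  moreover have "((\<lambda>s. (flat m s - flat m 0) / (s - 0)) \<longlongrightarrow> 0) (at_left 0)"
    by (rule Lim_transform_eventually[OF tendsto_const])
      (auto simp: flat_def field_simps eventually_at_filter)
  ultimately have "((\<lambda>s. (flat m s - flat m 0) / (s - 0)) \<longlongrightarrow> 0) (at 0)"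
    by (simp add: filterlim_at_split)
  then show ?thesis
    unfolding True has_field_derivative_iff by (simp add: flat_def)
qed

lemma Ck_flat:
  assumes W: "openin (Euclidean_space n) W" and f: "Ck n k W f"
  shows "Ck n k W (\<lambda>x. flat m (f x))"
  using f
proof (induction k arbitrary: m)
  case 0
  have "continuous_on UNIV (flat m)"
    using DERIV_isCont[OF flat_has_derivative] by (auto intro: continuous_at_imp_continuous_on)
  then show ?case
    using continuous_on_compose2[OF _ Ck_continuous[OF W 0] subset_UNIV, of "flat m"]
    by (simp add: continuous_map_Rn_iff[OF openin_Rn_subset[OF W]])
next
  case (Suc k)
  note IH = Suc.IH[OF Ck_Suc_imp[OF Suc.prems]]
  show ?case
    by (rule Ck_Suc_compose_real[OF W Suc.prems flat_has_derivative])
      (intro Ck_diff[OF W] Ck_mult[OF W] Ck_const[OF W] IH)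
qed

section \<open>Open boxes and the chain rule\<close>

definition open_box :: "nat \<Rightarrow> pt \<Rightarrow> pt \<Rightarrow> pt set" where
  "open_box n a b = {x \<in> Rn n. \<forall>i<n. a i < x i \<and> x i < b i}"

lemma openin_open_box: "openin (Euclidean_space n) (open_box n a b)"
proof -
  have "open_box n a b = Rn n \<inter> (\<Inter>i\<in>{..<n}. (\<lambda>x. x i) -` {a i<..<b i})"
    by (auto simp: open_box_def)
  moreover have "open (\<Inter>i\<in>{..<n}. (\<lambda>x::pt. x i) -` {a i<..<b i})"
    by (intro open_INT ballI open_vimage continuous_on_coord) auto
  ultimately show ?thesis
    unfolding openin_Rn_iff openin_open by blast
qed

text \<open>Coordinates from \<open>n\<close> on vanish throughout \<open>Rn n\<close>, so only the
  first \<open>n\<close> factors of a product neighbourhood constrain a point, and finitely many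
  radii have a positive minimum.\<close>

lemma open_box_nbhd:
  assumes "openin (Euclidean_space n) W" "x \<in> W"
  obtains e where "e > 0" "open_box n (\<lambda>i. x i - e) (\<lambda>i. x i + e) \<subseteq> W"
proof -
  obtain T where T: "open T" "W = Rn n \<inter> T"
    using assms(1) unfolding openin_Rn_iff openin_open by auto
  have "openin (powertop_real UNIV) T" "x \<in> T"
    using T assms(2) by (auto simp: euclidean_product_topology)
  from product_topology_open_contains_basis[OF this]
  obtain X where X: "x \<in> (\<Pi>\<^sub>E i\<in>UNIV. X i)" "\<And>i. open (X i)" "(\<Pi>\<^sub>E i\<in>UNIV. X i) \<subseteq> T"
    by auto
  have "\<exists>e>0. \<forall>y. \<bar>y - x i\<bar> < e \<longrightarrow> y \<in> X i" for i
    using X(1) X(2)[of i] by (auto simp: open_dist dist_real_def PiE_iff)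
  then obtain e where e: "\<And>i. e i > 0" "\<And>i y. \<bar>y - x i\<bar> < e i \<Longrightarrow> y \<in> X i" by metis
  \<comment> \<open>The extra element 1 keeps the set nonempty when \<open>n = 0\<close>.\<close>
  define d where "d = Min (insert 1 (e ` {..<n}))"
  have d: "d > 0" "\<And>i. i < n \<Longrightarrow> d \<le> e i"
    using e(1) by (auto simp: d_def)
  have "y \<in> W" if y: "y \<in> open_box n (\<lambda>i. x i - d) (\<lambda>i. x i + d)" for y
  proof -
    have "y i \<in> X i" for i
    proof (cases "i < n")
      case True
      then show ?thesis using y d(2)[of i] by (intro e(2)) (auto simp: open_box_def abs_less_iff)
    next
      case False
      then have "y i = x i" using y assms(2) T by (auto simp: open_box_def Rn_iff)
      then show ?thesis using X(1) by auto
    qed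
    then show ?thesis using X(3) y T by (auto simp: open_box_def)
  qed
  then show ?thesis using that d(1) by blast
qed

text \<open>The case of one varying argument; the full chain rule telescopes over the arguments.\<close>

lemma partial_chain_rule:
  assumes W: "openin (Euclidean_space m) W" and G: "Ck m (Suc 0) W G" and j: "j < m"
    and u: "\<And>i. isCont (\<lambda>t. u t i) t0" and uR: "\<And>t. u t \<in> Rn m" and u0: "u t0 \<in> W"
    and c: "(c has_real_derivative c') (at t0)" and c0: "u t0 j = c t0"
  shows "((\<lambda>t. G ((u t)(j := c t)) - G ((u t)(j := c t0))) has_real_derivative
           part_deriv j G (u t0) * c') (at t0)"
proof -
  obtain e where e: "e > 0" "open_box m (\<lambda>i. u t0 i - e) (\<lambda>i. u t0 i + e) \<subseteq> W"
    using open_box_nbhd[OF W u0] by blast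
  have near: "\<forall>\<^sub>F t in at t0. \<forall>i<m. \<bar>u t i - u t0 i\<bar> < e"
  proof -
    have "\<forall>\<^sub>F t in at t0. \<bar>u t i - u t0 i\<bar> < e" for i
      using tendstoD[OF u[of i, unfolded isCont_def] e(1)] by (simp add: dist_real_def)
    then have "\<forall>\<^sub>F t in at t0. \<forall>i\<in>{..<m}. \<bar>u t i - u t0 i\<bar> < e"
      by (intro eventually_ball_finite) auto
    then show ?thesis by (simp add: lessThan_iff Ball_def)
  qed
  have cc: "isCont c t0" using c by (rule DERIV_isCont)
  have nearc: "\<forall>\<^sub>F t in at t0. \<bar>c t - c t0\<bar> < e"
    using tendstoD[OF cc[unfolded isCont_def] e(1)] by (simp add: dist_real_def)
  have "\<forall>\<^sub>F t in at t0. \<exists>\<xi>. \<bar>\<xi> - c t0\<bar> \<le> \<bar>c t - c t0\<bar> \<and> (u t)(j := \<xi>) \<in> W \<and>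
      G ((u t)(j := c t)) - G ((u t)(j := c t0)) =
      (c t - c t0) * part_deriv j G ((u t)(j := \<xi>))"
    using near nearc
  proof eventually_elim
    case (elim t)
    have inW: "(u t)(j := s) \<in> W" if "\<bar>s - c t0\<bar> \<le> \<bar>c t - c t0\<bar>" for s
    proof -
      have "(u t)(j := s) \<in> open_box m (\<lambda>i. u t0 i - e) (\<lambda>i. u t0 i + e)"
        using elim that j uR[of t] c0 by (auto simp: open_box_def Rn_iff abs_less_iff)
      then show ?thesis using e(2) by blast
    qed
    have der: "((\<lambda>s. G ((u t)(j := s))) has_real_derivative part_deriv j G ((u t)(j := s))) (at s)"
      if "\<bar>s - c t0\<bar> \<le> \<bar>c t - c t0\<bar>" for s
      using Ck_SucD[OF G j inW[OF that]] by simp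
    \<comment> \<open>The mean value theorem is applied for each \<open>t\<close> separately,
      because the base point \<open>u t\<close> moves as well. The intermediate points converge to
      \<open>c t0\<close>, and continuity of the partial derivative then gives the limit of the
      difference quotient.\<close>
    consider "c t = c t0" | "c t0 < c t" | "c t < c t0" by linarith
    then show ?case
    proof cases
      case 1
      then show ?thesis using inW[of "c t0"] by auto
    next
      case 2
      obtain z where "c t0 < z" "z < c t" "G ((u t)(j := c t)) - G ((u t)(j := c t0)) =
          (c t - c t0) * part_deriv j G ((u t)(j := z))"
        using MVT2[OF 2, of "\<lambda>s. G ((u t)(j := s))" "\<lambda>s. part_deriv j G ((u t)(j := s))"]
          der by auto
      then show ?thesis using inW[of z] by (intro exI[of _ z]) auto
    next
      case 3
      obtain z where "c t < z" "z < c t0" "G ((u t)(j := c t0)) - G ((u t)(j := c t)) =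
          (c t0 - c t) * part_deriv j G ((u t)(j := z))"
        using MVT2[OF 3, of "\<lambda>s. G ((u t)(j := s))" "\<lambda>s. part_deriv j G ((u t)(j := s))"]
          der by auto
      then show ?thesis using inW[of z] by (intro exI[of _ z]) (auto simp: algebra_simps)
    qed
  qed
  then obtain \<xi> where \<xi>: "\<forall>\<^sub>F t in at t0. \<bar>\<xi> t - c t0\<bar> \<le> \<bar>c t - c t0\<bar> \<and> (u t)(j := \<xi> t) \<in> W \<and>
      G ((u t)(j := c t)) - G ((u t)(j := c t0)) =
      (c t - c t0) * part_deriv j G ((u t)(j := \<xi> t))"
    unfolding eventually_ex by blast
  have "((\<lambda>t. \<xi> t - c t0) \<longlongrightarrow> 0) (at t0)"
    by (rule tendsto_rabs_zero_cancel, rule tendsto_sandwich[of "\<lambda>_. 0" _ _ "\<lambda>t. \<bar>c t - c t0\<bar>"])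
      (use \<xi> cc in \<open>auto elim: eventually_mono simp: isCont_def LIM_zero_iff tendsto_rabs_zero_iff\<close>)
  then have lim\<xi>: "(\<xi> \<longlongrightarrow> c t0) (at t0)" by (simp add: LIM_zero_iff)
  have lim: "((\<lambda>t. (u t)(j := \<xi> t)) \<longlongrightarrow> u t0) (at t0)"
  proof -
    have "((\<lambda>t. ((u t)(j := \<xi> t)) i) \<longlongrightarrow> u t0 i) (at t0)" for i
      using lim\<xi> c0 u[of i] by (cases "i = j") (auto simp: isCont_def)
    then have "limitin (powertop_real UNIV) (\<lambda>t. (u t)(j := \<xi> t)) (u t0) (at t0)"
      by (simp add: limitin_componentwise)
    then show ?thesis by (simp add: euclidean_product_topology)
  qed
  have contG: "continuous_on W (part_deriv j G)"
    using G j Ck_continuous[OF W, of 0] by auto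
  have "((\<lambda>t. part_deriv j G ((u t)(j := \<xi> t))) \<longlongrightarrow> part_deriv j G (u t0)) (at t0)"
    using \<xi> by (intro continuous_on_tendsto_compose[OF contG lim u0]) (auto elim: eventually_mono)
  moreover have "((\<lambda>t. (c t - c t0) / (t - t0)) \<longlongrightarrow> c') (at t0)"
    using c by (simp add: has_field_derivative_iff)
  ultimately have "((\<lambda>t. part_deriv j G ((u t)(j := \<xi> t)) * ((c t - c t0) / (t - t0))) \<longlongrightarrow>
      part_deriv j G (u t0) * c') (at t0)"
    by (rule tendsto_mult)
  then have "((\<lambda>t. (G ((u t)(j := c t)) - G ((u t)(j := c t0))) / (t - t0)) \<longlongrightarrow>
      part_deriv j G (u t0) * c') (at t0)"
    by (rule Lim_transform_eventually) (use \<xi> in \<open>auto elim!: eventually_mono\<close>)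
  then show ?thesis
    by (simp add: has_field_derivative_iff)
qed

lemma chain_rule:
  assumes W: "openin (Euclidean_space m) W" and G: "Ck m (Suc 0) W G"
    and c: "\<And>j. j < m \<Longrightarrow> ((\<lambda>t. c t j) has_real_derivative c' j) (at t0)"
    and cR: "\<And>t. c t \<in> Rn m" and c0: "c t0 \<in> W"
  shows "((\<lambda>t. G (c t)) has_real_derivative (\<Sum>j<m. part_deriv j G (c t0) * c' j)) (at t0)"
proof -
  \<comment> \<open>The first \<open>j\<close> coordinates follow the curve and the others are
    frozen at time \<open>t0\<close>; consecutive stages differ in one coordinate only.\<close>
  define h where "h j t = (\<lambda>i. if i < j then c t i else c t0 i)" for j t
  have "((\<lambda>t. G (h j t)) has_real_derivative (\<Sum>i<j. part_deriv i G (c t0) * c' i)) (at t0)"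
    if "j \<le> m" for j
    using that
  proof (induction j)
    case 0
    then show ?case by (simp add: h_def)
  next
    case (Suc j)
    then have j: "j < m" by simp
    have h0: "h j t0 = c t0" by (auto simp: h_def)
    have "isCont (\<lambda>t. h j t i) t0" for i
      using c[of i] j by (cases "i < j") (auto simp: h_def intro: DERIV_isCont)
    moreover have "h j t \<in> Rn m" for t using cR[of t] cR[of t0] by (auto simp: h_def Rn_iff)
    ultimately have "((\<lambda>t. G ((h j t)(j := c t j)) - G ((h j t)(j := c t0 j))) has_real_derivative
           part_deriv j G (h j t0) * c' j) (at t0)"
      by (intro partial_chain_rule[OF W G j _ _ _ c[OF j]]) (auto simp: h0 c0)
    moreover have "(h j t)(j := c t j) = h (Suc j) t" "(h j t)(j := c t0 j) = h j t" for t
      by (auto simp: h_def less_Suc_eq)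
    ultimately have "((\<lambda>t. G (h (Suc j) t) - G (h j t)) has_real_derivative
        part_deriv j G (c t0) * c' j) (at t0)"
      by (simp add: h0)
    from DERIV_add[OF this Suc.IH] j show ?case by (simp add: add.commute)
  qed
  from this[of m] have "((\<lambda>t. G (h m t)) has_real_derivative
      (\<Sum>j<m. part_deriv j G (c t0) * c' j)) (at t0)" by simp
  moreover have "h m t = c t" for t using cR[of t] cR[of t0] by (auto simp: h_def Rn_iff)
  ultimately show ?thesis by simp
qed

text \<open>Each partial derivative of the composite is a finite sum of products of a partial
  derivative of \<open>G\<close>, composed with \<open>F\<close>, and a partial derivative of a
  component of \<open>F\<close>; hence the induction over the order with \<open>G\<close> arbitrary.
  \<open>FR\<close> is asked at every \<open>y\<close> because the chain rule follows
  \<open>F\<close> along whole coordinate lines, which may leave \<open>W\<close>.\<close>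

lemma Ck_compose:
  assumes W: "openin (Euclidean_space n) W" and V: "openin (Euclidean_space m) V"
    and F: "\<And>j. j < m \<Longrightarrow> Ck n k W (\<lambda>y. F y j)" and FR: "\<And>y. F y \<in> Rn m"
    and FV: "\<And>y. y \<in> W \<Longrightarrow> F y \<in> V" and G: "Ck m k V G"
  shows "Ck n k W (\<lambda>y. G (F y))"
  using F G
proof (induction k arbitrary: G)
  case 0
  have "continuous_on W (\<lambda>y. F y j)" for j
    using Ck_continuous[OF W 0(1)] FR by (cases "j < m") (auto simp: Rn_iff)
  then have "continuous_on W F" by (rule continuous_on_coordinatewise_then_product)
  then show ?case
    using Ck_continuous[OF V 0(2)] FV continuous_on_compose2[of V G W F]
    by (auto simp: continuous_map_Rn_iff[OF openin_Rn_subset[OF W]])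
next
  case (Suc k)
  have der: "((\<lambda>t. G (F (x(i := t)))) has_real_derivative
      (\<Sum>j<m. part_deriv j G (F x) * part_deriv i (\<lambda>y. F y j) x)) (at (x i))"
    if "i < n" "x \<in> W" for i x
  proof -
    have "Ck m (Suc 0) V G"
      using Suc.prems(2) by (induction k) (auto dest: Ck_Suc_imp)
    from chain_rule[OF V this, where c = "\<lambda>t. F (x(i := t))", OF Ck_SucD[OF Suc.prems(1) that]]
    show ?thesis using FR FV that by simp
  qed
  have Fk: "Ck n k W (\<lambda>y. F y j)" if "j < m" for j
    using Ck_Suc_imp[OF Suc.prems(1)[OF that]] .
  show ?case
  proof (rule Ck_SucI[OF W _ der])
    have "continuous_on W (\<lambda>y. F y j)" for j
      using Ck_continuous[OF W Suc.prems(1)] FR by (cases "j < m") (auto simp: Rn_iff)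
    then have "continuous_on W F" by (rule continuous_on_coordinatewise_then_product)
    then show "continuous_on W (\<lambda>y. G (F y))"
      using Ck_continuous[OF V Suc.prems(2)] FV continuous_on_compose2[of V G W F] by auto
    show "Ck n k W (\<lambda>x. \<Sum>j<m. part_deriv j G (F x) * part_deriv i (\<lambda>y. F y j) x)"
      if "i < n" for i
    proof (intro Ck_sum[OF W] Ck_mult[OF W])
      fix j assume "j \<in> {..<m}"
      then have j: "j < m" by simp
      show "Ck n k W (\<lambda>x. part_deriv j G (F x))"
        using Suc.IH[OF Fk, of "part_deriv j G"] Suc.prems(2) j by auto
      show "Ck n k W (part_deriv i (\<lambda>y. F y j))"
        using Suc.prems(1)[OF j] that by auto
    qed auto
  qed
qed

section \<open>Smooth maps and good covers\<close>

text \<open>The local clause of \<open>smooth_map\<close> with the ambient dimension as a parameter.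
  By \<open>smooth_at_dim\<close> the choice of that dimension is a matter of convenience.\<close>

definition smooth_at :: "nat \<Rightarrow> pt set \<Rightarrow> (pt \<Rightarrow> pt) \<Rightarrow> pt \<Rightarrow> bool" where
  "smooth_at n S f x \<longleftrightarrow> (\<exists>W F. openin (Euclidean_space n) W \<and> x \<in> W \<and>
     (\<forall>j k. Ck n k W (\<lambda>y. F y j)) \<and> (\<forall>y\<in>S \<inter> W. F y = f y))"

lemma smooth_map_iff:
  "smooth_map S T f \<longleftrightarrow> f \<in> S \<rightarrow>\<^sub>E T \<and> (\<exists>n. S \<subseteq> Rn n \<and> (\<forall>x\<in>S. smooth_at n S f x))"
  unfolding smooth_map_def smooth_at_def ..

lemma smooth_mapD: "smooth_map S T f \<Longrightarrow> f \<in> S \<rightarrow>\<^sub>E T"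
  by (simp add: smooth_map_def)

lemma smooth_map_in: "smooth_map S T f \<Longrightarrow> x \<in> S \<Longrightarrow> f x \<in> T"
  by (auto simp: smooth_map_def)

lemma openin_Rn_coord_preimage:
  assumes W: "openin (Euclidean_space n) W" and F: "continuous_on W F"
    and V: "openin (Euclidean_space m) V" and FR: "\<And>y. F y \<in> Rn m"
  shows "openin (Euclidean_space n) {y \<in> W. F y \<in> V}"
proof -
  obtain T where T: "open T" "V = Rn m \<inter> T"
    using V unfolding openin_Rn_iff openin_open by auto
  have "openin (top_of_set W) (W \<inter> F -` T)"
    using F T(1) by (rule continuous_openin_preimage_gen)
  moreover have "W \<inter> F -` T = {y \<in> W. F y \<in> V}" using T(2) FR by auto
  ultimately show ?thesis
    using W openin_trans unfolding openin_Rn_iff by metis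
qed

lemma smooth_at_compose:
  assumes f: "smooth_at n S f x" and g: "smooth_at m T g (f x)"
    and fT: "\<And>y. y \<in> S \<Longrightarrow> f y \<in> T" and T: "T \<subseteq> Rn m" and x: "x \<in> S"
    and h: "\<And>y. y \<in> S \<Longrightarrow> h y = g (f y)"
  shows "smooth_at n S h x"
proof -
  obtain W F where W: "openin (Euclidean_space n) W" "x \<in> W" "\<And>j k. Ck n k W (\<lambda>y. F y j)"
      "\<And>y. y \<in> S \<Longrightarrow> y \<in> W \<Longrightarrow> F y = f y"
    using f unfolding smooth_at_def by blast
  obtain V H where V: "openin (Euclidean_space m) V" "f x \<in> V" "\<And>j k. Ck m k V (\<lambda>y. H y j)"
      "\<And>y. y \<in> T \<Longrightarrow> y \<in> V \<Longrightarrow> H y = g y"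
    using g unfolding smooth_at_def by blast
  define E where "E y = (\<lambda>j. if j < m then F y j else 0)" for y
  have ER: "E y \<in> Rn m" for y by (simp add: E_def Rn_iff)
  have Ef: "E y = f y" if "y \<in> S" "y \<in> W" for y
    using W(4)[OF that] fT[OF that(1)] T by (fastforce simp: E_def Rn_iff)
  have EC: "Ck n k W (\<lambda>y. E y j)" for j k
    using W(3) Ck_const[OF W(1)] by (cases "j < m") (auto simp: E_def)
  define W' where "W' = {y \<in> W. E y \<in> V}"
  have "continuous_on W E"
    using Ck_continuous[OF W(1) EC] by (rule continuous_on_coordinatewise_then_product)
  then have W': "openin (Euclidean_space n) W'"
    unfolding W'_def by (rule openin_Rn_coord_preimage[OF W(1) _ V(1) ER])
  have "Ck n k W' (\<lambda>y. H (E y) j)" for j k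
  proof (rule Ck_compose[OF W' V(1) _ ER _ V(3)])
    show "Ck n k W' (\<lambda>y. E y i)" for i
      by (rule Ck_subset[OF EC]) (auto simp: W'_def)
    show "E y \<in> V" if "y \<in> W'" for y using that by (simp add: W'_def)
  qed
  moreover have "H (E y) = h y" if "y \<in> S \<inter> W'" for y
    using that V(4)[of "f y"] fT Ef h by (auto simp: W'_def)
  moreover have "x \<in> W'" using Ef[OF x W(2)] W(2) V(2) by (simp add: W'_def)
  ultimately show ?thesis using W' unfolding smooth_at_def by (intro exI[of _ W'] exI[of _ "\<lambda>y. H (E y)"]) blast
qed

lemma smooth_at_id:
  assumes "S \<subseteq> Rn n" "x \<in> S" "\<And>y. y \<in> S \<Longrightarrow> f y = y"
  shows "smooth_at n S f x"
  unfolding smooth_at_def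
  by (intro exI[of _ "Rn n"] exI[of _ "\<lambda>y. y"]) (use assms in \<open>auto intro: Ck_coord\<close>)

text \<open>Compose with the identity of \<open>S\<close>, regarded as a map out of a subset of the
  \<open>n\<close>-dimensional space.\<close>

lemma smooth_at_dim:
  assumes "smooth_at m S f x" "S \<subseteq> Rn m" "S \<subseteq> Rn n" "x \<in> S"
  shows "smooth_at n S f x"
  by (rule smooth_at_compose[OF smooth_at_id[OF assms(3,4), of "\<lambda>y. y"], of m S f])
    (use assms in auto)

lemma smooth_map_at:
  assumes "smooth_map S T f" "S \<subseteq> Rn n" "x \<in> S"
  shows "smooth_at n S f x"
  using assms smooth_at_dim unfolding smooth_map_iff by blast

lemma smooth_map_dom: "smooth_map S T f \<Longrightarrow> \<exists>n. S \<subseteq> Rn n"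
  unfolding smooth_map_def by blast

lemma smooth_map_compose:
  assumes f: "smooth_map S T f" and g: "smooth_map T R g"
  shows "smooth_map S R (compose S g f)"
proof -
  obtain n where n: "S \<subseteq> Rn n" "\<And>x. x \<in> S \<Longrightarrow> smooth_at n S f x" using f unfolding smooth_map_iff by blast
  obtain m where m: "T \<subseteq> Rn m" "\<And>x. x \<in> T \<Longrightarrow> smooth_at m T g x" using g unfolding smooth_map_iff by blast
  have "smooth_at n S (compose S g f) x" if "x \<in> S" for x
    using smooth_at_compose[OF n(2)[OF that] m(2)] smooth_map_in[OF f] that m(1)
    by (simp add: compose_eq)
  moreover have "compose S g f \<in> S \<rightarrow>\<^sub>E R"
    using f g by (auto simp: smooth_map_def compose_def)
  ultimately show ?thesis using n(1) unfolding smooth_map_iff by blast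
qed

lemma smooth_map_restrict:
  assumes "smooth_map S T f" "S' \<subseteq> S" "f ` S' \<subseteq> T'"
  shows "smooth_map S' T' (restrict f S')"
proof -
  obtain n where n: "S \<subseteq> Rn n" using smooth_map_dom[OF assms(1)] by blast
  have "smooth_at n S' (restrict f S') x" if "x \<in> S'" for x
  proof -
    obtain W F where "openin (Euclidean_space n) W" "x \<in> W" "\<forall>j k. Ck n k W (\<lambda>y. F y j)"
        "\<forall>y\<in>S \<inter> W. F y = f y"
      using smooth_map_at[OF assms(1) n] \<open>x \<in> S'\<close> assms(2) unfolding smooth_at_def by (meson subsetD)
    then show ?thesis
      unfolding smooth_at_def using assms(2) by (intro exI[of _ W] exI[of _ F]) auto
  qed
  moreover have "restrict f S' \<in> S' \<rightarrow>\<^sub>E T'" "S' \<subseteq> Rn n" using n assms(2,3) by auto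
  ultimately show ?thesis unfolding smooth_map_iff by blast
qed

lemma smooth_map_id:
  assumes "S \<subseteq> Rn n" "S \<subseteq> T"
  shows "smooth_map S T (\<lambda>x\<in>S. x)"
  unfolding smooth_map_iff using assms by (auto intro!: exI[of _ n] smooth_at_id)

lemma smooth_map_const:
  assumes "S \<subseteq> Rn n" "c \<in> T"
  shows "smooth_map S T (\<lambda>x\<in>S. c)"
proof -
  have "smooth_at n S (\<lambda>x\<in>S. c) x" if "x \<in> S" for x
    unfolding smooth_at_def using assms that
    by (intro exI[of _ "Rn n"] exI[of _ "\<lambda>y. c"]) (auto intro: Ck_const)
  then show ?thesis using assms unfolding smooth_map_iff by auto
qed

lemma smooth_map_openI:
  assumes "openin (Euclidean_space n) W" "\<And>j k. Ck n k W (\<lambda>y. f y j)" "\<And>x. x \<in> W \<Longrightarrow> f x \<in> T"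
  shows "smooth_map W T (restrict f W)"
  unfolding smooth_map_def
  using assms openin_Rn_subset[OF assms(1)] by (intro conjI exI[of _ n] ballI exI[of _ W] exI[of _ f]) auto

lemma smooth_map_continuous:
  assumes "smooth_map S T f"
  shows "continuous_on S f"
  unfolding continuous_on_eq_continuous_within
proof
  fix x assume x: "x \<in> S"
  obtain n where n: "S \<subseteq> Rn n" using smooth_map_dom[OF assms(1)] by blast
  obtain W F where W: "openin (Euclidean_space n) W" "x \<in> W" "\<And>j k. Ck n k W (\<lambda>y. F y j)"
      "\<And>y. y \<in> S \<Longrightarrow> y \<in> W \<Longrightarrow> F y = f y"
    using smooth_map_at[OF assms n x] unfolding smooth_at_def by blast
  obtain O' where O': "open O'" "W = Rn n \<inter> O'"
    using W(1) unfolding openin_Rn_iff openin_open by auto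
  have "continuous_on W F"
    using Ck_continuous[OF W(1) W(3)[where k = 0]] by (rule continuous_on_coordinatewise_then_product)
  then have "continuous_on (S \<inter> O') F"
    by (rule continuous_on_subset) (use n O' in auto)
  then have "continuous_on (S \<inter> O') f"
    by (rule continuous_on_eq) (use n O' W(4) in auto)
  then have "continuous (at x within (S \<inter> O')) f"
    using x W(2) O'(2) by (simp add: continuous_on_eq_continuous_within)
  then show "continuous (at x within S) f"
    using at_within_nhd[of x O' "S \<inter> O'" S] W(2) O' by (simp add: continuous_within Int_assoc)
qed

lemma cartesian_Rn: "cartesian U \<Longrightarrow> \<exists>n. U \<subseteq> Rn n"
  unfolding cartesian_def using smooth_map_dom by blast

lemma cartesian_nonempty: "cartesian U \<Longrightarrow> U \<noteq> {}"
  unfolding cartesian_def using smooth_map_in Rn_iff[of "\<lambda>_. 0"] by blast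

lemma cartesian_Rn_self: "cartesian (Rn n)"
  unfolding cartesian_def
  by (intro exI[of _ n] exI[of _ "\<lambda>x\<in>Rn n. x"]) (use smooth_map_id[of "Rn n" n "Rn n"] in auto)

section \<open>Diffeomorphisms and cartesian boxes\<close>

definition diffeo :: "pt set \<Rightarrow> pt set \<Rightarrow> (pt \<Rightarrow> pt) \<Rightarrow> (pt \<Rightarrow> pt) \<Rightarrow> bool" where
  "diffeo U V f g \<longleftrightarrow> smooth_map U V f \<and> smooth_map V U g \<and>
     (\<forall>x\<in>U. g (f x) = x) \<and> (\<forall>y\<in>V. f (g y) = y)"

lemma cartesian_iff_diffeo: "cartesian U \<longleftrightarrow> (\<exists>n f g. diffeo (Rn n) U f g)"
  unfolding cartesian_def diffeo_def ..

lemma cartesian_diffeo: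
  assumes "cartesian U" "diffeo U V f g"
  shows "cartesian V"
proof -
  obtain n f' g' where *: "diffeo (Rn n) U f' g'" using assms(1) cartesian_iff_diffeo by blast
  have "diffeo (Rn n) V (compose (Rn n) f f') (compose V g' g)"
    using * assms(2) smooth_map_compose unfolding diffeo_def
    by (auto simp: compose_def smooth_map_in) 
  then show ?thesis using cartesian_iff_diffeo by blast
qed

lemma diffeo_image:
  assumes "diffeo U V f g" "B \<subseteq> U"
  shows "diffeo B (f ` B) (restrict f B) (restrict g (f ` B))"
proof -
  have gf: "g (f x) = x" "f x \<in> V" if "x \<in> B" for x
    using assms that unfolding diffeo_def by (auto dest: smooth_map_in)
  then have "restrict f B ` B \<subseteq> f ` B" "g ` f ` B \<subseteq> B" "f ` B \<subseteq> V" by auto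
  then show ?thesis
    using assms gf unfolding diffeo_def by (auto intro!: smooth_map_restrict)
qed

text \<open>The image of \<open>B\<close> under \<open>f\<close> is its preimage under the
  continuous inverse \<open>g\<close>.\<close>

lemma diffeo_image_open:
  assumes "diffeo U V f g" "openin (top_of_set U) B"
  shows "openin (top_of_set V) (f ` B)"
proof -
  have B: "B \<subseteq> U" using assms(2) by (auto dest: openin_imp_subset)
  have "openin (top_of_set V) (V \<inter> g -` B)"
    using continuous_openin_preimage[OF smooth_map_continuous _ assms(2), of V U g] assms(1)
    unfolding diffeo_def by (auto simp: smooth_map_def)
  moreover have "V \<inter> g -` B = f ` B"
    using assms(1) B unfolding diffeo_def
    by (auto simp: smooth_map_in subset_iff image_iff) (metis smooth_map_in)+
  ultimately show ?thesis by simp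
qed

text \<open>In each coordinate the logistic function \<open>1 / (1 + exp (- t))\<close>, rescaled to
  the interval from \<open>a i\<close> to \<open>b i\<close>, is a diffeomorphism of the real line
  onto it; its inverse is the logarithm of the ratio of the distances to the two ends.\<close>

lemma cartesian_open_box:
  assumes ab: "\<And>i. i < n \<Longrightarrow> a i < b i"
  shows "cartesian (open_box n a b)"
proof -
  define f :: "pt \<Rightarrow> pt" where
    "f x = (\<lambda>i. if i < n then a i + (b i - a i) * inverse (1 + exp (- x i)) else 0)" for x
  define g :: "pt \<Rightarrow> pt" where
    "g y = (\<lambda>i. if i < n then ln (y i - a i) - ln (b i - y i) else 0)" for y
  note R = openin_topspace[of "Euclidean_space n"]
  have pos: "1 + exp t > 0" for t :: real by (simp add: add_pos_pos)
  have "Ck n k (Rn n) (\<lambda>x. f x j)" for j k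
  proof (cases "j < n")
    case True
    have "Ck n k (Rn n) (\<lambda>x. inverse (1 + exp (- x j)))"
      by (rule Ck_inverse[OF R Ck_add[OF R Ck_const[OF R] Ck_exp[OF R Ck_minus[OF R Ck_coord[OF R]]]]])
        (use pos in \<open>metis less_irrefl\<close>)
    then show ?thesis using True
      by (auto simp: f_def intro!: Ck_add[OF R] Ck_mult[OF R] Ck_const[OF R])
  qed (simp add: f_def Ck_const[OF R])
  moreover have fb: "f x \<in> open_box n a b" for x
  proof -
    have "0 < inverse (1 + exp (- x i))" "inverse (1 + exp (- x i)) < 1" for i
      using pos[of "- x i"] by (auto intro: inverse_less_1_iff[THEN iffD2])
    then have "0 < (b i - a i) * inverse (1 + exp (- x i))"
       "(b i - a i) * inverse (1 + exp (- x i)) < (b i - a i) * 1" if "i < n" for i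
      using ab[OF that] by (simp, intro mult_strict_left_mono) auto
    then show ?thesis by (fastforce simp: open_box_def f_def Rn_iff)
  qed
  ultimately have f: "smooth_map (Rn n) (open_box n a b) (restrict f (Rn n))"
    by (intro smooth_map_openI[OF R])
  note B = openin_open_box[of n a b]
  have "Ck n k (open_box n a b) (\<lambda>x. g x j)" for j k
  proof (cases "j < n")
    case True
    have "Ck n k (open_box n a b) (\<lambda>x. ln (x j - a j) - ln (b j - x j))"
      by (intro Ck_diff[OF B] Ck_ln[OF B] Ck_const[OF B] Ck_coord[OF B])
        (use True in \<open>auto simp: open_box_def\<close>)
    then show ?thesis using True by (simp add: g_def)
  qed (simp add: g_def Ck_const[OF B])
  then have g: "smooth_map (open_box n a b) (Rn n) (restrict g (open_box n a b))"
    by (intro smooth_map_openI[OF B]) (auto simp: g_def Rn_iff)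
  have "g (f x) = x" if "x \<in> Rn n" for x
  proof
    fix i
    show "g (f x) i = x i"
    proof (cases "i < n")
      case True
      define u where "u = exp (- x i)"
      have u: "u > 0" by (simp add: u_def)
      have d: "b i - a i > 0" using ab[OF True] by simp
      have "f x i - a i = (b i - a i) / (1 + u)"
        using True by (simp add: f_def u_def divide_inverse)
      moreover from this have "b i - f x i = (b i - a i) * u / (1 + u)"
        using u by (simp add: field_simps)
      ultimately have "ln (f x i - a i) - ln (b i - f x i) = - ln u"
        using u d by (simp add: ln_div ln_mult)
      then show ?thesis using True by (simp add: g_def u_def)
    qed (use that in \<open>auto simp: g_def Rn_iff\<close>)
  qed
  moreover have "f (g y) = y" if "y \<in> open_box n a b" for y
  proof
    fix i
    show "f (g y) i = y i"
    proof (cases "i < n")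
      case True
      have y: "y i - a i > 0" "b i - y i > 0" using that True by (auto simp: open_box_def)
      have "exp (- g y i) = (b i - y i) / (y i - a i)"
        using y True by (simp add: g_def exp_diff)
      then have "1 + exp (- g y i) = (b i - a i) / (y i - a i)"
        using y by (simp add: field_simps)
      then show ?thesis using True y by (simp add: f_def)
    qed (use that in \<open>auto simp: f_def open_box_def Rn_iff\<close>)
  qed
  moreover have "g y \<in> Rn n" for y by (auto simp: g_def Rn_iff)
  ultimately show ?thesis
    unfolding cartesian_def using f g fb
    by (intro exI[of _ n] exI[of _ "restrict f (Rn n)"] exI[of _ "restrict g (open_box n a b)"]) auto
qed

lemma open_box_Int: "open_box n a b \<inter> open_box n c d = open_box n (\<lambda>i. max (a i) (c i)) (\<lambda>i. min (b i) (d i))"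
  by (auto simp: open_box_def)

lemma open_box_nonempty: "open_box n a b \<noteq> {} \<Longrightarrow> i < n \<Longrightarrow> a i < b i"
  by (force simp: open_box_def)

lemma Inter_open_boxes:
  assumes "finite \<F>" "\<F> \<noteq> {}" "\<And>B. B \<in> \<F> \<Longrightarrow> \<exists>a b. B = open_box n a b"
  shows "\<exists>a b. \<Inter>\<F> = open_box n a b"
  using assms
proof (induction rule: finite_ne_induct)
  case (insert B \<F>)
  then show ?case by (metis Inter_insert open_box_Int insertCI)
qed simp

section \<open>Good refinements of open covers\<close>

lemma good_cover_openin: "good_cover U \<U> \<Longrightarrow> V \<in> \<U> \<Longrightarrow> openin (top_of_set U) V"
  by (auto simp: good_cover_def euclidean_product_topology)

text \<open>All boxes of one chart \<open>f\<close> whose image lies in some admissible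
  \<open>N\<close> are used. Injectivity of \<open>f\<close> turns intersections of images into
  images of intersections, which are again images of boxes. \<open>Q\<close> is what the given
  neighbourhoods satisfy and \<open>Q'\<close> what remains after shrinking to an open cartesian
  subset; keeping them apart allows \<open>Q'\<close> to use that the members are cartesian.\<close>

lemma good_refinement:
  assumes U: "cartesian U"
    and cover: "\<And>x. x \<in> U \<Longrightarrow> \<exists>N. openin (top_of_set U) N \<and> x \<in> N \<and> Q N"
    and mono: "\<And>N V. Q N \<Longrightarrow> openin (top_of_set U) N \<Longrightarrow> V \<subseteq> N \<Longrightarrow> openin (top_of_set U) V \<Longrightarrow>
      cartesian V \<Longrightarrow> Q' V"
  shows "\<exists>\<U>. good_cover U \<U> \<and> (\<forall>V\<in>\<U>. Q' V)"
proof -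
  obtain n f g where fg: "diffeo (Rn n) U f g" using U cartesian_iff_diffeo by blast
  have inj: "inj_on f (Rn n)" using fg unfolding diffeo_def by (metis inj_onI)
  \<comment> \<open>Empty boxes are excluded since a cartesian space is nonempty.\<close>
  define \<B> where "\<B> = {B. (\<exists>a b. B = open_box n a b) \<and> B \<noteq> {} \<and>
      (\<exists>N. openin (top_of_set U) N \<and> Q N \<and> f ` B \<subseteq> N)}"
  have sub: "B \<subseteq> Rn n" if "B \<in> \<B>" for B using that by (auto simp: \<B>_def open_box_def)
  have img: "openin (top_of_set U) (f ` B)" "cartesian (f ` B)" if "B = open_box n a b" "B \<noteq> {}" for B a b
  proof -
    have o: "openin (top_of_set (Rn n)) B" using openin_open_box that(1) openin_Rn_iff by metis
    show "openin (top_of_set U) (f ` B)" by (rule diffeo_image_open[OF fg o])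
    have "cartesian B" using cartesian_open_box open_box_nonempty that by metis
    then show "cartesian (f ` B)"
      using cartesian_diffeo diffeo_image[OF fg openin_imp_subset[OF o]] by blast
  qed
  have "good_cover U ((`) f ` \<B>)"
    unfolding good_cover_def
  proof (intro conjI ballI allI impI)
    fix V assume "V \<in> (`) f ` \<B>"
    then obtain B a b where B: "B = open_box n a b" "B \<noteq> {}" "V = f ` B"
      unfolding \<B>_def by blast
    show "openin (subtopology (powertop_real UNIV) U) V" "cartesian V"
      using img[OF B(1,2)] B(3) by (auto simp: euclidean_product_topology)
  next
    show "\<Union> ((`) f ` \<B>) = U"
    proof
      show "\<Union> ((`) f ` \<B>) \<subseteq> U"
        using fg sub unfolding diffeo_def by (auto dest: smooth_map_in)
      show "U \<subseteq> \<Union> ((`) f ` \<B>)"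
      proof
        fix x assume x: "x \<in> U"
        obtain N where N: "openin (top_of_set U) N" "x \<in> N" "Q N" using cover[OF x] by blast
        have gx: "g x \<in> Rn n" "f (g x) = x" using fg x unfolding diffeo_def by (auto dest: smooth_map_in)
        have "openin (top_of_set (Rn n)) (Rn n \<inter> f -` N)"
          using continuous_openin_preimage[OF smooth_map_continuous _ N(1), of "Rn n" U f] fg
          unfolding diffeo_def by (auto simp: smooth_map_def)
        then have "openin (Euclidean_space n) (Rn n \<inter> f -` N)" by (simp add: openin_Rn_iff)
        moreover have "g x \<in> Rn n \<inter> f -` N" using gx N(2) by auto
        ultimately obtain e where e: "e > 0"
            "open_box n (\<lambda>i. g x i - e) (\<lambda>i. g x i + e) \<subseteq> Rn n \<inter> f -` N"
          by (rule open_box_nbhd)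
        have "g x \<in> open_box n (\<lambda>i. g x i - e) (\<lambda>i. g x i + e)" using gx e(1) by (auto simp: open_box_def)
        moreover from this have "open_box n (\<lambda>i. g x i - e) (\<lambda>i. g x i + e) \<in> \<B>"
          using e(2) N unfolding \<B>_def by blast
        ultimately show "x \<in> \<Union> ((`) f ` \<B>)" using gx(2) by (metis UN_iff imageI)
      qed
    qed
  next
    fix \<F> assume F: "finite \<F> \<and> \<F> \<noteq> {} \<and> \<F> \<subseteq> (`) f ` \<B> \<and> \<Inter> \<F> \<noteq> {}"
    then obtain \<G> where G: "\<G> \<subseteq> \<B>" "finite \<G>" "\<F> = (`) f ` \<G>"
      using finite_subset_image by metis
    have ne: "\<G> \<noteq> {}" using G F by auto
    then obtain B where B: "B \<in> \<G>" by blast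
    have "f ` (\<Inter>B\<in>\<G>. B) = (\<Inter>B\<in>\<G>. f ` B)"
      by (rule image_INT[OF inj _ B]) (use sub G(1) in blast)
    then have "\<Inter> \<F> = f ` \<Inter> \<G>" unfolding G(3) by simp
    moreover obtain a b where "\<Inter> \<G> = open_box n a b"
      using Inter_open_boxes[OF G(2) ne] G(1) unfolding \<B>_def by blast
    ultimately show "cartesian (\<Inter> \<F>)" using img(2)[of "\<Inter> \<G>" a b] F by auto
  qed
  moreover have "Q' (f ` B)" if B: "B \<in> \<B>" for B
  proof -
    obtain a b N where N: "B = open_box n a b" "B \<noteq> {}" "openin (top_of_set U) N" "Q N" "f ` B \<subseteq> N"
      using B unfolding \<B>_def by blast
    show ?thesis by (rule mono[OF N(4,3,5) img[OF N(1,2)]])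
  qed
  ultimately show ?thesis by (intro exI[of _ "(`) f ` \<B>"]) simp
qed

section \<open>Equivalences from fully faithful, essentially surjective functors\<close>

lemma category_rules:
  assumes "is_category C"
  shows "x \<in> Ob C \<Longrightarrow> Ident C x \<in> Hom C x x"
    and "x \<in> Ob C \<Longrightarrow> y \<in> Ob C \<Longrightarrow> z \<in> Ob C \<Longrightarrow> f \<in> Hom C x y \<Longrightarrow> g \<in> Hom C y z \<Longrightarrow>
      Comp C x y z g f \<in> Hom C x z"
    and "x \<in> Ob C \<Longrightarrow> y \<in> Ob C \<Longrightarrow> f \<in> Hom C x y \<Longrightarrow> Comp C x x y f (Ident C x) = f"
    and "x \<in> Ob C \<Longrightarrow> y \<in> Ob C \<Longrightarrow> f \<in> Hom C x y \<Longrightarrow> Comp C x y y (Ident C y) f = f"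
    and "w \<in> Ob C \<Longrightarrow> x \<in> Ob C \<Longrightarrow> y \<in> Ob C \<Longrightarrow> z \<in> Ob C \<Longrightarrow>
      f \<in> Hom C w x \<Longrightarrow> g \<in> Hom C x y \<Longrightarrow> h \<in> Hom C y z \<Longrightarrow>
      Comp C w y z h (Comp C w x y g f) = Comp C w x z (Comp C x y z h g) f"
  using assms unfolding is_category_def by blast+

lemma functor_rules:
  assumes "is_functor C D F"
  shows "x \<in> Ob C \<Longrightarrow> on_Ob F x \<in> Ob D"
    and "x \<in> Ob C \<Longrightarrow> y \<in> Ob C \<Longrightarrow> f \<in> Hom C x y \<Longrightarrow>
      on_Hom F x y f \<in> Hom D (on_Ob F x) (on_Ob F y)"
    and "x \<in> Ob C \<Longrightarrow> on_Hom F x x (Ident C x) = Ident D (on_Ob F x)"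
    and "x \<in> Ob C \<Longrightarrow> y \<in> Ob C \<Longrightarrow> z \<in> Ob C \<Longrightarrow> f \<in> Hom C x y \<Longrightarrow> g \<in> Hom C y z \<Longrightarrow>
      on_Hom F x z (Comp C x y z g f) =
      Comp D (on_Ob F x) (on_Ob F y) (on_Ob F z) (on_Hom F y z g) (on_Hom F x y f)"
  using assms unfolding is_functor_def by blast+

text \<open>Essential surjectivity is asked in the weak form of a morphism \<open>e\<close>, which
  is an isomorphism because \<open>D\<close> is a groupoid. The quasi-inverse conjugates a morphism
  of \<open>D\<close> by chosen isomorphisms and lifts the result along \<open>F\<close>; equations
  between lifts are checked after applying \<open>F\<close>, by faithfulness.\<close>

lemma equivalence_of_groupoidsI:
  assumes C: "groupoid C" and D: "groupoid D" and F: "is_functor C D F"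
    and full: "\<And>x y d. x \<in> Ob C \<Longrightarrow> y \<in> Ob C \<Longrightarrow> d \<in> Hom D (on_Ob F x) (on_Ob F y) \<Longrightarrow>
      \<exists>c\<in>Hom C x y. on_Hom F x y c = d"
    and faithful: "\<And>x y c c'. x \<in> Ob C \<Longrightarrow> y \<in> Ob C \<Longrightarrow> c \<in> Hom C x y \<Longrightarrow> c' \<in> Hom C x y \<Longrightarrow>
      on_Hom F x y c = on_Hom F x y c' \<Longrightarrow> c = c'"
    and surj: "\<And>d. d \<in> Ob D \<Longrightarrow> \<exists>c\<in>Ob C. \<exists>e. e \<in> Hom D (on_Ob F c) d"
  shows "equivalence_of_groupoids C D F"
proof -
  have cC: "is_category C" and cD: "is_category D" using C D by (auto simp: groupoid_def)
  note rC = category_rules[OF cC] and rD = category_rules[OF cD] and rF = functor_rules[OF F]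
  have "\<forall>d. \<exists>c e e'. d \<in> Ob D \<longrightarrow> c \<in> Ob C \<and> e \<in> Hom D (on_Ob F c) d \<and> e' \<in> Hom D d (on_Ob F c) \<and>
      Comp D (on_Ob F c) d (on_Ob F c) e' e = Ident D (on_Ob F c) \<and>
      Comp D d (on_Ob F c) d e e' = Ident D d"
  proof (intro allI)
    fix d
    show "\<exists>c e e'. d \<in> Ob D \<longrightarrow> c \<in> Ob C \<and> e \<in> Hom D (on_Ob F c) d \<and> e' \<in> Hom D d (on_Ob F c) \<and>
      Comp D (on_Ob F c) d (on_Ob F c) e' e = Ident D (on_Ob F c) \<and>
      Comp D d (on_Ob F c) d e e' = Ident D d"
    proof (cases "d \<in> Ob D")
      case True
      then obtain c e where c: "c \<in> Ob C" "e \<in> Hom D (on_Ob F c) d" using surj by blast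
      then have "is_isomorphism D (on_Ob F c) d e"
        using D True rF(1) unfolding groupoid_def by blast
      then show ?thesis using c unfolding is_isomorphism_def by blast
    qed blast
  qed
  then obtain k e e' where k: "\<And>d. d \<in> Ob D \<Longrightarrow> k d \<in> Ob C"
    and e: "\<And>d. d \<in> Ob D \<Longrightarrow> e d \<in> Hom D (on_Ob F (k d)) d"
    and e': "\<And>d. d \<in> Ob D \<Longrightarrow> e' d \<in> Hom D d (on_Ob F (k d))"
    and e'e: "\<And>d. d \<in> Ob D \<Longrightarrow>
      Comp D (on_Ob F (k d)) d (on_Ob F (k d)) (e' d) (e d) = Ident D (on_Ob F (k d))"
    and ee': "\<And>d. d \<in> Ob D \<Longrightarrow> Comp D d (on_Ob F (k d)) d (e d) (e' d) = Ident D d"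
    by metis
  define lift where "lift x y d = (SOME c. c \<in> Hom C x y \<and> on_Hom F x y c = d)" for x y d
  have lift: "lift x y d \<in> Hom C x y" "on_Hom F x y (lift x y d) = d"
    if "x \<in> Ob C" "y \<in> Ob C" "d \<in> Hom D (on_Ob F x) (on_Ob F y)" for x y d
    using someI_ex[of "\<lambda>c. c \<in> Hom C x y \<and> on_Hom F x y c = d"] full[OF that]
    unfolding lift_def by blast+
  define conj where "conj d d' f = Comp D (on_Ob F (k d)) d (on_Ob F (k d'))
      (Comp D d d' (on_Ob F (k d')) (e' d') f) (e d)" for d d' f
  have conj_in: "conj d d' f \<in> Hom D (on_Ob F (k d)) (on_Ob F (k d'))"
    if "d \<in> Ob D" "d' \<in> Ob D" "f \<in> Hom D d d'" for d d' f
    using that by (simp add: conj_def rD(2) rF(1) k e e')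
  define H where "H = \<lparr>on_Ob = k, on_Hom = (\<lambda>d d' f. lift (k d) (k d') (conj d d' f))\<rparr>"
  have FH: "on_Hom F (k d) (k d') (on_Hom H d d' f) = conj d d' f"
    and H_in: "on_Hom H d d' f \<in> Hom C (k d) (k d')"
    if "d \<in> Ob D" "d' \<in> Ob D" "f \<in> Hom D d d'" for d d' f
    using that by (simp_all add: H_def lift k conj_in)
  have e_conj: "Comp D (on_Ob F (k d)) (on_Ob F (k d')) d' (e d') (conj d d' f) =
      Comp D (on_Ob F (k d)) d d' f (e d)"
    if "d \<in> Ob D" "d' \<in> Ob D" "f \<in> Hom D d d'" for d d' f
  proof -
    have "Comp D (on_Ob F (k d)) (on_Ob F (k d')) d' (e d') (conj d d' f) =
      Comp D (on_Ob F (k d)) d d' (Comp D d (on_Ob F (k d')) d' (e d')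
        (Comp D d d' (on_Ob F (k d')) (e' d') f)) (e d)"
      unfolding conj_def by (rule rD(5)) (use that in \<open>simp_all add: rD(2) rF(1) k e e'\<close>)
    also have "Comp D d (on_Ob F (k d')) d' (e d') (Comp D d d' (on_Ob F (k d')) (e' d') f) =
      Comp D d d' d' (Comp D d' (on_Ob F (k d')) d' (e d') (e' d')) f"
      by (rule rD(5)) (use that in \<open>simp_all add: rD(2) rF(1) k e e'\<close>)
    finally show ?thesis using that by (simp add: ee' rD)
  qed
  \<comment> \<open>The left inverse \<open>e' d\<close> makes \<open>e d\<close> monic.
    Compatibility of \<open>conj\<close> with composition can then be checked after composing with
    \<open>e z\<close>, where it follows from the naturality square \<open>e_conj\<close> used once
    for each factor.\<close>
  have mono: "f = g" if "d \<in> Ob D" "x \<in> Ob D" "f \<in> Hom D x (on_Ob F (k d))" "g \<in> Hom D x (on_Ob F (k d))"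
    "Comp D x (on_Ob F (k d)) d (e d) f = Comp D x (on_Ob F (k d)) d (e d) g" for d x f g
  proof -
    have "Comp D x d (on_Ob F (k d)) (e' d) (Comp D x (on_Ob F (k d)) d (e d) h) = h"
      if "h \<in> Hom D x (on_Ob F (k d))" for h
      by (subst rD(5)) (use that \<open>d \<in> Ob D\<close> \<open>x \<in> Ob D\<close> in \<open>simp_all add: rD(2,4) rF(1) k e e' e'e\<close>)
    then show ?thesis using that by metis
  qed
  have HF: "is_functor D C H"
    unfolding is_functor_def
  proof (intro conjI ballI)
    show "on_Ob H d \<in> Ob C" if "d \<in> Ob D" for d using that k by (simp add: H_def)
    show "on_Hom H d d' f \<in> Hom C (on_Ob H d) (on_Ob H d')"
      if "d \<in> Ob D" "d' \<in> Ob D" "f \<in> Hom D d d'" for d d' f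
      using H_in[OF that] by (simp add: H_def)
    show "on_Hom H d d (Ident D d) = Ident C (on_Ob H d)" if d: "d \<in> Ob D" for d
    proof -
      note i = rD(1)[OF d]
      have "conj d d (Ident D d) = Ident D (on_Ob F (k d))"
        using d by (simp add: conj_def rD rF(1) k e e' e'e)
      then have "on_Hom F (k d) (k d) (on_Hom H d d (Ident D d)) = on_Hom F (k d) (k d) (Ident C (k d))"
        using FH[OF d d i] rF(3)[OF k[OF d]] by simp
      then show ?thesis
        using faithful[OF k[OF d] k[OF d] H_in[OF d d i] rC(1)[OF k[OF d]]] by (simp add: H_def)
    qed
    show "on_Hom H x z (Comp D x y z g f) =
        Comp C (on_Ob H x) (on_Ob H y) (on_Ob H z) (on_Hom H y z g) (on_Hom H x y f)"
      if x: "x \<in> Ob D" and y: "y \<in> Ob D" and z: "z \<in> Ob D" and f: "f \<in> Hom D x y" and g: "g \<in> Hom D y z"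
      for x y z f g
    proof -
      have gf: "Comp D x y z g f \<in> Hom D x z" using that by (simp add: rD(2))
      note kk = k[OF x] k[OF y] k[OF z] rF(1)[OF k[OF x]] rF(1)[OF k[OF y]] rF(1)[OF k[OF z]]
      let ?c = "Comp D (on_Ob F (k x)) (on_Ob F (k y)) (on_Ob F (k z))"
      have "conj x z (Comp D x y z g f) = ?c (conj y z g) (conj x y f)"
      proof (rule mono[OF z kk(4) conj_in[OF x z gf]])
        show "?c (conj y z g) (conj x y f) \<in> Hom D (on_Ob F (k x)) (on_Ob F (k z))"
          using that kk by (simp add: rD(2) conj_in)
        have "Comp D (on_Ob F (k x)) (on_Ob F (k z)) z (e z) (?c (conj y z g) (conj x y f)) =
          Comp D (on_Ob F (k x)) (on_Ob F (k y)) z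
            (Comp D (on_Ob F (k y)) (on_Ob F (k z)) z (e z) (conj y z g)) (conj x y f)"
          by (rule rD(5)) (use that kk in \<open>simp_all add: conj_in e\<close>)
        also have "\<dots> = Comp D (on_Ob F (k x)) (on_Ob F (k y)) z
            (Comp D (on_Ob F (k y)) y z g (e y)) (conj x y f)"
          using e_conj[OF y z g] by simp
        also have "\<dots> = Comp D (on_Ob F (k x)) y z g
            (Comp D (on_Ob F (k x)) (on_Ob F (k y)) y (e y) (conj x y f))"
          by (rule rD(5)[symmetric]) (use that kk in \<open>simp_all add: conj_in e\<close>)
        also have "\<dots> = Comp D (on_Ob F (k x)) y z g (Comp D (on_Ob F (k x)) x y f (e x))"
          using e_conj[OF x y f] by simp
        also have "\<dots> = Comp D (on_Ob F (k x)) x z (Comp D x y z g f) (e x)"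
          by (rule rD(5)) (use that kk in \<open>simp_all add: e\<close>)
        finally show "Comp D (on_Ob F (k x)) (on_Ob F (k z)) z (e z) (conj x z (Comp D x y z g f)) =
          Comp D (on_Ob F (k x)) (on_Ob F (k z)) z (e z) (?c (conj y z g) (conj x y f))"
          using e_conj[OF x z gf] by simp
      qed
      then have "on_Hom F (k x) (k z) (on_Hom H x z (Comp D x y z g f)) =
          on_Hom F (k x) (k z) (Comp C (k x) (k y) (k z) (on_Hom H y z g) (on_Hom H x y f))"
        using FH[OF x z gf] FH[OF x y f] FH[OF y z g] H_in[OF x y f] H_in[OF y z g] kk
        by (simp add: rF(4))
      then show ?thesis
        using faithful[OF kk(1,3) H_in[OF x z gf]] rC(2)[OF kk(1-3) H_in[OF x y f] H_in[OF y z g]]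
        by (simp add: H_def)
    qed
  qed
  have unit: "naturally_isomorphic C C id_functor (comp_functor H F)"
    unfolding naturally_isomorphic_def
  proof (intro exI conjI ballI)
    \<comment> \<open>The component of the unit at \<open>x\<close> must go to the chosen object
      over \<open>on_Ob F x\<close>; it is the lift of the inverse of the chosen isomorphism
      there.\<close>
    let ?\<eta> = "\<lambda>x. lift x (k (on_Ob F x)) (e' (on_Ob F x))"
    have \<eta>: "?\<eta> x \<in> Hom C x (k (on_Ob F x))"
      "on_Hom F x (k (on_Ob F x)) (?\<eta> x) = e' (on_Ob F x)" if "x \<in> Ob C" for x
      using that by (simp_all add: lift k rF e')
    show "is_isomorphism C (on_Ob id_functor x) (on_Ob (comp_functor H F) x) (?\<eta> x)" if "x \<in> Ob C" for x
      using that \<eta>(1)[OF that] C k rF(1)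
      by (auto simp: groupoid_def id_functor_def comp_functor_def H_def)
    show "Comp C (on_Ob id_functor x) (on_Ob id_functor y) (on_Ob (comp_functor H F) y)
        (?\<eta> y) (on_Hom id_functor x y f) =
      Comp C (on_Ob id_functor x) (on_Ob (comp_functor H F) x) (on_Ob (comp_functor H F) y)
        (on_Hom (comp_functor H F) x y f) (?\<eta> x)"
      if x: "x \<in> Ob C" and y: "y \<in> Ob C" and f: "f \<in> Hom C x y" for x y f
    proof -
      let ?x = "on_Ob F x" and ?y = "on_Ob F y" and ?f = "on_Hom F x y f"
      have d: "?x \<in> Ob D" "?y \<in> Ob D" "?f \<in> Hom D ?x ?y" "k ?x \<in> Ob C" "k ?y \<in> Ob C"
        "on_Ob F (k ?x) \<in> Ob D" "on_Ob F (k ?y) \<in> Ob D"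
        using that rF k by auto
      have in1: "Comp C x y (k ?y) (?\<eta> y) f \<in> Hom C x (k ?y)"
        using that d \<eta> by (simp add: rC(2))
      have in2: "Comp C x (k ?x) (k ?y) (on_Hom H ?x ?y ?f) (?\<eta> x) \<in> Hom C x (k ?y)"
        using that d \<eta> by (simp add: rC(2) H_in)
      have "Comp D ?x (on_Ob F (k ?x)) (on_Ob F (k ?y)) (conj ?x ?y ?f) (e' ?x) =
        Comp D ?x ?x (on_Ob F (k ?y)) (Comp D ?x ?y (on_Ob F (k ?y)) (e' ?y) ?f)
          (Comp D ?x (on_Ob F (k ?x)) ?x (e ?x) (e' ?x))"
        unfolding conj_def by (rule rD(5)[symmetric]) (use d in \<open>simp_all add: rD(2) e e'\<close>)
      also have "\<dots> = Comp D ?x ?y (on_Ob F (k ?y)) (e' ?y) ?f"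
        using d by (simp add: ee' rD(2,3) e')
      finally have "on_Hom F x (k ?y) (Comp C x y (k ?y) (?\<eta> y) f) =
        on_Hom F x (k ?y) (Comp C x (k ?x) (k ?y) (on_Hom H ?x ?y ?f) (?\<eta> x))"
        using that d \<eta> by (simp add: rF(4) FH H_in)
      then have "Comp C x y (k ?y) (?\<eta> y) f = Comp C x (k ?x) (k ?y) (on_Hom H ?x ?y ?f) (?\<eta> x)"
        using faithful[OF x d(5) in1 in2] by blast
      then show ?thesis by (simp add: id_functor_def comp_functor_def H_def)
    qed
  qed
  have counit: "naturally_isomorphic D D (comp_functor F H) id_functor"
    unfolding naturally_isomorphic_def
  proof (intro exI conjI ballI)
    show "is_isomorphism D (on_Ob (comp_functor F H) d) (on_Ob id_functor d) (e d)" if "d \<in> Ob D" for d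
      using that D e k rF(1) by (auto simp: groupoid_def id_functor_def comp_functor_def H_def)
    show "Comp D (on_Ob (comp_functor F H) d) (on_Ob (comp_functor F H) d') (on_Ob id_functor d')
        (e d') (on_Hom (comp_functor F H) d d' f) =
      Comp D (on_Ob (comp_functor F H) d) (on_Ob id_functor d) (on_Ob id_functor d')
        (on_Hom id_functor d d' f) (e d)"
      if "d \<in> Ob D" "d' \<in> Ob D" "f \<in> Hom D d d'" for d d' f
      using FH[OF that] e_conj[OF that] by (simp add: id_functor_def comp_functor_def H_def)
  qed
  show ?thesis
    unfolding equivalence_of_groupoids_def using C D F HF unit counit by blast
qed

section \<open>Plots\<close>

text \<open>Plots are extensional functions. Restricting first lets arbitrary terms, such as
  pointwise composites, act as plots, and lets them be replaced by terms that agree with them on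
  \<open>U\<close> only.\<close>

definition plot_on :: "'a dspace \<Rightarrow> pt set \<Rightarrow> (pt \<Rightarrow> 'a) \<Rightarrow> bool" where
  "plot_on X U f \<longleftrightarrow> (U, restrict f U) \<in> plots X"

lemma plot_on_cong: "(\<And>x. x \<in> U \<Longrightarrow> f x = g x) \<Longrightarrow> plot_on X U f \<longleftrightarrow> plot_on X U g"
  unfolding plot_on_def by (metis restrict_ext)

lemma plot_on_eq: "plot_on X U f \<Longrightarrow> (\<And>x. x \<in> U \<Longrightarrow> f x = g x) \<Longrightarrow> plot_on X U g"
  using plot_on_cong by metis

lemma plot_on_restrict [simp]: "plot_on X U (restrict f U) \<longleftrightarrow> plot_on X U f"
  by (simp add: plot_on_def)

lemma restrict_compose: "restrict (\<lambda>x. f (p x)) U = compose U f p"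
  by (simp add: compose_def)

lemma plots_plot_on:
  assumes "diffeological_space X" "(U, p) \<in> plots X"
  shows "plot_on X U p" "p \<in> U \<rightarrow>\<^sub>E points X" "cartesian U"
proof -
  have "\<forall>(U, p)\<in>plots X. cartesian U \<and> p \<in> U \<rightarrow>\<^sub>E points X"
    using assms(1) unfolding diffeological_space_def by (rule conjunct1)
  then show p: "p \<in> U \<rightarrow>\<^sub>E points X" "cartesian U" using assms(2) by auto
  then have "restrict p U = p" by (simp add: PiE_restrict)
  then show "plot_on X U p" using assms(2) by (simp add: plot_on_def)
qed

lemma plot_on_in: "diffeological_space X \<Longrightarrow> plot_on X U f \<Longrightarrow> x \<in> U \<Longrightarrow> f x \<in> points X"
  unfolding plot_on_def using plots_plot_on(2) by fastforce

lemma plot_on_cartesian: "diffeological_space X \<Longrightarrow> plot_on X U f \<Longrightarrow> cartesian U"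
  unfolding plot_on_def using plots_plot_on(3) by blast

lemma plot_on_compose:
  assumes "diffeological_space X" "plot_on X U f" "cartesian V" "smooth_map V U s"
  shows "plot_on X V (\<lambda>x. f (s x))"
proof -
  have "(V, compose V (restrict f U) s) \<in> plots X"
    using assms unfolding diffeological_space_def plot_on_def by blast
  moreover have "compose V (restrict f U) s = restrict (\<lambda>x. f (s x)) V"
    using smooth_map_in[OF assms(4)] by (auto simp: compose_def fun_eq_iff)
  ultimately show ?thesis by (simp add: plot_on_def)
qed

lemma plot_on_subset:
  assumes "diffeological_space X" "plot_on X U f" "cartesian V" "V \<subseteq> U"
  shows "plot_on X V f"
proof -
  obtain n where "U \<subseteq> Rn n" using plot_on_cartesian[OF assms(1,2)] cartesian_Rn by blast
  then have "smooth_map V U (\<lambda>x\<in>V. x)" using assms(4) by (intro smooth_map_id[of _ n]) auto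
  from plot_on_compose[OF assms(1-3) this] show ?thesis
    by (subst plot_on_cong[of _ _ "\<lambda>x. f ((\<lambda>x\<in>V. x) x)"]) auto
qed

lemma plot_on_point:
  assumes "diffeological_space X" "\<And>x. x \<in> Rn 0 \<Longrightarrow> f x \<in> points X"
  shows "plot_on X (Rn 0) f"
proof -
  have "\<forall>p \<in> Rn 0 \<rightarrow>\<^sub>E points X. (Rn 0, p) \<in> plots X"
    using assms(1) unfolding diffeological_space_def by (elim conjE)
  then show ?thesis using assms(2) by (simp add: plot_on_def)
qed

text \<open>A constant map factors through the one-point space \<open>Rn 0\<close>, on which every
  map is a plot.\<close>

lemma plot_on_const:
  assumes X: "diffeological_space X" and "cartesian U" "c \<in> points X"
  shows "plot_on X U (\<lambda>x. c)"
proof -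
  have "plot_on X (Rn 0) (\<lambda>x. c)" using plot_on_point[OF X] assms(3) by simp
  moreover obtain n where "U \<subseteq> Rn n" using cartesian_Rn[OF assms(2)] by blast
  then have "smooth_map U (Rn 0) (\<lambda>x\<in>U. (\<lambda>i. 0))"
    by (rule smooth_map_const) (simp add: Rn_iff)
  ultimately show ?thesis using plot_on_compose[OF X _ assms(2)] by blast
qed

text \<open>The locality axiom speaks of good covers only; \<open>good_refinement\<close> reduces an
  arbitrary family of neighbourhoods to one, since plots restrict to cartesian subsets.\<close>

lemma plot_on_local:
  assumes X: "diffeological_space X" and U: "cartesian U"
    and loc: "\<And>x. x \<in> U \<Longrightarrow> \<exists>N. openin (top_of_set U) N \<and> x \<in> N \<and> plot_on X N f"
  shows "plot_on X U f"
proof -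
  obtain \<U> where \<U>: "good_cover U \<U>" "\<And>V. V \<in> \<U> \<Longrightarrow> plot_on X V f"
    using good_refinement[OF U loc, of "\<lambda>V. plot_on X V f"] plot_on_subset[OF X] by blast
  have sub: "V \<subseteq> U" if "V \<in> \<U>" for V using \<U>(1) that by (auto simp: good_cover_def)
  have "restrict f U \<in> U \<rightarrow>\<^sub>E points X"
    using loc plot_on_in[OF X] by (metis (no_types, lifting) PiE_restrict restrict_PiE_iff)
  moreover have "(V, restrict (restrict f U) V) \<in> plots X" if "V \<in> \<U>" for V
    using \<U>(2)[OF that] sub[OF that] by (simp add: plot_on_def Int_absorb1)
  ultimately show ?thesis
    using X U \<U>(1) unfolding diffeological_space_def plot_on_def by blast
qed

lemma dsmooth_in: "dsmooth X Y f \<Longrightarrow> x \<in> points X \<Longrightarrow> f x \<in> points Y"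
  unfolding dsmooth_def by auto

lemma dsmooth_ext: "dsmooth X Y f \<Longrightarrow> f \<in> points X \<rightarrow>\<^sub>E points Y"
  unfolding dsmooth_def by auto

lemma dsmooth_plot_on:
  assumes "dsmooth X Y f" "plot_on X U p"
  shows "plot_on Y U (\<lambda>x. f (p x))"
proof -
  have "(U, compose U f (restrict p U)) \<in> plots Y"
    using assms unfolding dsmooth_def plot_on_def by blast
  moreover have "compose U f (restrict p U) = restrict (\<lambda>x. f (p x)) U"
    by (auto simp: compose_def)
  ultimately show ?thesis by (simp add: plot_on_def)
qed

lemma dsmoothI:
  assumes X: "diffeological_space X" and "f \<in> points X \<rightarrow>\<^sub>E points Y"
    and "\<And>U p. plot_on X U p \<Longrightarrow> plot_on Y U (\<lambda>x. f (p x))"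
  shows "dsmooth X Y f"
  unfolding dsmooth_def using assms plots_plot_on(1)[OF X]
  by (auto simp: plot_on_def restrict_compose)

lemma dsmooth_compose:
  assumes "diffeological_space X" "dsmooth X Y f" "dsmooth Y Z g"
  shows "dsmooth X Z (compose (points X) g f)"
proof (rule dsmoothI[OF assms(1)])
  show "compose (points X) g f \<in> points X \<rightarrow>\<^sub>E points Z"
    using assms(2,3) by (auto simp: compose_def dsmooth_in)
  fix U p assume p: "plot_on X U p"
  then show "plot_on Z U (\<lambda>x. compose (points X) g f (p x))"
    using dsmooth_plot_on[OF assms(3) dsmooth_plot_on[OF assms(2) p]] plot_on_in[OF assms(1) p]
    by (subst plot_on_cong[of _ _ "\<lambda>x. g (f (p x))"]) (auto simp: compose_def)
qed

lemma dsmooth_id: "diffeological_space X \<Longrightarrow> dsmooth X X (\<lambda>x\<in>points X. x)"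
  by (rule dsmoothI) (auto simp: plot_on_in cong: plot_on_cong)

text \<open>A Yoneda argument: evaluate at the identity plot of \<open>U\<close>, and conversely
  precompose. Components of cocycles and of their morphisms can thus be handled as plots of
  \<open>G\<close>.\<close>

lemma dsmooth_cart_space_iff:
  assumes Y: "diffeological_space Y" and U: "cartesian U"
  shows "dsmooth (cart_space U) Y h \<longleftrightarrow> h \<in> extensional U \<and> plot_on Y U h"
proof
  obtain n where n: "U \<subseteq> Rn n" using cartesian_Rn[OF U] by blast
  assume h: "dsmooth (cart_space U) Y h"
  have "(U, \<lambda>x\<in>U. x) \<in> plots (cart_space U)"
    using U smooth_map_id[OF n] by (auto simp: cart_space_def)
  then have "plot_on (cart_space U) U (\<lambda>x. x)" by (simp add: plot_on_def)
  from dsmooth_plot_on[OF h this] show "h \<in> extensional U \<and> plot_on Y U h"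
    using dsmooth_ext[OF h] by (simp add: cart_space_def PiE_iff)
next
  assume h: "h \<in> extensional U \<and> plot_on Y U h"
  then have "h \<in> U \<rightarrow>\<^sub>E points Y" using plot_on_in[OF Y] by (auto simp: PiE_iff)
  then show "dsmooth (cart_space U) Y h"
    unfolding dsmooth_def using h plot_on_compose[OF Y, of U h]
    by (auto simp: cart_space_def plot_on_def restrict_compose)
qed

lemma plot_on_dprod:
  assumes X: "diffeological_space X" and Y: "diffeological_space Y"
  shows "plot_on (dprod X Y) U f \<longleftrightarrow> plot_on X U (\<lambda>x. fst (f x)) \<and> plot_on Y U (\<lambda>x. snd (f x))"
proof -
  have c: "compose U fst (restrict f U) = restrict (\<lambda>x. fst (f x)) U"
    "compose U snd (restrict f U) = restrict (\<lambda>x. snd (f x)) U"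
    by (auto simp: compose_def)
  have "restrict f U \<in> U \<rightarrow>\<^sub>E points X \<times> points Y"
    if "plot_on X U (\<lambda>x. fst (f x))" "plot_on Y U (\<lambda>x. snd (f x))"
    using plot_on_in[OF X that(1)] plot_on_in[OF Y that(2)] by (auto simp: mem_Times_iff)
  then show ?thesis
    unfolding plot_on_def dprod_def using c by auto
qed

lemma diffeological_space_dprod:
  assumes X: "diffeological_space X" and Y: "diffeological_space Y"
  shows "diffeological_space (dprod X Y)"
  unfolding diffeological_space_def
proof (intro conjI allI impI ballI)
  have ext: "plot_on (dprod X Y) U p" if "(U, p) \<in> plots (dprod X Y)" for U p
  proof -
    have "p \<in> U \<rightarrow>\<^sub>E points X \<times> points Y" using that by (simp add: dprod_def)
    then have "restrict p U = p" by (simp add: PiE_restrict)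
    then show ?thesis using that by (simp add: plot_on_def)
  qed
  have points: "points (dprod X Y) = points X \<times> points Y" by (simp add: dprod_def)
  fix z assume "z \<in> plots (dprod X Y)"
  then show "case z of (U, p) \<Rightarrow> cartesian U \<and> p \<in> U \<rightarrow>\<^sub>E points (dprod X Y)"
    using ext[of "fst z" "snd z"] plot_on_cartesian[OF X, of "fst z" "\<lambda>x. fst (snd z x)"]
    unfolding plot_on_dprod[OF X Y] by (auto simp: dprod_def)
next
  fix p :: "pt \<Rightarrow> 'a \<times> 'b" assume p: "p \<in> Rn 0 \<rightarrow>\<^sub>E points (dprod X Y)"
  have "plot_on X (Rn 0) (\<lambda>x. fst (p x))" "plot_on Y (Rn 0) (\<lambda>x. snd (p x))"
    using p by (auto intro!: plot_on_point X Y simp: dprod_def PiE_iff mem_Times_iff)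
  then have "plot_on (dprod X Y) (Rn 0) p" by (simp add: plot_on_dprod[OF X Y])
  then show "(Rn 0, p) \<in> plots (dprod X Y)" using p by (simp add: plot_on_def PiE_restrict)
next
  fix U V p f
  assume *: "(U, p) \<in> plots (dprod X Y) \<and> cartesian V \<and> smooth_map V U f"
  then have "p \<in> U \<rightarrow>\<^sub>E points X \<times> points Y" by (simp add: dprod_def)
  then have "restrict p U = p" by (rule PiE_restrict)
  then have "plot_on (dprod X Y) U p" using * by (simp add: plot_on_def)
  then have "plot_on (dprod X Y) V (\<lambda>x. p (f x))"
    using * plot_on_compose[OF X] plot_on_compose[OF Y] by (auto simp: plot_on_dprod[OF X Y])
  then show "(V, compose V p f) \<in> plots (dprod X Y)" by (simp add: plot_on_def restrict_compose)
next
  fix U p \<U>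
  assume *: "cartesian U \<and> p \<in> U \<rightarrow>\<^sub>E points (dprod X Y) \<and> good_cover U \<U> \<and>
    (\<forall>V\<in>\<U>. (V, restrict p V) \<in> plots (dprod X Y))"
  have "\<exists>N. openin (top_of_set U) N \<and> x \<in> N \<and> plot_on X N (\<lambda>x. fst (p x)) \<and> plot_on Y N (\<lambda>x. snd (p x))"
    if "x \<in> U" for x
  proof -
    obtain V where V: "V \<in> \<U>" "x \<in> V"
      using * \<open>x \<in> U\<close> unfolding good_cover_def by blast
    then have "plot_on (dprod X Y) V p" using * by (simp add: plot_on_def)
    then show ?thesis using V * good_cover_openin unfolding plot_on_dprod[OF X Y] by blast
  qed
  then have "plot_on (dprod X Y) U p"
    using * plot_on_local[OF X] plot_on_local[OF Y] unfolding plot_on_dprod[OF X Y] by meson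
  moreover have "restrict p U = p" using * by (intro PiE_restrict) blast
  ultimately show "(U, p) \<in> plots (dprod X Y)" by (simp add: plot_on_def)
qed

lemma subduction_lift:
  assumes P: "diffeological_space P" and "subduction P X \<pi>" "plot_on X U p" "x \<in> U"
  obtains N q where "openin (top_of_set U) N" "x \<in> N" "plot_on P N q" "\<And>y. y \<in> N \<Longrightarrow> \<pi> (q y) = p y"
proof -
  have "\<exists>\<U>. good_cover U \<U> \<and> (\<forall>V\<in>\<U>. \<exists>q. (V, q) \<in> plots P \<and> (\<forall>x\<in>V. \<pi> (q x) = restrict p U x))"
    using assms(2,3) unfolding subduction_def plot_on_def by blast
  then obtain \<U> where \<U>: "good_cover U \<U>"
    "\<And>V. V \<in> \<U> \<Longrightarrow> \<exists>q. (V, q) \<in> plots P \<and> (\<forall>x\<in>V. \<pi> (q x) = restrict p U x)" by blast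
  obtain V where V: "V \<in> \<U>" "x \<in> V" using \<U>(1) assms(4) by (auto simp: good_cover_def)
  have "V \<subseteq> U" using V \<U>(1) by (auto simp: good_cover_def)
  obtain q where q: "(V, q) \<in> plots P" "\<And>x. x \<in> V \<Longrightarrow> \<pi> (q x) = restrict p U x"
    using \<U>(2)[OF V(1)] by blast
  show ?thesis
    by (rule that[OF good_cover_openin[OF \<U>(1) V(1)] V(2) plots_plot_on(1)[OF P q(1)]])
      (use q(2) \<open>V \<subseteq> U\<close> in auto)
qed

lemma subductionI:
  assumes X: "diffeological_space X" and P: "diffeological_space P" and "dsmooth P X \<pi>"
    and "points X \<subseteq> \<pi> ` points P"
    and loc: "\<And>U p x. plot_on X U p \<Longrightarrow> x \<in> U \<Longrightarrow> \<exists>N q. openin (top_of_set U) N \<and> x \<in> N \<and> plot_on P N q \<and>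
      (\<forall>y\<in>N. \<pi> (q y) = p y)"
  shows "subduction P X \<pi>"
  unfolding subduction_def
proof (intro conjI ballI)
  show "\<pi> ` points P = points X" using assms(3,4) by (auto simp: dsmooth_in)
  fix z assume z: "z \<in> plots X"
  obtain U p where [simp]: "z = (U, p)" by force
  have p: "plot_on X U p" "cartesian U" using z plots_plot_on[OF X] by auto
  have "\<exists>\<U>. good_cover U \<U> \<and> (\<forall>V\<in>\<U>. \<exists>q. plot_on P V q \<and> (\<forall>y\<in>V. \<pi> (q y) = p y))"
  proof (rule good_refinement[OF p(2), where Q = "\<lambda>V. \<exists>q. plot_on P V q \<and> (\<forall>y\<in>V. \<pi> (q y) = p y)"])
    show "\<exists>N. openin (top_of_set U) N \<and> x \<in> N \<and> (\<exists>q. plot_on P N q \<and> (\<forall>y\<in>N. \<pi> (q y) = p y))"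
      if "x \<in> U" for x
      using loc[OF p(1) that] by blast
    show "\<exists>q. plot_on P V q \<and> (\<forall>y\<in>V. \<pi> (q y) = p y)"
      if "\<exists>q. plot_on P N q \<and> (\<forall>y\<in>N. \<pi> (q y) = p y)" "V \<subseteq> N" "cartesian V" for N V
      using that plot_on_subset[OF P _ that(3,2)] by blast
  qed
  then obtain \<U> where \<U>: "good_cover U \<U>" "\<And>V. V \<in> \<U> \<Longrightarrow> \<exists>q. plot_on P V q \<and> (\<forall>y\<in>V. \<pi> (q y) = p y)"
    by blast
  have "\<exists>q. (V, q) \<in> plots P \<and> (\<forall>x\<in>V. \<pi> (q x) = p x)" if "V \<in> \<U>" for V
    using \<U>(2)[OF that] unfolding plot_on_def by (metis restrict_apply')
  then show "case z of (U, p) \<Rightarrow> \<exists>\<U>. good_cover U \<U> \<and>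
     (\<forall>V\<in>\<U>. \<exists>q. (V, q) \<in> plots P \<and> (\<forall>x\<in>V. \<pi> (q x) = p x))"
    using \<U>(1) by auto
qed (use assms(3) in auto)

section \<open>Diffeological groups\<close>

locale diffeological_group_loc =
  fixes G :: "'g dgroup" (structure)
  assumes dgroup: "diffeological_group G"

sublocale diffeological_group_loc \<subseteq> group G
  using dgroup by (simp add: diffeological_group_def)

context diffeological_group_loc
begin

lemma gspace: "diffeological_space (gspace G)" and points_gspace [simp]: "points (gspace G) = carrier G"
  using dgroup by (auto simp: diffeological_group_def gspace_def)

lemmas plot_on_carrier = plot_on_in[OF gspace, unfolded points_gspace]

lemma plot_on_mult:
  assumes "plot_on (gspace G) U a" "plot_on (gspace G) U b"
  shows "plot_on (gspace G) U (\<lambda>x. a x \<otimes> b x)"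
proof -
  have "plot_on (dprod (gspace G) (gspace G)) U (\<lambda>x. (a x, b x))"
    using assms by (simp add: plot_on_dprod gspace)
  moreover have "dsmooth (dprod (gspace G) (gspace G)) (gspace G)
       (\<lambda>z\<in>carrier G \<times> carrier G. fst z \<otimes> snd z)"
    using dgroup by (simp add: diffeological_group_def)
  ultimately have "plot_on (gspace G) U
      (\<lambda>x. (\<lambda>z\<in>carrier G \<times> carrier G. fst z \<otimes> snd z) (a x, b x))"
    by (rule dsmooth_plot_on[rotated])
  then show ?thesis
    by (rule plot_on_cong[THEN iffD1, rotated])
      (simp add: plot_on_carrier[OF assms(1)] plot_on_carrier[OF assms(2)])
qed

lemma plot_on_inv:
  assumes "plot_on (gspace G) U a"
  shows "plot_on (gspace G) U (\<lambda>x. inv\<^bsub>G\<^esub> (a x))"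
proof -
  have "dsmooth (gspace G) (gspace G) (\<lambda>a\<in>carrier G. inv\<^bsub>G\<^esub> a)"
    using dgroup by (simp add: diffeological_group_def)
  from dsmooth_plot_on[OF this assms] show ?thesis
    using plot_on_carrier[OF assms]
    by (subst plot_on_cong[of _ _ "\<lambda>x. (\<lambda>z\<in>carrier G. inv\<^bsub>G\<^esub> z) (a x)"]) auto
qed

lemma plot_on_one: "cartesian U \<Longrightarrow> plot_on (gspace G) U (\<lambda>x. \<one>)"
  using plot_on_const[OF gspace] by simp

end

locale dgroup_base = diffeological_group_loc G for G :: "'g dgroup" (structure) +
  fixes X :: "'x dspace"
  assumes base: "diffeological_space X"

section \<open>Principal bundles\<close>

text \<open>The division map of a torsor: on two points of one fibre it is the second component of
  the inverse of the shear map.\<close>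

definition bundle_div :: "'g dgroup \<Rightarrow> ('p, 'x, 'g) gbundle \<Rightarrow> 'p \<Rightarrow> 'p \<Rightarrow> 'g" where
  "bundle_div G B a b = (THE k. k \<in> carrier G \<and> act B (a, k) = b)"

locale principal_bundle_loc = dgroup_base G X for G :: "'g dgroup" (structure) and X :: "'x dspace" +
  fixes B :: "('p, 'x, 'g) gbundle"
  assumes principal: "principal_bundle X G B"
begin

lemma total: "diffeological_space (total B)"
  using principal unfolding principal_bundle_def by (elim conjE)

lemma subduction: "subduction (total B) X (bproj B)"
  using principal unfolding principal_bundle_def by (elim conjE)

lemma act_dsmooth: "dsmooth (dprod (total B) (gspace G)) (total B) (act B)"
  using principal unfolding principal_bundle_def by (elim conjE)

lemma act_one: "a \<in> points (total B) \<Longrightarrow> act B (a, \<one>) = a"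
proof -
  have "\<forall>p\<in>points (total B). act B (p, \<one>) = p"
    using principal unfolding principal_bundle_def by (elim conjE)
  then show "a \<in> points (total B) \<Longrightarrow> act B (a, \<one>) = a" by (rule bspec)
qed

lemma act_act:
  assumes "a \<in> points (total B)" "k \<in> carrier G" "l \<in> carrier G"
  shows "act B (act B (a, k), l) = act B (a, k \<otimes> l)"
proof -
  have "\<forall>p\<in>points (total B). \<forall>k\<in>carrier G. \<forall>l\<in>carrier G.
      act B (act B (p, k), l) = act B (p, k \<otimes> l)"
    using principal unfolding principal_bundle_def by (elim conjE)
  then show ?thesis using assms by blast
qed

lemma shear: "diffeomorphism (dprod (total B) (gspace G))
    (dfibprod (total B) (total B) (bproj B) (bproj B))
    (\<lambda>z\<in>points (total B) \<times> carrier G. (fst z, act B z))"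
  using principal unfolding principal_bundle_def by (elim conjE)

lemma bproj_dsmooth: "dsmooth (total B) X (bproj B)"
  using subduction by (simp add: subduction_def)

lemma bproj_surj: "y \<in> points X \<Longrightarrow> \<exists>a\<in>points (total B). bproj B a = y"
proof -
  have "bproj B ` points (total B) = points X"
    using subduction unfolding subduction_def by (elim conjE)
  then show "y \<in> points X \<Longrightarrow> \<exists>a\<in>points (total B). bproj B a = y" by (metis imageE)
qed

lemma act_in: "a \<in> points (total B) \<Longrightarrow> k \<in> carrier G \<Longrightarrow> act B (a, k) \<in> points (total B)"
  using dsmooth_in[OF act_dsmooth] by (simp add: dprod_def)

lemma bproj_act: "a \<in> points (total B) \<Longrightarrow> k \<in> carrier G \<Longrightarrow> bproj B (act B (a, k)) = bproj B a"
proof -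
  assume "a \<in> points (total B)" "k \<in> carrier G"
  then have "(a, k) \<in> points (dprod (total B) (gspace G))" by (simp add: dprod_def)
  from dsmooth_in[OF conjunct1[OF shear[unfolded diffeomorphism_def]] this]
  show "bproj B (act B (a, k)) = bproj B a"
    using \<open>a \<in> points (total B)\<close> \<open>k \<in> carrier G\<close> by (simp add: dfibprod_def)
qed

lemma plot_on_act:
  assumes "plot_on (total B) U a" "plot_on (gspace G) U k"
  shows "plot_on (total B) U (\<lambda>x. act B (a x, k x))"
  by (rule dsmooth_plot_on[OF act_dsmooth]) (simp add: plot_on_dprod total gspace assms)

text \<open>Injectivity of the shear map says that the action is free, and surjectivity that it is
  transitive on fibres. The smooth inverse \<open>g\<close> is kept because it is what makes
  division smooth.\<close>

lemma bundle_div_aux: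
  obtains g where
    "dsmooth (dfibprod (total B) (total B) (bproj B) (bproj B)) (dprod (total B) (gspace G)) g"
    "\<And>a k. a \<in> points (total B) \<Longrightarrow> k \<in> carrier G \<Longrightarrow> g (a, act B (a, k)) = (a, k)"
    "\<And>a b. a \<in> points (total B) \<Longrightarrow> b \<in> points (total B) \<Longrightarrow> bproj B a = bproj B b \<Longrightarrow>
       \<exists>k\<in>carrier G. act B (a, k) = b"
proof -
  obtain g where g:
    "dsmooth (dfibprod (total B) (total B) (bproj B) (bproj B)) (dprod (total B) (gspace G)) g"
    "\<forall>x\<in>points (dprod (total B) (gspace G)).
      g ((\<lambda>z\<in>points (total B) \<times> carrier G. (fst z, act B z)) x) = x"
    "\<forall>y\<in>points (dfibprod (total B) (total B) (bproj B) (bproj B)).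
      (\<lambda>z\<in>points (total B) \<times> carrier G. (fst z, act B z)) (g y) = y"
    using shear unfolding diffeomorphism_def by blast
  show ?thesis
  proof (rule that[OF g(1)])
    show "g (a, act B (a, k)) = (a, k)" if "a \<in> points (total B)" "k \<in> carrier G" for a k
      using g(2)[rule_format, of "(a, k)"] that by (simp add: dprod_def)
    show "\<exists>k\<in>carrier G. act B (a, k) = b"
      if "a \<in> points (total B)" "b \<in> points (total B)" "bproj B a = bproj B b" for a b
    proof -
      have ab: "(a, b) \<in> points (dfibprod (total B) (total B) (bproj B) (bproj B))"
        using that by (simp add: dfibprod_def)
      have "g (a, b) \<in> points (total B) \<times> carrier G"
        using dsmooth_in[OF g(1) ab] by (simp add: dprod_def)
      then obtain a' k where k: "g (a, b) = (a', k)" "a' \<in> points (total B)" "k \<in> carrier G"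
        by auto
      then show ?thesis using g(3)[rule_format, OF ab] by auto
    qed
  qed
qed

lemma act_cancel:
  assumes "a \<in> points (total B)" "k \<in> carrier G" "l \<in> carrier G" "act B (a, k) = act B (a, l)"
  shows "k = l"
  using assms by (metis bundle_div_aux prod.inject)

lemma bundle_div:
  assumes "a \<in> points (total B)" "b \<in> points (total B)" "bproj B a = bproj B b"
  shows "bundle_div G B a b \<in> carrier G" "act B (a, bundle_div G B a b) = b"
proof -
  have "\<exists>!k. k \<in> carrier G \<and> act B (a, k) = b"
    using act_cancel[OF assms(1)] bundle_div_aux assms by metis
  from theI'[OF this] show "bundle_div G B a b \<in> carrier G" "act B (a, bundle_div G B a b) = b"
    unfolding bundle_div_def by auto
qed

lemma plot_on_bundle_div:
  assumes a: "plot_on (total B) U a" and b: "plot_on (total B) U b"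
    and ab: "\<And>x. x \<in> U \<Longrightarrow> bproj B (a x) = bproj B (b x)"
  shows "plot_on (gspace G) U (\<lambda>x. bundle_div G B (a x) (b x))"
proof -
  obtain g where g:
    "dsmooth (dfibprod (total B) (total B) (bproj B) (bproj B)) (dprod (total B) (gspace G)) g"
    "\<And>a k. a \<in> points (total B) \<Longrightarrow> k \<in> carrier G \<Longrightarrow> g (a, act B (a, k)) = (a, k)"
    by (rule bundle_div_aux) blast
  note in_a = plot_on_in[OF total a] and in_b = plot_on_in[OF total b]
  have "plot_on (dprod (total B) (total B)) U (\<lambda>x. (a x, b x))"
    using a b by (simp add: plot_on_dprod total)
  then have "plot_on (dfibprod (total B) (total B) (bproj B) (bproj B)) U (\<lambda>x. (a x, b x))"
    using ab by (simp add: plot_on_def dfibprod_def)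
  from dsmooth_plot_on[OF g(1) this]
  have "plot_on (gspace G) U (\<lambda>x. snd (g (a x, b x)))"
    by (simp add: plot_on_dprod total gspace)
  moreover have "snd (g (a x, b x)) = bundle_div G B (a x) (b x)" if "x \<in> U" for x
    using g(2)[OF in_a[OF that] bundle_div(1)[OF in_a[OF that] in_b[OF that] ab[OF that]]]
      bundle_div(2)[OF in_a[OF that] in_b[OF that] ab[OF that]] by simp
  ultimately show ?thesis by (rule plot_on_eq)
qed

end

lemma bundle_mapD:
  assumes "bundle_map G B B' f"
  shows "dsmooth (total B) (total B') f"
    and "a \<in> points (total B) \<Longrightarrow> f a \<in> points (total B')"
    and "a \<in> points (total B) \<Longrightarrow> bproj B' (f a) = bproj B a"
    and "a \<in> points (total B) \<Longrightarrow> k \<in> carrier G \<Longrightarrow> f (act B (a, k)) = act B' (f a, k)"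
proof -
  note * = assms[unfolded bundle_map_def]
  show d: "dsmooth (total B) (total B') f" using * by (elim conjE)
  show "a \<in> points (total B) \<Longrightarrow> f a \<in> points (total B')" by (rule dsmooth_in[OF d])
  show "a \<in> points (total B) \<Longrightarrow> bproj B' (f a) = bproj B a"
    "a \<in> points (total B) \<Longrightarrow> k \<in> carrier G \<Longrightarrow> f (act B (a, k)) = act B' (f a, k)"
    using * by simp_all
qed

text \<open>On fibres an equivariant map of torsors is bijective, so only smoothness of the inverse
  needs the diffeology. For a plot \<open>q\<close> of the target, lift its projection locally to a
  plot \<open>r\<close> of the source, by subduction. Then \<open>f \<circ> r\<close> and
  \<open>q\<close> lie in the same fibres, and moving \<open>r\<close> by their quotient gives
  \<open>g \<circ> q\<close>.\<close>

lemma bundle_map_inverse: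
  assumes B: "principal_bundle_loc G X B" and B': "principal_bundle_loc G X B'"
    and f: "bundle_map G B B' f"
  obtains g where "bundle_map G B' B g" "\<And>a. a \<in> points (total B) \<Longrightarrow> g (f a) = a"
    "\<And>b. b \<in> points (total B') \<Longrightarrow> f (g b) = b"
proof -
  interpret B: principal_bundle_loc G X B by (rule B)
  interpret B': principal_bundle_loc G X B' by (rule B')
  note f_in = bundle_mapD(2)[OF f] and f_proj = bundle_mapD(3)[OF f] and f_act = bundle_mapD(4)[OF f]
  have inj: "a = b" if a: "a \<in> points (total B)" and b: "b \<in> points (total B)" and eq: "f a = f b" for a b
  proof -
    have "bproj B a = bproj B b" using f_proj a b eq by metis
    note k = B.bundle_div[OF a b this]
    have "act B' (f a, bundle_div G B a b) = act B' (f a, \<one>\<^bsub>G\<^esub>)"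
      using f_act[OF a k(1)] k(2) eq B'.act_one[OF f_in[OF a]] by simp
    then have "bundle_div G B a b = \<one>\<^bsub>G\<^esub>"
      using B'.act_cancel f_in[OF a] k(1) B.one_closed by blast
    then show ?thesis using k(2) B.act_one[OF a] by simp
  qed
  have ex: "\<exists>a\<in>points (total B). f a = b" if b: "b \<in> points (total B')" for b
  proof -
    obtain a where a: "a \<in> points (total B)" "bproj B a = bproj B' b"
      using B.bproj_surj dsmooth_in[OF B'.bproj_dsmooth b] by blast
    note k = B'.bundle_div[OF f_in[OF a(1)] b, unfolded f_proj[OF a(1)] a(2), OF refl]
    show ?thesis using f_act[OF a(1) k(1)] k B.act_in[OF a(1) k(1)] by auto
  qed
  define g where "g = (\<lambda>b\<in>points (total B'). SOME a. a \<in> points (total B) \<and> f a = b)"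
  have g: "g b \<in> points (total B)" "f (g b) = b" if "b \<in> points (total B')" for b
    using someI_ex[of "\<lambda>a. a \<in> points (total B) \<and> f a = b"] ex[OF that] that
    by (auto simp: g_def)
  have gf: "g (f a) = a" if "a \<in> points (total B)" for a
    using inj g f_in that by metis
  have g_proj: "bproj B (g b) = bproj B' b" if "b \<in> points (total B')" for b
    using f_proj[OF g(1)[OF that]] g(2)[OF that] by simp
  have "dsmooth (total B') (total B) g"
  proof (rule dsmoothI[OF B'.total])
    show "g \<in> points (total B') \<rightarrow>\<^sub>E points (total B)" using g(1) by (auto simp: g_def)
    fix U q assume q: "plot_on (total B') U q"
    note q_in = plot_on_in[OF B'.total q]
    show "plot_on (total B) U (\<lambda>x. g (q x))"
    proof (rule plot_on_local[OF B.total plot_on_cartesian[OF B'.total q]])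
      fix x assume x: "x \<in> U"
      obtain N r where N: "openin (top_of_set U) N" "x \<in> N" "plot_on (total B) N r"
        "\<And>y. y \<in> N \<Longrightarrow> bproj B (r y) = bproj B' (q y)"
        using subduction_lift[OF B.total B.subduction dsmooth_plot_on[OF B'.bproj_dsmooth q] x] by blast
      have NU: "N \<subseteq> U" using N(1) openin_imp_subset by blast
      have r_in: "r y \<in> points (total B)" if "y \<in> N" for y using plot_on_in[OF B.total N(3) that] .
      have proj: "bproj B' (f (r y)) = bproj B' (q y)" if "y \<in> N" for y
        using f_proj[OF r_in[OF that]] N(4)[OF that] by simp
      have "plot_on (gspace G) N (\<lambda>y. bundle_div G B' (f (r y)) (q y))"
        using dsmooth_plot_on[OF bundle_mapD(1)[OF f] N(3)]
          plot_on_subset[OF B'.total q plot_on_cartesian[OF B.total N(3)] NU] proj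
        by (rule B'.plot_on_bundle_div)
      from B.plot_on_act[OF N(3) this]
      have "plot_on (total B) N (\<lambda>y. act B (r y, bundle_div G B' (f (r y)) (q y)))" .
      moreover have "act B (r y, bundle_div G B' (f (r y)) (q y)) = g (q y)" if "y \<in> N" for y
      proof -
        note k = B'.bundle_div[OF f_in[OF r_in[OF that]] q_in[OF subsetD[OF NU that]] proj[OF that]]
        show ?thesis
          using gf[OF B.act_in[OF r_in[OF that] k(1)]] f_act[OF r_in[OF that] k(1)] k(2) by simp
      qed
      ultimately have "plot_on (total B) N (\<lambda>y. g (q y))" by (rule plot_on_eq)
      then show "\<exists>N. openin (top_of_set U) N \<and> x \<in> N \<and> plot_on (total B) N (\<lambda>x. g (q x))"
        using N(1,2) by blast
    qed
  qed
  moreover have "g (act B' (b, k)) = act B (g b, k)" if "b \<in> points (total B')" "k \<in> carrier G" for b k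
    using f_act[OF g(1)[OF that(1)] that(2)] g(2)[OF that(1)] gf[OF B.act_in[OF g(1)[OF that(1)] that(2)]]
    by simp
  ultimately have "bundle_map G B' B g" using g_proj by (simp add: bundle_map_def)
  then show ?thesis using that gf g(2) by blast
qed

lemma bundle_map_compose:
  assumes "diffeological_space (total B)" "bundle_map G B B' f" "bundle_map G B' B'' g"
    and "\<And>a k. a \<in> points (total B) \<Longrightarrow> k \<in> carrier G \<Longrightarrow> act B (a, k) \<in> points (total B)"
  shows "bundle_map G B B'' (compose (points (total B)) g f)"
  unfolding bundle_map_def
proof (intro conjI ballI)
  show "dsmooth (total B) (total B'') (compose (points (total B)) g f)"
    using dsmooth_compose[OF assms(1)] bundle_mapD(1) assms(2,3) by blast
qed (simp_all add: compose_eq bundle_mapD[OF assms(2)] bundle_mapD[OF assms(3)] assms(4))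

lemma groupoid_DiffPrin:
  assumes X: "diffeological_space X" and G: "diffeological_group G"
  shows "groupoid (DiffPrin X G :: (('p, 'x, 'g) gbundle, 'p \<Rightarrow> 'p) category)"
proof -
  have loc: "principal_bundle_loc G X B" if "principal_bundle X G B" for B :: "('p, 'x, 'g) gbundle"
    using X G that by unfold_locales
  have ext: "f \<in> extensional (points (total B))" if "bundle_map G B B' f" for f and B B' :: "('p, 'x, 'g) gbundle"
    using dsmooth_ext[OF bundle_mapD(1)[OF that]] by (simp add: PiE_iff)
  have eq: "f = f'" if "f \<in> extensional (points (total B))" "f' \<in> extensional (points (total B))"
      "\<And>a. a \<in> points (total B) \<Longrightarrow> f a = f' a" for f f' and B :: "('p, 'x, 'g) gbundle"
    using that extensionalityI by blast
  have "is_category (DiffPrin X G :: (('p, 'x, 'g) gbundle, 'p \<Rightarrow> 'p) category)"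
    unfolding is_category_def DiffPrin_def
  proof (simp, intro conjI allI impI)
    fix B :: "('p, 'x, 'g) gbundle" assume B: "principal_bundle X G B"
    interpret principal_bundle_loc G X B by (rule loc[OF B])
    show "bundle_map G B B (\<lambda>p\<in>points (total B). p)"
      unfolding bundle_map_def by (simp add: dsmooth_id[OF total] act_in)
    fix B' :: "('p, 'x, 'g) gbundle" and f assume f: "principal_bundle X G B'" "bundle_map G B B' f"
    show "compose (points (total B)) f (\<lambda>p\<in>points (total B). p) = f"
      by (rule eq[OF _ ext[OF f(2)]]) (auto simp: compose_eq)
    show "compose (points (total B)) (\<lambda>p\<in>points (total B'). p) f = f"
      by (rule eq[OF _ ext[OF f(2)]]) (auto simp: compose_eq bundle_mapD[OF f(2)])
    fix B'' :: "('p, 'x, 'g) gbundle" and g assume g: "principal_bundle X G B''" "bundle_map G B' B'' g"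
    show "bundle_map G B B'' (compose (points (total B)) g f)"
      using bundle_map_compose[OF total f(2) g(2)] act_in by blast
    fix B3 :: "('p, 'x, 'g) gbundle" and h assume "principal_bundle X G B3" "bundle_map G B'' B3 h"
    show "compose (points (total B)) h (compose (points (total B)) g f) =
      compose (points (total B)) (compose (points (total B')) h g) f"
      by (rule eq[of _ B]) (auto simp: compose_eq bundle_mapD[OF f(2)])
  qed
  moreover have "is_isomorphism (DiffPrin X G) B B' f"
    if B: "principal_bundle X G B" "principal_bundle X G B'" "bundle_map G B B' f" for f
    and B B' :: "('p, 'x, 'g) gbundle"
  proof -
    obtain g where g: "bundle_map G B' B g" "\<And>a. a \<in> points (total B) \<Longrightarrow> g (f a) = a"
      "\<And>b. b \<in> points (total B') \<Longrightarrow> f (g b) = b"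
      using bundle_map_inverse[OF loc[OF B(1)] loc[OF B(2)] B(3)] by blast
    then have "compose (points (total B)) g f = (\<lambda>p\<in>points (total B). p)"
      "compose (points (total B')) f g = (\<lambda>p\<in>points (total B'). p)"
      by (auto simp: compose_def)
    then show ?thesis using g(1) B(3) by (auto simp: is_isomorphism_def DiffPrin_def)
  qed
  ultimately show ?thesis unfolding groupoid_def by (simp add: DiffPrin_def)
qed

section \<open>The groupoid of cocycles\<close>

lemma plot_mapsD:
  assumes "(p1, p0, f) \<in> plot_maps X"
  shows "p1 \<in> plots X" "p0 \<in> plots X" "smooth_map (fst p1) (fst p0) f"
    "x \<in> fst p1 \<Longrightarrow> f x \<in> fst p0" "x \<in> fst p1 \<Longrightarrow> snd p0 (f x) = snd p1 x"
  using assms smooth_map_in unfolding plot_maps_def by auto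

context dgroup_base
begin

lemma plot_cartesian: "p \<in> plots X \<Longrightarrow> cartesian (fst p)"
  using plots_plot_on(3)[OF base, of "fst p" "snd p"] by simp

lemma plot_maps_compose:
  assumes "(p2, p1, f1) \<in> plot_maps X" "(p1, p0, f0) \<in> plot_maps X"
  shows "(p2, p0, compose (fst p2) f0 f1) \<in> plot_maps X"
  using assms smooth_map_compose smooth_map_in
  unfolding plot_maps_def by (fastforce simp: compose_eq)

lemma cocycleD:
  assumes "cocycle X G g" "(p1, p0, f) \<in> plot_maps X"
  shows "plot_on (gspace G) (fst p1) (g (p1, p0, f))" "g (p1, p0, f) \<in> extensional (fst p1)"
    "x \<in> fst p1 \<Longrightarrow> g (p1, p0, f) x \<in> carrier G"
proof -
  have "dsmooth (cart_space (fst p1)) (gspace G) (g (p1, p0, f))"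
    using assms unfolding cocycle_def by auto
  then show *: "plot_on (gspace G) (fst p1) (g (p1, p0, f))" "g (p1, p0, f) \<in> extensional (fst p1)"
    using dsmooth_cart_space_iff[OF gspace plot_cartesian[OF plot_mapsD(1)[OF assms(2)]]] by auto
  then show "x \<in> fst p1 \<Longrightarrow> g (p1, p0, f) x \<in> carrier G" using plot_on_carrier by blast
qed

lemma cocycle_compose:
  assumes "cocycle X G g" "(p2, p1, f1) \<in> plot_maps X" "(p1, p0, f0) \<in> plot_maps X" "x \<in> fst p2"
  shows "g (p2, p0, compose (fst p2) f0 f1) x = g (p1, p0, f0) (f1 x) \<otimes> g (p2, p1, f1) x"
  using assms unfolding cocycle_def by blast

lemma cocycleI:
  assumes "g \<in> extensional (plot_maps X)"
    and "\<And>p1 p0 f. (p1, p0, f) \<in> plot_maps X \<Longrightarrow>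
      plot_on (gspace G) (fst p1) (g (p1, p0, f)) \<and> g (p1, p0, f) \<in> extensional (fst p1)"
    and "\<And>p2 p1 p0 f1 f0 x. (p2, p1, f1) \<in> plot_maps X \<Longrightarrow> (p1, p0, f0) \<in> plot_maps X \<Longrightarrow> x \<in> fst p2 \<Longrightarrow>
      g (p2, p0, compose (fst p2) f0 f1) x = g (p1, p0, f0) (f1 x) \<otimes> g (p2, p1, f1) x"
  shows "cocycle X G g"
proof -
  have "dsmooth (cart_space (fst p1)) (gspace G) (g (p1, p0, f))" if "(p1, p0, f) \<in> plot_maps X" for p1 p0 f
    using assms(2)[OF that] dsmooth_cart_space_iff[OF gspace plot_cartesian[OF plot_mapsD(1)[OF that]]]
    by blast
  then show ?thesis using assms(1,3) unfolding cocycle_def by blast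
qed

lemma cocycle_mapD:
  assumes "cocycle_map X G g g' h"
  shows "h \<in> extensional (plots X)"
    and "p \<in> plots X \<Longrightarrow> plot_on (gspace G) (fst p) (h p)"
    and "p \<in> plots X \<Longrightarrow> h p \<in> extensional (fst p)"
    and "p \<in> plots X \<Longrightarrow> x \<in> fst p \<Longrightarrow> h p x \<in> carrier G"
    and "(p1, p0, f) \<in> plot_maps X \<Longrightarrow> x \<in> fst p1 \<Longrightarrow>
        g' (p1, p0, f) x \<otimes> h p1 x = h p0 (f x) \<otimes> g (p1, p0, f) x"
proof -
  have sm: "\<forall>p\<in>plots X. dsmooth (cart_space (fst p)) (gspace G) (h p)"
    using assms unfolding cocycle_map_def by (elim conjE)
  show *: "plot_on (gspace G) (fst p) (h p)" "h p \<in> extensional (fst p)" if "p \<in> plots X"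
    using sm that dsmooth_cart_space_iff[OF gspace plot_cartesian[OF that]] by auto
  show "p \<in> plots X \<Longrightarrow> x \<in> fst p \<Longrightarrow> h p x \<in> carrier G" using *(1) plot_on_carrier by blast
  show "h \<in> extensional (plots X)" using assms unfolding cocycle_map_def by (elim conjE)
  show "(p1, p0, f) \<in> plot_maps X \<Longrightarrow> x \<in> fst p1 \<Longrightarrow>
        g' (p1, p0, f) x \<otimes> h p1 x = h p0 (f x) \<otimes> g (p1, p0, f) x"
    using assms unfolding cocycle_map_def by auto
qed

lemma cocycle_mapI:
  assumes "\<And>p. p \<in> plots X \<Longrightarrow> plot_on (gspace G) (fst p) (h p)"
    and "\<And>p1 p0 f x. (p1, p0, f) \<in> plot_maps X \<Longrightarrow> x \<in> fst p1 \<Longrightarrow>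
        g' (p1, p0, f) x \<otimes> h p1 x = h p0 (f x) \<otimes> g (p1, p0, f) x"
  shows "cocycle_map X G g g' (\<lambda>p\<in>plots X. \<lambda>x\<in>fst p. h p x)"
  unfolding cocycle_map_def
proof (intro conjI ballI)
  fix p assume p: "p \<in> plots X"
  then show "dsmooth (cart_space (fst p)) (gspace G) ((\<lambda>p\<in>plots X. \<lambda>x\<in>fst p. h p x) p)"
    using assms(1)[OF p] by (simp add: dsmooth_cart_space_iff[OF gspace plot_cartesian[OF p]])
next
  fix z assume z: "z \<in> plot_maps X"
  obtain p1 p0 f where [simp]: "z = (p1, p0, f)" by (metis surj_pair)
  note m = z[unfolded \<open>z = (p1, p0, f)\<close>]
  show "case z of (p1, p0, f) \<Rightarrow> \<forall>x\<in>fst p1.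
      g' (p1, p0, f) x \<otimes> (\<lambda>p\<in>plots X. \<lambda>x\<in>fst p. h p x) p1 x =
      (\<lambda>p\<in>plots X. \<lambda>x\<in>fst p. h p x) p0 (f x) \<otimes> g (p1, p0, f) x"
    using assms(2)[OF m] plot_mapsD(1,2)[OF m] plot_mapsD(4)[OF m] by simp
qed simp

lemma cocycle_map_eqI:
  assumes "cocycle_map X G g g' h" "cocycle_map X G g g' h'"
    and "\<And>p x. p \<in> plots X \<Longrightarrow> x \<in> fst p \<Longrightarrow> h p x = h' p x"
  shows "h = h'"
proof (rule extensionalityI[OF cocycle_mapD(1)[OF assms(1)] cocycle_mapD(1)[OF assms(2)]])
  fix p assume "p \<in> plots X"
  then show "h p = h' p"
    using assms(3) by (intro extensionalityI[OF cocycle_mapD(3)[OF assms(1)] cocycle_mapD(3)[OF assms(2)]])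
qed

lemma cocycle_map_id:
  assumes "cocycle X G g"
  shows "cocycle_map X G g g (\<lambda>p\<in>plots X. \<lambda>x\<in>fst p. \<one>)"
  by (rule cocycle_mapI) (auto simp: plot_on_one plot_cartesian cocycleD[OF assms])

lemma cocycle_map_comp:
  assumes "cocycle X G g" "cocycle X G g'" "cocycle X G g''"
    and h: "cocycle_map X G g g' h" and h': "cocycle_map X G g' g'' h'"
  shows "cocycle_map X G g g'' (\<lambda>p\<in>plots X. \<lambda>x\<in>fst p. h' p x \<otimes> h p x)"
proof (rule cocycle_mapI)
  show "plot_on (gspace G) (fst p) (\<lambda>x. h' p x \<otimes> h p x)" if "p \<in> plots X" for p
    by (rule plot_on_mult[OF cocycle_mapD(2)[OF h' that] cocycle_mapD(2)[OF h that]])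
  fix p1 p0 f x assume f: "(p1, p0, f) \<in> plot_maps X" and x: "x \<in> fst p1"
  note m = plot_mapsD(1,2)[OF f] plot_mapsD(4)[OF f x]
  note c = cocycleD(3)[OF assms(1) f x] cocycleD(3)[OF assms(2) f x] cocycleD(3)[OF assms(3) f x]
    cocycle_mapD(4)[OF h m(1) x] cocycle_mapD(4)[OF h m(2,3)]
    cocycle_mapD(4)[OF h' m(1) x] cocycle_mapD(4)[OF h' m(2,3)]
  have "g'' (p1, p0, f) x \<otimes> (h' p1 x \<otimes> h p1 x) =
      (h' p0 (f x) \<otimes> g' (p1, p0, f) x) \<otimes> h p1 x"
    using c cocycle_mapD(5)[OF h' f x] by (simp add: m_assoc[symmetric])
  also have "\<dots> = h' p0 (f x) \<otimes> (h p0 (f x) \<otimes> g (p1, p0, f) x)"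
    using c cocycle_mapD(5)[OF h f x] by (simp add: m_assoc)
  finally show "g'' (p1, p0, f) x \<otimes> (h' p1 x \<otimes> h p1 x) =
      (h' p0 (f x) \<otimes> h p0 (f x)) \<otimes> g (p1, p0, f) x"
    using c by (simp add: m_assoc)
qed

lemma cocycle_map_inv:
  assumes "cocycle X G g" "cocycle X G g'" and h: "cocycle_map X G g g' h"
  shows "cocycle_map X G g' g (\<lambda>p\<in>plots X. \<lambda>x\<in>fst p. inv\<^bsub>G\<^esub> (h p x))"
proof (rule cocycle_mapI)
  show "plot_on (gspace G) (fst p) (\<lambda>x. inv\<^bsub>G\<^esub> (h p x))" if "p \<in> plots X" for p
    by (rule plot_on_inv[OF cocycle_mapD(2)[OF h that]])
  fix p1 p0 f x assume f: "(p1, p0, f) \<in> plot_maps X" and x: "x \<in> fst p1"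
  note m = plot_mapsD(1,2)[OF f] plot_mapsD(4)[OF f x]
  note c = cocycleD(3)[OF assms(1) f x] cocycleD(3)[OF assms(2) f x]
    cocycle_mapD(4)[OF h m(1) x] cocycle_mapD(4)[OF h m(2,3)]
  have "g (p1, p0, f) x = inv\<^bsub>G\<^esub> (h p0 (f x)) \<otimes> (g' (p1, p0, f) x \<otimes> h p1 x)"
    using cocycle_mapD(5)[OF h f x] c by (simp add: m_assoc[symmetric])
  then show "g (p1, p0, f) x \<otimes> inv\<^bsub>G\<^esub> (h p1 x) = inv\<^bsub>G\<^esub> (h p0 (f x)) \<otimes> g' (p1, p0, f) x"
    using c by (simp add: m_assoc)
qed

lemma groupoid_Coc: "groupoid (Coc X G)"
proof -
  have "is_category (Coc X G)"
    unfolding is_category_def Coc_def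
  proof (simp, intro conjI allI impI)
    fix g1 assume g1: "cocycle X G g1"
    show "cocycle_map X G g1 g1 (\<lambda>p\<in>plots X. \<lambda>x\<in>fst p. \<one>)" by (rule cocycle_map_id[OF g1])
    fix g2 h assume g2: "cocycle X G g2" and h: "cocycle_map X G g1 g2 h"
    have e: "\<And>p. p \<notin> plots X \<Longrightarrow> h p = undefined"
      "\<And>p x. p \<in> plots X \<Longrightarrow> x \<notin> fst p \<Longrightarrow> h p x = undefined"
      using extensional_arb[OF cocycle_mapD(1)[OF h]] extensional_arb[OF cocycle_mapD(3)[OF h]] by auto
    show "(\<lambda>p\<in>plots X. \<lambda>x\<in>fst p. h p x \<otimes> (if p \<in> plots X then \<lambda>x\<in>fst p. \<one> else undefined) x) = h"
      using e by (auto simp: restrict_def fun_eq_iff cocycle_mapD(4)[OF h])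
    show "(\<lambda>p\<in>plots X. \<lambda>x\<in>fst p. (if p \<in> plots X then \<lambda>x\<in>fst p. \<one> else undefined) x \<otimes> h p x) = h"
      using e by (auto simp: restrict_def fun_eq_iff cocycle_mapD(4)[OF h])
    fix g3 h' assume g3: "cocycle X G g3" and h': "cocycle_map X G g2 g3 h'"
    show "cocycle_map X G g1 g3 (\<lambda>p\<in>plots X. \<lambda>x\<in>fst p. h' p x \<otimes> h p x)"
      by (rule cocycle_map_comp[OF g1 g2 g3 h h'])
    fix g4 h'' assume g4: "cocycle X G g4" and h'': "cocycle_map X G g3 g4 h''"
    show "(\<lambda>p\<in>plots X. \<lambda>x\<in>fst p. h'' p x \<otimes>
        (if p \<in> plots X then \<lambda>x\<in>fst p. h' p x \<otimes> h p x else undefined) x) =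
      (\<lambda>p\<in>plots X. \<lambda>x\<in>fst p. (if p \<in> plots X then \<lambda>x\<in>fst p. h'' p x \<otimes> h' p x else undefined) x
        \<otimes> h p x)"
      by (auto simp: restrict_def fun_eq_iff m_assoc cocycle_mapD(4)[OF h] cocycle_mapD(4)[OF h']
          cocycle_mapD(4)[OF h''])
  qed
  moreover have "is_isomorphism (Coc X G) g g' h"
    if g: "cocycle X G g" "cocycle X G g'" "cocycle_map X G g g' h" for g g' h
    unfolding is_isomorphism_def using that cocycle_map_inv[OF g]
    by (auto simp: Coc_def restrict_def fun_eq_iff cocycle_mapD(4)[OF g(3)]
        intro!: bexI[of _ "\<lambda>p\<in>plots X. \<lambda>x\<in>fst p. inv\<^bsub>G\<^esub> (h p x)"])
  ultimately show ?thesis unfolding groupoid_def by (simp add: Coc_def)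
qed

end

section \<open>The bundle of a cocycle\<close>

lemma good_cover_single: "cartesian U \<Longrightarrow> good_cover U {U}"
  unfolding good_cover_def
proof (intro conjI ballI allI impI)
  fix \<F> assume "cartesian U" "finite \<F> \<and> \<F> \<noteq> {} \<and> \<F> \<subseteq> {U} \<and> \<Inter> \<F> \<noteq> {}"
  moreover from this have "\<F> = {U}" by (metis subset_singletonD)
  ultimately show "cartesian (\<Inter> \<F>)" by simp
qed (simp_all add: euclidean_product_topology)

text \<open>Refine the cover of \<open>U\<close> that consists of \<open>V\<close> and
  \<open>U - {x}\<close>: a member that contains \<open>x\<close> must lie in
  \<open>V\<close>.\<close>

lemma cartesian_nbhd:
  assumes U: "cartesian U" and V: "openin (top_of_set U) V" "x \<in> V"
  obtains N where "openin (top_of_set U) N" "x \<in> N" "N \<subseteq> V" "cartesian N"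
proof -
  have x: "x \<in> U" using V openin_imp_subset by blast
  have "\<exists>\<U>. good_cover U \<U> \<and> (\<forall>N\<in>\<U>. (x \<in> N \<longrightarrow> N \<subseteq> V) \<and> cartesian N)"
  proof (rule good_refinement[OF U, where Q = "\<lambda>N. x \<in> N \<longrightarrow> N \<subseteq> V"])
    fix y assume y: "y \<in> U"
    show "\<exists>N. openin (top_of_set U) N \<and> y \<in> N \<and> (x \<in> N \<longrightarrow> N \<subseteq> V)"
    proof (cases "y = x")
      case True
      then show ?thesis using V by blast
    next
      case False
      have "openin (top_of_set U) (U - {x})" by (rule openin_delete) simp
      then show ?thesis using y False by blast
    qed
  qed blast
  then obtain \<U> where \<U>: "good_cover U \<U>" "\<And>N. N \<in> \<U> \<Longrightarrow> x \<in> N \<Longrightarrow> N \<subseteq> V"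
    "\<And>N. N \<in> \<U> \<Longrightarrow> cartesian N" by blast
  obtain N where N: "N \<in> \<U>" "x \<in> N" using \<U>(1) x unfolding good_cover_def by blast
  show ?thesis by (rule that[OF good_cover_openin[OF \<U>(1) N(1)] N(2) \<U>(2)[OF N] \<U>(3)[OF N(1)]])
qed

section \<open>One-point plots\<close>

definition point_plot :: "'x \<Rightarrow> 'x param" where
  "point_plot y = (Rn 0, \<lambda>_\<in>Rn 0. y)"

definition point_map :: "'x param \<Rightarrow> pt \<Rightarrow> 'x plot_map" where
  "point_map p x = (point_plot (snd p x), p, \<lambda>_\<in>Rn 0. x)"

abbreviation origin :: pt where
  "origin \<equiv> \<lambda>_. 0"

lemma origin_in: "origin \<in> Rn 0"
  by (simp add: Rn_iff)

lemma points_prebundle: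
  "(p, x, k) \<in> points (prebundle X G) \<longleftrightarrow> p \<in> plots X \<and> x \<in> fst p \<and> k \<in> carrier G"
  by (auto simp: prebundle_def dcoprod_def dprod_def cart_space_def gspace_def)

lemma (in dgroup_base) point_plot_in: "y \<in> points X \<Longrightarrow> point_plot y \<in> plots X"
  using plot_on_point[OF base, of "\<lambda>_. y"] by (simp add: point_plot_def plot_on_def)

lemma (in dgroup_base) plot_in: "p \<in> plots X \<Longrightarrow> x \<in> fst p \<Longrightarrow> snd p x \<in> points X"
  using plot_on_in[OF base plots_plot_on(1)[OF base], of "fst p" "snd p" x] by simp

lemma (in dgroup_base) point_map_in:
  assumes "p \<in> plots X" "x \<in> fst p"
  shows "point_map p x \<in> plot_maps X"
  using assms point_plot_in[OF plot_in[OF assms]] smooth_map_const[of "Rn 0" 0 x "fst p"]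
  by (auto simp: point_map_def plot_maps_def point_plot_def)

section \<open>The generated equivalence relation\<close>

locale cons_loc = dgroup_base G X for G :: "'g dgroup" (structure) and X :: "'x dspace" +
  fixes \<iota> :: "('x, 'g) prebundle_pt set \<Rightarrow> 'p" and g :: "'x plot_map \<Rightarrow> pt \<Rightarrow> 'g"
  assumes inj: "inj \<iota>" and cocycle: "cocycle X G g"
begin

text \<open>
  Transport to the zero-dimensional plot through \<open>p x\<close>, a complete invariant of the equivalence
  relation \<^const>\<open>cons_rel\<close>.
\<close>

definition normal :: "('x, 'g) prebundle_pt \<Rightarrow> 'x \<times> 'g" where
  "normal = (\<lambda>(p, x, k). (snd p x, inv\<^bsub>G\<^esub> (g (point_map p x) origin) \<otimes> k))"

abbreviation cls :: "'x param \<Rightarrow> pt \<Rightarrow> 'g \<Rightarrow> 'p" where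
  "cls p x k \<equiv> cons_class \<iota> X G g (p, x, k)"

abbreviation C :: "'p dspace" where
  "C \<equiv> cons_space \<iota> X G g"

abbreviation B :: "('p, 'x, 'g) gbundle" where
  "B \<equiv> cons_bundle \<iota> X G g"

lemma g_point_in:
  assumes "p \<in> plots X" "x \<in> fst p"
  shows "g (point_map p x) origin \<in> carrier G"
  using cocycleD(3)[OF cocycle point_map_in[OF assms, unfolded point_map_def], of origin]
  by (simp add: point_map_def point_plot_def origin_in)

text \<open>The one-point map at \<open>x\<close>, followed by \<open>f\<close>, is the one-point
  map at \<open>f x\<close>; this is the cocycle identity for that composite.\<close>

lemma g_point_map:
  assumes f: "(p1, p0, f) \<in> plot_maps X" and x: "x \<in> fst p1"
  shows "g (point_map p0 (f x)) origin = g (p1, p0, f) x \<otimes> g (point_map p1 x) origin"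
proof -
  have "point_map p0 (f x) = (point_plot (snd p1 x), p0, compose (Rn 0) f (\<lambda>_\<in>Rn 0. x))"
    using plot_mapsD(5)[OF f x] by (auto simp: point_map_def compose_def)
  then show ?thesis
    using cocycle_compose[OF cocycle point_map_in[OF plot_mapsD(1)[OF f] x, unfolded point_map_def] f, of origin]
    by (simp add: point_map_def point_plot_def origin_in)
qed

lemma normal_step:
  assumes f: "(p1, p0, f) \<in> plot_maps X" and x: "x \<in> fst p1" and k: "k \<in> carrier G"
  shows "normal (p0, f x, g (p1, p0, f) x \<otimes> k) = normal (p1, x, k)"
  using g_point_in[OF plot_mapsD(1)[OF f] x] cocycleD(3)[OF cocycle f x] k plot_mapsD(5)[OF f x]
  by (simp add: normal_def g_point_map[OF f x] inv_mult_group m_assoc inv_solve_left')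

text \<open>Having equal invariants is itself one of the relations that are intersected, which
  bounds \<open>cons_rel\<close> from above. Conversely, a single generating step joins every
  \<open>z\<close> to the representative over its one-point plot that carries
  \<open>snd (normal z)\<close>, so two elements with equal invariants are joined through a common
  third one. Chains of steps of arbitrary length never have to be followed.\<close>

lemma cons_rel_iff:
  "(z, z') \<in> cons_rel X G g \<longleftrightarrow> z \<in> points (prebundle X G) \<and> z' \<in> points (prebundle X G) \<and> normal z = normal z'"
proof
  define r where "r = {(z, z'). z \<in> points (prebundle X G) \<and> z' \<in> points (prebundle X G) \<and> normal z = normal z'}"
  have "equiv (points (prebundle X G)) r"
    by (rule equivI) (auto simp: r_def refl_on_def sym_def trans_def)
  moreover have "\<forall>(p1, p0, f)\<in>plot_maps X. \<forall>x\<in>fst p1. \<forall>k\<in>carrier G.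
        ((p1, x, k), (p0, f x, g (p1, p0, f) x \<otimes> k)) \<in> r"
  proof (intro ballI, clarify)
    fix a b c d f x k
    assume *: "((a, b), (c, d), f) \<in> plot_maps X" "x \<in> fst (a, b)" "k \<in> carrier G"
    show "(((a, b), x, k), ((c, d), f x, g ((a, b), (c, d), f) x \<otimes> k)) \<in> r"
      using normal_step[OF *] plot_mapsD(1,2)[OF *(1)] plot_mapsD(4)[OF *(1,2)] * cocycleD(3)[OF cocycle *(1,2)]
      by (auto simp: r_def points_prebundle)
  qed
  ultimately show "z \<in> points (prebundle X G) \<and> z' \<in> points (prebundle X G) \<and> normal z = normal z'"
    if "(z, z') \<in> cons_rel X G g"
    using that unfolding cons_rel_def r_def by blast
next
  assume *: "z \<in> points (prebundle X G) \<and> z' \<in> points (prebundle X G) \<and> normal z = normal z'"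
  show "(z, z') \<in> cons_rel X G g"
    unfolding cons_rel_def
  proof (rule InterI, clarify)
    fix r assume r: "equiv (points (prebundle X G)) r"
      and step: "\<forall>(p1, p0, f)\<in>plot_maps X. \<forall>x\<in>fst p1. \<forall>k\<in>carrier G.
        ((p1, x, k), (p0, f x, g (p1, p0, f) x \<otimes> k)) \<in> r"
    have "((point_plot (fst (normal z)), origin, snd (normal z)), z) \<in> r"
      if z: "z \<in> points (prebundle X G)" for z
    proof -
      obtain p x k where [simp]: "z = (p, x, k)" by (metis surj_pair)
      have p: "p \<in> plots X" "x \<in> fst p" "k \<in> carrier G" using z by (auto simp: points_prebundle)
      note a = g_point_in[OF p(1,2)]
      have "((point_plot (snd p x), origin, snd (normal z)),
          (p, (\<lambda>_\<in>Rn 0. x) origin, g (point_map p x) origin \<otimes> snd (normal z))) \<in> r"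
        using step point_map_in[OF p(1,2)] origin_in a p(3)
        by (force simp: point_map_def point_plot_def normal_def)
      moreover have "g (point_map p x) origin \<otimes> snd (normal z) = k"
        using a p(3) by (simp add: normal_def m_assoc[symmetric])
      ultimately show ?thesis by (simp add: normal_def origin_in)
    qed
    then have "((point_plot (fst (normal z)), origin, snd (normal z)), z) \<in> r"
      "((point_plot (fst (normal z)), origin, snd (normal z)), z') \<in> r" using * by metis+
    then show "(z, z') \<in> r" using r by (meson equivE symD transD)
  qed
qed

lemma cons_class_eq_iff:
  assumes "z \<in> points (prebundle X G)" "z' \<in> points (prebundle X G)"
  shows "cons_class \<iota> X G g z = cons_class \<iota> X G g z' \<longleftrightarrow> normal z = normal z'"
proof -
  have "cons_rel X G g `` {z} = {w \<in> points (prebundle X G). normal z = normal w}"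
    if "z \<in> points (prebundle X G)" for z
    by (rule Set.set_eqI) (simp add: cons_rel_iff that)
  then show ?thesis
    using assms unfolding cons_class_def inj_eq[OF inj] by auto
qed

lemma points_C: "u \<in> points C \<longleftrightarrow> (\<exists>p x k. p \<in> plots X \<and> x \<in> fst p \<and> k \<in> carrier G \<and> u = cls p x k)"
proof -
  have "points C = cons_class \<iota> X G g ` points (prebundle X G)"
    by (simp add: cons_space_def dquot_def)
  then show ?thesis by (force simp: points_prebundle)
qed

lemma cls_in: "p \<in> plots X \<Longrightarrow> x \<in> fst p \<Longrightarrow> k \<in> carrier G \<Longrightarrow> cls p x k \<in> points C"
  using points_C by blast

lemma cls_eq_iff:
  assumes "p \<in> plots X" "x \<in> fst p" "k \<in> carrier G" "p' \<in> plots X" "x' \<in> fst p'" "k' \<in> carrier G"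
  shows "cls p x k = cls p' x' k' \<longleftrightarrow> normal (p, x, k) = normal (p', x', k')"
  using assms by (simp add: cons_class_eq_iff points_prebundle)

lemma cls_eq_same_iff:
  assumes "p \<in> plots X" "x \<in> fst p" "k \<in> carrier G" "k' \<in> carrier G"
  shows "cls p x k = cls p x k' \<longleftrightarrow> k = k'"
  using assms g_point_in[OF assms(1,2)] by (simp add: cls_eq_iff normal_def)

lemma cls_step:
  assumes f: "(p1, p0, f) \<in> plot_maps X" and x: "x \<in> fst p1" and k: "k \<in> carrier G"
  shows "cls p0 (f x) (g (p1, p0, f) x \<otimes> k) = cls p1 x k"
  using normal_step[OF assms] plot_mapsD(1,2)[OF f] plot_mapsD(4)[OF f x] x k cocycleD(3)[OF cocycle f x]
  by (simp add: cls_eq_iff)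

lemma normal_mult:
  assumes "p \<in> plots X" "x \<in> fst p" "k \<in> carrier G" "l \<in> carrier G"
  shows "normal (p, x, k \<otimes> l) = (fst (normal (p, x, k)), snd (normal (p, x, k)) \<otimes> l)"
  using assms g_point_in[OF assms(1,2)] by (simp add: normal_def m_assoc)

lemma total_B [simp]: "total B = C"
  by (simp add: cons_bundle_def)

lemma bproj_cls:
  assumes "p \<in> plots X" "x \<in> fst p" "k \<in> carrier G"
  shows "bproj B (cls p x k) = snd p x"
proof -
  have "(THE y. \<exists>p' x' k'. (p', x', k') \<in> points (prebundle X G) \<and>
          cls p x k = cls p' x' k' \<and> y = snd p' x') = snd p x"
  proof (rule the_equality)
    show "\<exists>p' x' k'. (p', x', k') \<in> points (prebundle X G) \<and>
          cls p x k = cls p' x' k' \<and> snd p x = snd p' x'"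
      using assms by (intro exI[of _ p] exI[of _ x] exI[of _ k]) (simp add: points_prebundle)
    fix y assume "\<exists>p' x' k'. (p', x', k') \<in> points (prebundle X G) \<and> cls p x k = cls p' x' k' \<and> y = snd p' x'"
    then obtain p' x' k' where *: "p' \<in> plots X" "x' \<in> fst p'" "k' \<in> carrier G"
      "cls p x k = cls p' x' k'" "y = snd p' x'" by (auto simp: points_prebundle)
    from *(4) show "y = snd p x"
      unfolding cls_eq_iff[OF assms *(1-3)] by (simp add: normal_def *(5))
  qed
  then show ?thesis using cls_in[OF assms] by (simp add: cons_bundle_def)
qed

lemma act_cls:
  assumes "p \<in> plots X" "x \<in> fst p" "k \<in> carrier G" "l \<in> carrier G"
  shows "act B (cls p x k, l) = cls p x (k \<otimes> l)"
proof -
  have "(THE v. \<exists>p' x' k'. (p', x', k') \<in> points (prebundle X G) \<and>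
          cls p x k = cls p' x' k' \<and> v = cls p' x' (k' \<otimes> l)) = cls p x (k \<otimes> l)"
  proof (rule the_equality)
    show "\<exists>p' x' k'. (p', x', k') \<in> points (prebundle X G) \<and>
          cls p x k = cls p' x' k' \<and> cls p x (k \<otimes> l) = cls p' x' (k' \<otimes> l)"
      using assms by (intro exI[of _ p] exI[of _ x] exI[of _ k]) (simp add: points_prebundle)
    fix v assume "\<exists>p' x' k'. (p', x', k') \<in> points (prebundle X G) \<and> cls p x k = cls p' x' k' \<and>
      v = cls p' x' (k' \<otimes> l)"
    then obtain p' x' k' where *: "p' \<in> plots X" "x' \<in> fst p'" "k' \<in> carrier G"
      "cls p x k = cls p' x' k'" "v = cls p' x' (k' \<otimes> l)" by (auto simp: points_prebundle)
    have "normal (p, x, k) = normal (p', x', k')" using *(4) unfolding cls_eq_iff[OF assms(1-3) *(1-3)] .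
    then show "v = cls p x (k \<otimes> l)"
      unfolding *(5) using assms * by (simp add: cls_eq_iff normal_mult)
  qed
  then show ?thesis using cls_in[OF assms(1-3)] assms(4) by (simp add: cons_bundle_def)
qed

text \<open>The shape of a plot of the quotient once it has been lifted locally twice, through the
  quotient and then into the coproduct: it stays in the summand of a single plot
  \<open>p\<close>.\<close>

definition rep :: "(pt \<Rightarrow> 'p) \<Rightarrow> pt set \<Rightarrow> bool" where
  "rep u N \<longleftrightarrow> (\<exists>p s k. p \<in> plots X \<and> smooth_map N (fst p) s \<and> plot_on (gspace G) N k \<and>
     (\<forall>v\<in>N. u v = cls p (s v) (k v)))"

lemma rep_subset:
  assumes "rep u N" "N' \<subseteq> N" "cartesian N'"
  shows "rep u N'"
proof -
  obtain p s k where *: "p \<in> plots X" "smooth_map N (fst p) s" "plot_on (gspace G) N k"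
    "\<forall>v\<in>N. u v = cls p (s v) (k v)" using assms(1) unfolding rep_def by blast
  have "smooth_map N' (fst p) (restrict s N')"
    by (rule smooth_map_restrict[OF *(2) assms(2)]) (use smooth_map_in[OF *(2)] assms(2) in auto)
  moreover have "\<forall>v\<in>N'. u v = cls p (restrict s N' v) (k v)" using *(4) assms(2) by auto
  ultimately show ?thesis
    unfolding rep_def using *(1) plot_on_subset[OF gspace *(3) assms(3,2)] by blast
qed

lemma rep_prebundle_plot:
  assumes "rep u N"
  shows "\<exists>q. (N, q) \<in> plots (prebundle X G) \<and> (\<forall>v\<in>N. u v = cons_class \<iota> X G g (q v))"
proof -
  obtain p s k where *: "p \<in> plots X" "smooth_map N (fst p) s" "plot_on (gspace G) N k"
    "\<forall>v\<in>N. u v = cls p (s v) (k v)" using assms(1) unfolding rep_def by blast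
  have N: "cartesian N" by (rule plot_on_cartesian[OF gspace *(3)])
  note s_in = smooth_map_in[OF *(2)] and k_in = plot_on_carrier[OF *(3)]
  have "restrict s N = s" using smooth_mapD[OF *(2)] by (rule PiE_restrict)
  moreover have "compose N fst (\<lambda>v\<in>N. (s v, k v)) = restrict s N"
    "compose N snd (\<lambda>v\<in>N. (s v, k v)) = restrict k N" by (auto simp: compose_def)
  ultimately have w: "(N, \<lambda>v\<in>N. (s v, k v)) \<in> plots (dprod (cart_space (fst p)) (gspace G))"
    using *(2,3) N s_in k_in by (simp add: dprod_def cart_space_def plot_on_def gspace_def)
  have "(\<lambda>v\<in>N. (p, s v, k v)) \<in> N \<rightarrow>\<^sub>E
      Sigma (plots X) (\<lambda>p. points (dprod (cart_space (fst p)) (gspace G)))"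
    using *(1) s_in k_in by (auto simp: dprod_def cart_space_def gspace_def)
  moreover have "\<exists>i\<in>plots X. \<exists>q. (N, q) \<in> plots (dprod (cart_space (fst i)) (gspace G)) \<and>
      (\<forall>x\<in>N. (\<lambda>v\<in>N. (p, s v, k v)) x = (i, q x))"
    using *(1) w by (intro bexI[of _ p] exI[of _ "\<lambda>v\<in>N. (s v, k v)"]) auto
  ultimately have "(N, \<lambda>v\<in>N. (p, s v, k v)) \<in> plots (prebundle X G)"
    using N good_cover_single[OF N] unfolding prebundle_def dcoprod_def
    by (simp, intro exI[of _ "{N}"]) simp
  then show ?thesis using *(4) by (intro exI[of _ "\<lambda>v\<in>N. (p, s v, k v)"]) auto
qed

text \<open>Lifting through the quotient and into a summand takes two successive good covers. With
  neighbourhoods in their place, the nesting is transitivity of relative openness. In the other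
  direction \<open>rep\<close> passes to cartesian subsets, so neighbourhoods can be refined to one
  good cover that serves the quotient, while each member needs only the trivial cover for the
  coproduct.\<close>

lemma plot_on_C_iff:
  "plot_on C U u \<longleftrightarrow> cartesian U \<and> (\<forall>x\<in>U. \<exists>N. openin (top_of_set U) N \<and> x \<in> N \<and> rep u N)"
proof
  assume "plot_on C U u"
  then obtain \<U> where U: "cartesian U" and \<U>: "good_cover U \<U>"
    "\<And>V. V \<in> \<U> \<Longrightarrow> \<exists>q. (V, q) \<in> plots (prebundle X G) \<and>
       (\<forall>x\<in>V. restrict u U x = cons_class \<iota> X G g (q x))"
    unfolding plot_on_def cons_space_def dquot_def by auto
  have "\<exists>N. openin (top_of_set U) N \<and> x \<in> N \<and> rep u N" if x: "x \<in> U" for x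
  proof -
    obtain V where V: "V \<in> \<U>" "x \<in> V" using \<U>(1) x unfolding good_cover_def by blast
    have oV: "openin (top_of_set U) V" using good_cover_openin[OF \<U>(1) V(1)] .
    then have VU: "V \<subseteq> U" by (rule openin_imp_subset)
    obtain q where q: "(V, q) \<in> plots (prebundle X G)"
      "\<And>x. x \<in> V \<Longrightarrow> restrict u U x = cons_class \<iota> X G g (q x)" using \<U>(2)[OF V(1)] by blast
    obtain \<V> where \<V>: "good_cover V \<V>"
      "\<And>N. N \<in> \<V> \<Longrightarrow> \<exists>p\<in>plots X. \<exists>w. (N, w) \<in> plots (dprod (cart_space (fst p)) (gspace G)) \<and>
         (\<forall>x\<in>N. q x = (p, w x))"
      using q(1) unfolding prebundle_def dcoprod_def by auto
    obtain N where N: "N \<in> \<V>" "x \<in> N" using \<V>(1) V(2) unfolding good_cover_def by blast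
    have oN: "openin (top_of_set V) N" using good_cover_openin[OF \<V>(1) N(1)] .
    then have NV: "N \<subseteq> V" by (rule openin_imp_subset)
    obtain p w where p: "p \<in> plots X" "(N, w) \<in> plots (dprod (cart_space (fst p)) (gspace G))"
      "\<And>x. x \<in> N \<Longrightarrow> q x = (p, w x)" using \<V>(2)[OF N(1)] by blast
    have "smooth_map N (fst p) (\<lambda>v\<in>N. fst (w v))" "plot_on (gspace G) N (\<lambda>v. snd (w v))"
      using p(2) by (auto simp: dprod_def cart_space_def plot_on_def compose_def)
    moreover have "u v = cls p ((\<lambda>v\<in>N. fst (w v)) v) (snd (w v))" if "v \<in> N" for v
      using that q(2)[OF subsetD[OF NV that]] p(3)[OF that] NV VU by (simp add: subset_iff)
    ultimately have "rep u N" using p(1) unfolding rep_def by blast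
    then show ?thesis using openin_trans[OF oN oV] N(2) by blast
  qed
  then show "cartesian U \<and> (\<forall>x\<in>U. \<exists>N. openin (top_of_set U) N \<and> x \<in> N \<and> rep u N)" using U by blast
next
  assume *: "cartesian U \<and> (\<forall>x\<in>U. \<exists>N. openin (top_of_set U) N \<and> x \<in> N \<and> rep u N)"
  have "\<exists>\<U>. good_cover U \<U> \<and> (\<forall>V\<in>\<U>. rep u V)"
    by (rule good_refinement[where Q = "rep u"]) (use * rep_subset in auto)
  then obtain \<U> where \<U>: "good_cover U \<U>" "\<And>V. V \<in> \<U> \<Longrightarrow> rep u V" by blast
  have "\<exists>q. (V, q) \<in> plots (prebundle X G) \<and> (\<forall>x\<in>V. restrict u U x = cons_class \<iota> X G g (q x))"
    if V: "V \<in> \<U>" for V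
  proof -
    have "V \<subseteq> U" using good_cover_openin[OF \<U>(1) V] by (rule openin_imp_subset)
    then have "restrict u U x = u x" if "x \<in> V" for x using that by auto
    then show ?thesis using rep_prebundle_plot[OF \<U>(2)[OF V]] by (metis (no_types, lifting))
  qed
  moreover have "restrict u U \<in> U \<rightarrow>\<^sub>E points C"
  proof -
    have "u x \<in> points C" if x: "x \<in> U" for x
    proof -
      obtain N where "x \<in> N" "rep u N" using * x by blast
      then obtain p s k where "p \<in> plots X" "smooth_map N (fst p) s" "plot_on (gspace G) N k"
        "u x = cls p (s x) (k x)" unfolding rep_def by blast
      then show ?thesis using \<open>x \<in> N\<close> by (simp add: cls_in smooth_map_in plot_on_carrier)
    qed
    then show ?thesis by auto
  qed
  ultimately show "plot_on C U u"
    using * \<U>(1) unfolding plot_on_def cons_space_def dquot_def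
    by (simp del: restrict_apply PiE_restrict restrict_PiE_iff) blast
qed

end

section \<open>Diffeology, projection and action of the quotient\<close>

context cons_loc
begin

lemma rep_cls:
  assumes "p \<in> plots X" "smooth_map N (fst p) s" "plot_on (gspace G) N k"
  shows "rep (\<lambda>v. cls p (s v) (k v)) N"
  using assms unfolding rep_def by blast

lemma plot_on_cls:
  assumes "p \<in> plots X" "smooth_map N (fst p) s" "plot_on (gspace G) N k"
  shows "plot_on C N (\<lambda>v. cls p (s v) (k v))"
  unfolding plot_on_C_iff
  using rep_cls[OF assms] plot_on_cartesian[OF gspace assms(3)] openin_subtopology_self by auto

lemma plot_on_cls_id:
  assumes "p \<in> plots X" "plot_on (gspace G) (fst p) k"
  shows "plot_on C (fst p) (\<lambda>v. cls p v (k v))"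
proof -
  obtain n where "fst p \<subseteq> Rn n" using cartesian_Rn[OF plot_cartesian[OF assms(1)]] by blast
  then have "smooth_map (fst p) (fst p) (\<lambda>x\<in>fst p. x)" by (rule smooth_map_id) simp
  from plot_on_cls[OF assms(1) this assms(2)] show ?thesis by (rule plot_on_eq) simp
qed

lemma diffeological_space_C: "diffeological_space C"
  unfolding diffeological_space_def
proof (intro conjI allI impI ballI)
  have ext: "p \<in> U \<rightarrow>\<^sub>E points C" "plot_on C U p" if "(U, p) \<in> plots C" for U p
  proof -
    show "p \<in> U \<rightarrow>\<^sub>E points C" using that by (auto simp: cons_space_def dquot_def)
    then have "restrict p U = p" by (rule PiE_restrict)
    then show "plot_on C U p" using that by (simp add: plot_on_def)
  qed
  have plotI: "(U, p) \<in> plots C" if "p \<in> U \<rightarrow>\<^sub>E points C" "plot_on C U p" for U p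
    using PiE_restrict[OF that(1)] that(2) by (simp add: plot_on_def)
  show "case z of (U, p) \<Rightarrow> cartesian U \<and> p \<in> U \<rightarrow>\<^sub>E points C" if "z \<in> plots C" for z
    using ext[of "fst z" "snd z"] that plot_on_C_iff by (cases z) auto
  show "(Rn 0, p) \<in> plots C" if p: "p \<in> Rn 0 \<rightarrow>\<^sub>E points C" for p
  proof (rule plotI[OF p])
    have "p origin \<in> points C" using p origin_in by blast
    then obtain q x k where q: "q \<in> plots X" "x \<in> fst q" "k \<in> carrier G" "p origin = cls q x k"
      using points_C by blast
    have "plot_on C (Rn 0) (\<lambda>v. cls q ((\<lambda>_\<in>Rn 0. x) v) k)"
      using q by (intro plot_on_cls smooth_map_const[of _ 0] plot_on_const[OF gspace] cartesian_Rn_self) auto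
    then show "plot_on C (Rn 0) p"
    proof (rule plot_on_eq)
      fix v assume "v \<in> Rn 0"
      moreover from this have "v = origin" by (simp add: Rn_iff fun_eq_iff)
      ultimately show "cls q ((\<lambda>_\<in>Rn 0. x) v) k = p v" using q(4) by simp
    qed
  qed
  show "(V, compose V p f) \<in> plots C"
    if *: "(U, p) \<in> plots C \<and> cartesian V \<and> smooth_map V U f" for U p V f
  proof -
    have f: "smooth_map V U f" and V: "cartesian V" and p: "(U, p) \<in> plots C" using * by auto
    have "plot_on C V (\<lambda>v. p (f v))"
      unfolding plot_on_C_iff
    proof (intro conjI ballI V)
      fix x assume x: "x \<in> V"
      obtain N where N: "openin (top_of_set U) N" "f x \<in> N" "rep p N"
        using ext(2)[OF p] smooth_map_in[OF f x] unfolding plot_on_C_iff by blast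
      have "openin (top_of_set V) (V \<inter> f -` N)"
        using continuous_openin_preimage[OF smooth_map_continuous[OF f] _ N(1)] smooth_map_in[OF f] by auto
      \<comment> \<open>The preimage of \<open>N\<close> is open but may fail to be cartesian,
        whereas \<open>rep\<close> requires a plot of \<open>G\<close> on the set.\<close>
      then obtain M where M: "openin (top_of_set V) M" "x \<in> M" "M \<subseteq> V \<inter> f -` N" "cartesian M"
        using cartesian_nbhd[OF V, of "V \<inter> f -` N" x] x N(2) by auto
      obtain q s k where q: "q \<in> plots X" "smooth_map N (fst q) s" "plot_on (gspace G) N k"
        "\<And>v. v \<in> N \<Longrightarrow> p v = cls q (s v) (k v)" using N(3) unfolding rep_def by blast
      have fM: "smooth_map M N (restrict f M)"
        by (rule smooth_map_restrict[OF f]) (use M(3) in auto)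
      have "rep (\<lambda>v. p (f v)) M"
        unfolding rep_def
      proof (intro exI conjI ballI)
        show "smooth_map M (fst q) (compose M s (restrict f M))"
          by (rule smooth_map_compose[OF fM q(2)])
        show "plot_on (gspace G) M (\<lambda>v. k (restrict f M v))"
          by (rule plot_on_compose[OF gspace q(3) M(4) fM])
        show "p (f v) = cls q (compose M s (restrict f M) v) (k (restrict f M v))" if "v \<in> M" for v
          using that M(3) q(4)[of "f v"] by (auto simp: compose_eq)
      qed (rule q(1))
      then show "\<exists>N. openin (top_of_set V) N \<and> x \<in> N \<and> rep (\<lambda>v. p (f v)) N" using M(1,2) by blast
    qed
    then show ?thesis by (simp add: plot_on_def restrict_compose)
  qed
  show "(U, p) \<in> plots C"
    if *: "cartesian U \<and> p \<in> U \<rightarrow>\<^sub>E points C \<and> good_cover U \<U> \<and> (\<forall>V\<in>\<U>. (V, restrict p V) \<in> plots C)"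
    for U p \<U>
  proof (rule plotI)
    show "plot_on C U p"
      unfolding plot_on_C_iff
    proof (intro conjI ballI)
      fix x assume "x \<in> U"
      then obtain V where V: "V \<in> \<U>" "x \<in> V" using * unfolding good_cover_def by blast
      have oV: "openin (top_of_set U) V" using * good_cover_openin V(1) by blast
      have "plot_on C V p" using * V(1) by (simp add: plot_on_def)
      then obtain N where "openin (top_of_set V) N" "x \<in> N" "rep p N"
        using V(2) unfolding plot_on_C_iff by blast
      then show "\<exists>N. openin (top_of_set U) N \<and> x \<in> N \<and> rep p N" using openin_trans oV by blast
    qed (use * in blast)
  qed (use * in blast)
qed

text \<open>Smoothness out of the quotient is tested on representatives, since a plot of
  \<open>C\<close> is locally \<open>cls p (s v) (k v)\<close>. Well-definedness is already
  contained in \<open>F_cls\<close>, as \<open>F\<close> is a function on classes.\<close>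

lemma dsmooth_CI:
  assumes Y: "diffeological_space Y" and F: "F \<in> extensional (points C)"
    and F_cls: "\<And>p x k. p \<in> plots X \<Longrightarrow> x \<in> fst p \<Longrightarrow> k \<in> carrier G \<Longrightarrow> F (cls p x k) = \<Phi> p x k"
    and \<Phi>: "\<And>p N s k. p \<in> plots X \<Longrightarrow> smooth_map N (fst p) s \<Longrightarrow> plot_on (gspace G) N k \<Longrightarrow>
      plot_on Y N (\<lambda>v. \<Phi> p (s v) (k v))"
  shows "dsmooth C Y F"
proof (rule dsmoothI[OF diffeological_space_C])
  have "F u \<in> points Y" if u: "u \<in> points C" for u
  proof -
    obtain p x k where u: "p \<in> plots X" "x \<in> fst p" "k \<in> carrier G" "u = cls p x k"
      using u unfolding points_C by blast
    \<comment> \<open>That values lie in \<open>Y\<close> also comes from \<open>\<Phi>\<close>,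
      applied to constant data on the one-point space.\<close>
    have "plot_on Y (Rn 0) (\<lambda>v. \<Phi> p ((\<lambda>_\<in>Rn 0. x) v) k)"
      using u by (intro \<Phi> smooth_map_const[of _ 0] plot_on_const[OF gspace] cartesian_Rn_self) auto
    from plot_on_in[OF Y this origin_in] show ?thesis
      unfolding u(4) F_cls[OF u(1-3)] by (simp add: origin_in)
  qed
  then show "F \<in> points C \<rightarrow>\<^sub>E points Y" using F by (simp add: PiE_iff)
  fix U u assume u: "plot_on C U u"
  show "plot_on Y U (\<lambda>x. F (u x))"
  proof (rule plot_on_local[OF Y])
    show "cartesian U" using u plot_on_C_iff by blast
    fix x assume "x \<in> U"
    then obtain N where N: "openin (top_of_set U) N" "x \<in> N" "rep u N" using u plot_on_C_iff by blast
    then obtain p s k where p: "p \<in> plots X" "smooth_map N (fst p) s" "plot_on (gspace G) N k"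
      "\<And>v. v \<in> N \<Longrightarrow> u v = cls p (s v) (k v)" unfolding rep_def by blast
    have "plot_on Y N (\<lambda>v. F (u v))"
    proof (rule plot_on_eq[OF \<Phi>[OF p(1-3)]])
      fix v assume v: "v \<in> N"
      show "\<Phi> p (s v) (k v) = F (u v)"
        unfolding p(4)[OF v] by (rule F_cls[OF p(1) smooth_map_in[OF p(2) v] plot_on_carrier[OF p(3) v], symmetric])
    qed
    then show "\<exists>N. openin (top_of_set U) N \<and> x \<in> N \<and> plot_on Y N (\<lambda>x. F (u x))" using N by blast
  qed
qed

lemma dsmooth_bproj: "dsmooth C X (bproj B)"
proof (rule dsmooth_CI[OF base, where \<Phi> = "\<lambda>p x k. snd p x"])
  show "bproj B \<in> extensional (points C)" by (simp add: cons_bundle_def)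
  fix p N s and k :: "pt \<Rightarrow> 'g"
  assume p: "p \<in> plots X" "smooth_map N (fst p) s" "plot_on (gspace G) N k"
  then show "plot_on X N (\<lambda>v. snd p (s v))"
    using plot_on_compose[OF base plots_plot_on(1)[OF base, of "fst p" "snd p"] _ p(2)]
      plot_on_cartesian[OF gspace p(3)] by simp
qed (rule bproj_cls)

text \<open>The map \<open>s\<close> is itself a map of plots from the projection of
  \<open>u\<close> to \<open>p\<close>, so \<open>cls_step\<close> moves \<open>u\<close> into the
  summand of its own projection at the cost of the smooth factor \<open>g (r, p, s)\<close>. Two
  local plots with the same projection can then be compared inside one summand.\<close>

lemma rep_canonical:
  assumes "rep u N"
  obtains k where "plot_on (gspace G) N k" "(N, \<lambda>v\<in>N. bproj B (u v)) \<in> plots X"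
    "\<And>v. v \<in> N \<Longrightarrow> u v = cls (N, \<lambda>v\<in>N. bproj B (u v)) v (k v)"
proof -
  obtain p s k where p: "p \<in> plots X" "smooth_map N (fst p) s" "plot_on (gspace G) N k"
    "\<And>v. v \<in> N \<Longrightarrow> u v = cls p (s v) (k v)" using assms unfolding rep_def by blast
  note s_in = smooth_map_in[OF p(2)] and k_in = plot_on_carrier[OF p(3)]
  define r where "r = (N, \<lambda>v\<in>N. bproj B (u v))"
  have "plot_on C N u"
    by (rule plot_on_eq[OF plot_on_cls[OF p(1-3)]]) (simp add: p(4))
  from dsmooth_plot_on[OF dsmooth_bproj this] have r: "r \<in> plots X" by (simp add: r_def plot_on_def)
  have m: "(r, p, s) \<in> plot_maps X"
    using r p(1,2) unfolding plot_maps_def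
    by (simp add: r_def p(4) bproj_cls s_in k_in)
  have c: "plot_on (gspace G) N (g (r, p, s))" using cocycleD(1)[OF cocycle m] by (simp add: r_def)
  have "u v = cls r v (inv\<^bsub>G\<^esub> (g (r, p, s) v) \<otimes> k v)" if "v \<in> N" for v
    using cls_step[OF m, of v "inv\<^bsub>G\<^esub> (g (r, p, s) v) \<otimes> k v"] that k_in[OF that] plot_on_carrier[OF c that]
      p(4)[OF that] by (simp add: r_def m_assoc[symmetric])
  then show ?thesis
    using that[OF plot_on_mult[OF plot_on_inv[OF c] p(3)]] r by (simp add: r_def)
qed

text \<open>The invariant \<open>normal\<close> carried over to classes. It identifies each fibre
  with \<open>G\<close>, but nothing makes this identification vary smoothly with the base
  point.\<close>

definition coord :: "'p \<Rightarrow> 'x \<times> 'g" where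
  "coord u = normal (SOME z. z \<in> points (prebundle X G) \<and> u = cons_class \<iota> X G g z)"

lemma coord_cls:
  assumes "p \<in> plots X" "x \<in> fst p" "k \<in> carrier G"
  shows "coord (cls p x k) = normal (p, x, k)"
proof -
  have z: "(p, x, k) \<in> points (prebundle X G) \<and> cls p x k = cons_class \<iota> X G g (p, x, k)"
    using assms by (simp add: points_prebundle)
  note s = someI[of "\<lambda>z. z \<in> points (prebundle X G) \<and> cls p x k = cons_class \<iota> X G g z", OF z]
  show ?thesis
    unfolding coord_def
    by (rule cons_class_eq_iff[OF conjunct1[OF z] conjunct1[OF s], THEN iffD1, symmetric, OF conjunct2[OF s]])
qed

lemma coord_in: "u \<in> points C \<Longrightarrow> snd (coord u) \<in> carrier G"
  unfolding points_C by (auto simp: coord_cls normal_def g_point_in)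

lemma fst_coord: "u \<in> points C \<Longrightarrow> fst (coord u) = bproj B u"
  unfolding points_C by (auto simp: coord_cls bproj_cls normal_def)

lemma coord_inj: "u \<in> points C \<Longrightarrow> w \<in> points C \<Longrightarrow> coord u = coord w \<Longrightarrow> u = w"
  unfolding points_C by (auto simp: coord_cls cls_eq_iff)

lemma act_C: "u \<in> points C \<Longrightarrow> l \<in> carrier G \<Longrightarrow> act B (u, l) \<in> points C"
  unfolding points_C using act_cls m_closed by metis

lemma coord_act:
  "u \<in> points C \<Longrightarrow> l \<in> carrier G \<Longrightarrow> coord (act B (u, l)) = (fst (coord u), snd (coord u) \<otimes> l)"
  unfolding points_C by (auto simp: coord_cls act_cls normal_mult)

text \<open>Each coordinate involves transport to a one-point plot that changes with the point, so
  it need not be smooth. In the quotient of two coordinates over the same base point the transport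
  factor cancels. By \<open>rep_canonical\<close> both plots can be written over one plot
  \<open>r\<close>, and the quotient becomes that of their smooth group components.\<close>

lemma plot_on_coord_div:
  assumes u: "plot_on C U u" and w: "plot_on C U w" and uw: "\<And>x. x \<in> U \<Longrightarrow> bproj B (u x) = bproj B (w x)"
  shows "plot_on (gspace G) U (\<lambda>x. inv\<^bsub>G\<^esub> (snd (coord (u x))) \<otimes> snd (coord (w x)))"
proof (rule plot_on_local[OF gspace])
  show U: "cartesian U" using u plot_on_C_iff by blast
  fix x assume x: "x \<in> U"
  obtain N1 where N1: "openin (top_of_set U) N1" "x \<in> N1" "rep u N1"
    using u x unfolding plot_on_C_iff by blast
  obtain N2 where N2: "openin (top_of_set U) N2" "x \<in> N2" "rep w N2"
    using w x unfolding plot_on_C_iff by blast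
  obtain N where N: "openin (top_of_set U) N" "x \<in> N" "N \<subseteq> N1 \<inter> N2" "cartesian N"
    using cartesian_nbhd[OF U, of "N1 \<inter> N2" x] N1 N2 by (metis IntI openin_Int)
  have NU: "N \<subseteq> U" using N(1) by (rule openin_imp_subset)
  define r where "r = (N, \<lambda>v\<in>N. bproj B (u v))"
  have r': "(N, \<lambda>v\<in>N. bproj B (w v)) = r"
    using uw NU by (auto simp: r_def intro!: restrict_ext)
  obtain k where k: "plot_on (gspace G) N k" "r \<in> plots X" "\<And>v. v \<in> N \<Longrightarrow> u v = cls r v (k v)"
    by (rule rep_canonical[OF rep_subset[OF N1(3) _ N(4)]]) (use N(3) in \<open>auto simp: r_def\<close>)
  obtain l where l: "plot_on (gspace G) N l" "\<And>v. v \<in> N \<Longrightarrow> w v = cls r v (l v)"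
    by (rule rep_canonical[OF rep_subset[OF N2(3) _ N(4)]], unfold r') (use N(3) in auto)
  have "plot_on (gspace G) N (\<lambda>v. inv\<^bsub>G\<^esub> (k v) \<otimes> l v)"
    by (rule plot_on_mult[OF plot_on_inv[OF k(1)] l(1)])
  then have "plot_on (gspace G) N (\<lambda>v. inv\<^bsub>G\<^esub> (snd (coord (u v))) \<otimes> snd (coord (w v)))"
  proof (rule plot_on_eq)
    fix v assume v: "v \<in> N"
    then have v': "v \<in> fst r" by (simp add: r_def)
    note c = plot_on_carrier[OF k(1) v] plot_on_carrier[OF l(1) v] g_point_in[OF k(2) v']
    have "inv\<^bsub>G\<^esub> (inv\<^bsub>G\<^esub> a \<otimes> b) \<otimes> (inv\<^bsub>G\<^esub> a \<otimes> d) = inv\<^bsub>G\<^esub> b \<otimes> d"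
      if "a \<in> carrier G" "b \<in> carrier G" "d \<in> carrier G" for a b d
    proof -
      have "inv\<^bsub>G\<^esub> (inv\<^bsub>G\<^esub> a \<otimes> b) \<otimes> (inv\<^bsub>G\<^esub> a \<otimes> d) = inv\<^bsub>G\<^esub> b \<otimes> (a \<otimes> (inv\<^bsub>G\<^esub> a \<otimes> d))"
        using that by (simp add: inv_mult_group m_assoc)
      then show ?thesis using that by (simp add: m_assoc[symmetric])
    qed
    then show "inv\<^bsub>G\<^esub> (k v) \<otimes> l v = inv\<^bsub>G\<^esub> (snd (coord (u v))) \<otimes> snd (coord (w v))"
      using c v' k(2) by (simp add: k(3)[OF v] l(2)[OF v] coord_cls normal_def)
  qed
  then show "\<exists>N. openin (top_of_set U) N \<and> x \<in> N \<and>
      plot_on (gspace G) N (\<lambda>x. inv\<^bsub>G\<^esub> (snd (coord (u x))) \<otimes> snd (coord (w x)))"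
    using N(1,2) by blast
qed

lemma dsmooth_act: "dsmooth (dprod C (gspace G)) C (act B)"
proof (rule dsmoothI[OF diffeological_space_dprod[OF diffeological_space_C gspace]])
  show "act B \<in> points (dprod C (gspace G)) \<rightarrow>\<^sub>E points C"
  proof (rule PiE_I)
    show "act B z \<in> points C" if "z \<in> points (dprod C (gspace G))" for z
      using that act_C by (auto simp: dprod_def)
    show "act B z = undefined" if "z \<notin> points (dprod C (gspace G))" for z
      using that by (cases z) (auto simp: cons_bundle_def dprod_def restrict_def)
  qed
  fix U w assume "plot_on (dprod C (gspace G)) U w"
  then have u: "plot_on C U (\<lambda>x. fst (w x))" and l: "plot_on (gspace G) U (\<lambda>x. snd (w x))"
    by (simp_all add: plot_on_dprod diffeological_space_C gspace)
  show "plot_on C U (\<lambda>x. act B (w x))"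
  proof (rule plot_on_local[OF diffeological_space_C])
    show "cartesian U" using plot_on_cartesian[OF gspace l] .
    fix x assume "x \<in> U"
    then obtain N where N: "openin (top_of_set U) N" "x \<in> N" "rep (\<lambda>x. fst (w x)) N"
      using u unfolding plot_on_C_iff by blast
    then obtain p s k where p: "p \<in> plots X" "smooth_map N (fst p) s" "plot_on (gspace G) N k"
      "\<And>v. v \<in> N \<Longrightarrow> fst (w v) = cls p (s v) (k v)" unfolding rep_def by blast
    have l': "plot_on (gspace G) N (\<lambda>x. snd (w x))"
      by (rule plot_on_subset[OF gspace l plot_on_cartesian[OF gspace p(3)] openin_imp_subset[OF N(1)]])
    have "plot_on C N (\<lambda>v. cls p (s v) (k v \<otimes> snd (w v)))"
      by (rule plot_on_cls[OF p(1,2) plot_on_mult[OF p(3) l']])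
    then have "plot_on C N (\<lambda>v. act B (w v))"
    proof (rule plot_on_eq)
      fix v assume v: "v \<in> N"
      have "act B (fst (w v), snd (w v)) = cls p (s v) (k v \<otimes> snd (w v))"
        unfolding p(4)[OF v]
        by (rule act_cls[OF p(1) smooth_map_in[OF p(2) v] plot_on_carrier[OF p(3) v] plot_on_carrier[OF l' v]])
      then show "cls p (s v) (k v \<otimes> snd (w v)) = act B (w v)" by simp
    qed
    then show "\<exists>N. openin (top_of_set U) N \<and> x \<in> N \<and> plot_on C N (\<lambda>x. act B (w x))" using N by blast
  qed
qed

text \<open>A plot lifts on its whole domain, to \<open>v \<mapsto> [v, 1]\<close> in its own
  summand. Surjectivity comes from the one-point plots.\<close>

lemma subduction_B: "subduction C X (bproj B)"
proof (rule subductionI[OF base diffeological_space_C dsmooth_bproj])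
  show "points X \<subseteq> bproj B ` points C"
  proof
    fix y assume "y \<in> points X"
    then have "point_plot y \<in> plots X" by (rule point_plot_in)
    moreover have "origin \<in> fst (point_plot y)" "snd (point_plot y) origin = y"
      by (simp_all add: point_plot_def origin_in)
    ultimately show "y \<in> bproj B ` points C"
      using bproj_cls cls_in one_closed by (metis image_eqI)
  qed
  fix U p x assume p: "plot_on X U p" and "x \<in> U"
  have m: "(U, restrict p U) \<in> plots X" using p by (simp add: plot_on_def)
  have U: "cartesian U" by (rule plot_on_cartesian[OF base p])
  have "plot_on C U (\<lambda>v. cls (U, restrict p U) v \<one>)"
    using plot_on_cls_id[OF m, of "\<lambda>_. \<one>"] plot_on_one[OF U] by simp
  then show "\<exists>N q. openin (top_of_set U) N \<and> x \<in> N \<and> plot_on C N q \<and> (\<forall>y\<in>N. bproj B (q y) = p y)"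
    using \<open>x \<in> U\<close> m
    by (intro exI[of _ U] exI[of _ "\<lambda>v. cls (U, restrict p U) v \<one>"]) (simp add: bproj_cls)
qed

lemma coord_div:
  assumes "u \<in> points C" "w \<in> points C" "bproj B u = bproj B w"
  shows "act B (u, inv\<^bsub>G\<^esub> (snd (coord u)) \<otimes> snd (coord w)) = w"
  using assms coord_in[OF assms(1)] coord_in[OF assms(2)]
  by (intro coord_inj) (auto simp: act_C coord_act fst_coord m_assoc[symmetric] prod_eq_iff)

lemma principal_bundle_B: "principal_bundle X G B"
  unfolding principal_bundle_def total_B
proof (intro conjI ballI diffeological_space_C subduction_B dsmooth_act)
  show "act B (u, \<one>) = u" if "u \<in> points C" for u
    using that unfolding points_C by (auto simp: act_cls)
  show "act B (act B (u, k), l) = act B (u, k \<otimes> l)"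
    if "u \<in> points C" "k \<in> carrier G" "l \<in> carrier G" for u k l
    using that unfolding points_C by (auto simp: act_cls m_assoc)
  let ?F = "dfibprod C C (bproj B) (bproj B)" and ?D = "dprod C (gspace G)"
  let ?f = "\<lambda>z\<in>points C \<times> carrier G. (fst z, act B z)"
  \<comment> \<open>The inverse of the shear map, with division expressed through coordinates; it is
    smooth by \<open>plot_on_coord_div\<close>.\<close>
  define h where "h = (\<lambda>z\<in>points ?F. (fst z, inv\<^bsub>G\<^esub> (snd (coord (fst z))) \<otimes> snd (coord (snd z))))"
  have plot_F: "plot_on ?F U w \<longleftrightarrow> plot_on (dprod C C) U w \<and> (\<forall>x\<in>U. bproj B (fst (w x)) = bproj B (snd (w x)))"
    for U w by (auto simp: plot_on_def dfibprod_def)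
  have proj_act: "bproj B (act B (u, l)) = bproj B u" if "u \<in> points C" "l \<in> carrier G" for u l
    using that fst_coord act_C coord_act by (metis fst_conv)
  have F: "points ?F = {(u, w). u \<in> points C \<and> w \<in> points C \<and> bproj B u = bproj B w}"
    by (auto simp: dfibprod_def)
  have D: "points ?D = points C \<times> carrier G" by (simp add: dprod_def)
  note dC = diffeological_space_C
  have "dsmooth ?D ?F ?f"
  proof (rule dsmoothI[OF diffeological_space_dprod[OF dC gspace]])
    show "?f \<in> points ?D \<rightarrow>\<^sub>E points ?F"
      unfolding F D by (auto simp: act_C proj_act)
    fix U w assume w: "plot_on ?D U w"
    then have w': "plot_on C U (\<lambda>x. fst (w x))" "plot_on (gspace G) U (\<lambda>x. snd (w x))"
      by (simp_all add: plot_on_dprod dC gspace)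
    have in_w: "w x \<in> points C \<times> carrier G" if "x \<in> U" for x
      using plot_on_in[OF dC w'(1) that] plot_on_carrier[OF w'(2) that] by (simp add: mem_Times_iff)
    have "plot_on ?F U (\<lambda>x. (fst (w x), act B (w x)))"
      unfolding plot_F
    proof (intro conjI ballI)
      show "plot_on (dprod C C) U (\<lambda>x. (fst (w x), act B (w x)))"
        by (simp add: plot_on_dprod dC w'(1) dsmooth_plot_on[OF dsmooth_act w])
      show "bproj B (fst (fst (w x), act B (w x))) = bproj B (snd (fst (w x), act B (w x)))" if "x \<in> U" for x
        using in_w[OF that] proj_act[of "fst (w x)" "snd (w x)"] by (auto simp: mem_Times_iff)
    qed
    then show "plot_on ?F U (\<lambda>x. ?f (w x))"
      by (rule plot_on_eq) (use in_w in simp)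
  qed
  \<comment> \<open>\<open>dsmoothI\<close> would ask for the axioms of a diffeology on the fibre
    product; the plots are unpacked directly instead.\<close>
  moreover have "dsmooth ?F ?D h"
    unfolding dsmooth_def
  proof (intro conjI ballI)
    show "h \<in> points ?F \<rightarrow>\<^sub>E points ?D"
      unfolding F D h_def by (auto simp: coord_in)
    fix z assume z: "z \<in> plots ?F"
    obtain U w where [simp]: "z = (U, w)" by force
    have ext: "w \<in> U \<rightarrow>\<^sub>E points C \<times> points C"
      using z by (simp add: dfibprod_def dprod_def)
    then have "restrict w U = w" by (rule PiE_restrict)
    then have "plot_on ?F U w" using z by (simp add: plot_on_def)
    then have w: "plot_on C U (\<lambda>x. fst (w x))" "plot_on C U (\<lambda>x. snd (w x))"
      "\<And>x. x \<in> U \<Longrightarrow> bproj B (fst (w x)) = bproj B (snd (w x))"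
      by (simp_all add: plot_F plot_on_dprod dC)
    have "plot_on ?D U (\<lambda>x. (fst (w x), inv\<^bsub>G\<^esub> (snd (coord (fst (w x)))) \<otimes> snd (coord (snd (w x)))))"
      using plot_on_coord_div[OF w] w(1) by (simp add: plot_on_dprod dC gspace)
    then have "plot_on ?D U (\<lambda>x. h (w x))"
    proof (rule plot_on_eq)
      fix x assume x: "x \<in> U"
      have "w x \<in> points ?F" using plot_on_in[OF dC w(1) x] plot_on_in[OF dC w(2) x] w(3)[OF x]
        by (simp add: F case_prod_beta)
      then show "(fst (w x), inv\<^bsub>G\<^esub> (snd (coord (fst (w x)))) \<otimes> snd (coord (snd (w x)))) = h (w x)"
        by (simp add: h_def)
    qed
    then show "case z of (U, p) \<Rightarrow> (U, compose U h p) \<in> plots ?D"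
      by (simp add: plot_on_def restrict_compose)
  qed
  moreover have "h (?f z) = z" if zD: "z \<in> points ?D" for z
  proof -
    obtain u l where z: "z = (u, l)" "u \<in> points C" "l \<in> carrier G" using zD D by auto
    have "(u, act B (u, l)) \<in> points ?F" using z by (simp add: F act_C proj_act)
    then show ?thesis using z coord_in[OF z(2)] by (simp add: h_def coord_act m_assoc[symmetric])
  qed
  moreover have "?f (h z) = z" if zF: "z \<in> points ?F" for z
  proof -
    obtain u w where z: "z = (u, w)" "u \<in> points C" "w \<in> points C" "bproj B u = bproj B w"
      using zF F by auto
    show ?thesis using zF z coord_in[OF z(2)] coord_in[OF z(3)] coord_div[OF z(2-4)] by (simp add: h_def)
  qed
  ultimately show "diffeomorphism ?D ?F ?f" unfolding diffeomorphism_def by blast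
qed

end

section \<open>The functor is fully faithful\<close>

locale cons_map_loc = C: cons_loc G X \<iota> g + C': cons_loc G X \<iota> g'
  for G :: "'g dgroup" (structure) and X :: "'x dspace" and \<iota> :: "('x, 'g) prebundle_pt set \<Rightarrow> 'p" and g g'
begin

text \<open>In terms of the invariants, \<open>h\<close> acts by left multiplication with its value
  at the one-point plot, because it is compatible with the one-point map at \<open>x\<close>. That
  value depends only on the base point, so equivalent representatives have equivalent images and the
  description by \<open>THE\<close> is legitimate.\<close>

lemma cons_map_cls:
  assumes h: "cocycle_map X G g g' h" and p: "p \<in> plots X" "x \<in> fst p" and k: "k \<in> carrier G"
  shows "cons_map \<iota> X G g g' h (C.cls p x k) = C'.cls p x (h p x \<otimes> k)"
proof -
  have normal: "C'.normal (p, x, h p x \<otimes> k) =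
      (snd p x, h (point_plot (snd p x)) origin \<otimes> snd (C.normal (p, x, k)))"
    if p: "p \<in> plots X" "x \<in> fst p" and k: "k \<in> carrier G" for p x k
  proof -
    let ?a = "g (point_map p x) origin" and ?a' = "g' (point_map p x) origin"
    let ?b = "h (point_plot (snd p x)) origin"
    have o: "origin \<in> fst (point_plot (snd p x))" by (simp add: point_plot_def origin_in)
    note pp = C.point_plot_in[OF C.plot_in[OF p]]
    note c = C.g_point_in[OF p] C'.g_point_in[OF p] C.cocycle_mapD(4)[OF h p] C.cocycle_mapD(4)[OF h pp o] k
    have e: "?a' \<otimes> ?b = h p x \<otimes> ?a"
      using C.cocycle_mapD(5)[OF h C.point_map_in[OF p, unfolded point_map_def] o]
      by (simp add: point_map_def origin_in)
    have "inv\<^bsub>G\<^esub> ?a' \<otimes> (h p x \<otimes> k) =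
        inv\<^bsub>G\<^esub> ?a' \<otimes> ((h p x \<otimes> ?a) \<otimes> (inv\<^bsub>G\<^esub> ?a \<otimes> k))"
    proof -
      have "?a \<otimes> (inv\<^bsub>G\<^esub> ?a \<otimes> k) = k" using c by (simp add: C.m_assoc[symmetric])
      then show ?thesis using c by (simp add: C.m_assoc)
    qed
    also have "\<dots> = ?b \<otimes> (inv\<^bsub>G\<^esub> ?a \<otimes> k)"
      unfolding e[symmetric] using c by (simp add: C.m_assoc[symmetric])
    finally show ?thesis by (simp add: C.normal_def C'.normal_def)
  qed
  have "(THE v. \<exists>p' x' k'. (p', x', k') \<in> points (prebundle X G) \<and>
          C.cls p x k = C.cls p' x' k' \<and> v = C'.cls p' x' (h p' x' \<otimes> k')) = C'.cls p x (h p x \<otimes> k)"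
  proof (rule the_equality)
    show "\<exists>p' x' k'. (p', x', k') \<in> points (prebundle X G) \<and>
          C.cls p x k = C.cls p' x' k' \<and> C'.cls p x (h p x \<otimes> k) = C'.cls p' x' (h p' x' \<otimes> k')"
      using p k by (intro exI[of _ p] exI[of _ x] exI[of _ k]) (simp add: points_prebundle)
    fix v assume "\<exists>p' x' k'. (p', x', k') \<in> points (prebundle X G) \<and> C.cls p x k = C.cls p' x' k' \<and>
      v = C'.cls p' x' (h p' x' \<otimes> k')"
    then obtain p' x' k' where *: "p' \<in> plots X" "x' \<in> fst p'" "k' \<in> carrier G"
      "C.cls p x k = C.cls p' x' k'" "v = C'.cls p' x' (h p' x' \<otimes> k')" by (auto simp: points_prebundle)
    have n: "C.normal (p, x, k) = C.normal (p', x', k')"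
      using *(4) unfolding C.cls_eq_iff[OF p k *(1-3)] .
    then have "snd p x = snd p' x'" by (simp add: C.normal_def)
    then show "v = C'.cls p x (h p x \<otimes> k)"
      unfolding *(5) using p k * n C.cocycle_mapD(4)[OF h] by (simp add: C'.cls_eq_iff normal)
  qed
  then show ?thesis using C.cls_in[OF p k] by (simp add: cons_map_def)
qed

lemma bundle_map_cons_map:
  assumes h: "cocycle_map X G g g' h"
  shows "bundle_map G C.B C'.B (cons_map \<iota> X G g g' h)"
  unfolding bundle_map_def C.total_B C'.total_B
proof (intro conjI ballI)
  let ?h = "cons_map \<iota> X G g g' h"
  note h_in = C.cocycle_mapD(4)[OF h]
  show "dsmooth C.C C'.C ?h"
  proof (rule C.dsmooth_CI[OF C'.diffeological_space_C,
        where \<Phi> = "\<lambda>p x k. C'.cls p x (h p x \<otimes> k)"])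
    show "?h \<in> extensional (points C.C)" by (simp add: cons_map_def)
    fix p N s k
    assume p: "p \<in> plots X" "smooth_map N (fst p) s" "plot_on (gspace G) N k"
    have "plot_on (gspace G) N (\<lambda>v. h p (s v))"
      by (rule plot_on_compose[OF C.gspace C.cocycle_mapD(2)[OF h p(1)] plot_on_cartesian[OF C.gspace p(3)] p(2)])
    then show "plot_on C'.C N (\<lambda>v. C'.cls p (s v) (h p (s v) \<otimes> k v))"
      by (rule C'.plot_on_cls[OF p(1,2) C.plot_on_mult[OF _ p(3)]])
  qed (rule cons_map_cls[OF h])
  fix u assume u: "u \<in> points C.C"
  then show "bproj C'.B (?h u) = bproj C.B u"
    unfolding C.points_C using h_in by (auto simp: cons_map_cls[OF h] C.bproj_cls C'.bproj_cls)
  fix k assume "k \<in> carrier G"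
  with u show "?h (act C.B (u, k)) = act C'.B (?h u, k)"
    unfolding C.points_C using h_in
    by (auto simp: cons_map_cls[OF h] C.act_cls C'.act_cls C.m_assoc)
qed

lemma cons_map_faithful:
  assumes h: "cocycle_map X G g g' h" and h': "cocycle_map X G g g' h'"
    and eq: "cons_map \<iota> X G g g' h = cons_map \<iota> X G g g' h'"
  shows "h = h'"
proof (rule C.cocycle_map_eqI[OF h h'])
  fix p x assume p: "p \<in> plots X" "x \<in> fst p"
  have "C'.cls p x (h p x) = C'.cls p x (h' p x)"
    using cons_map_cls[OF h p C.one_closed] cons_map_cls[OF h' p C.one_closed] eq
      C.cocycle_mapD(4)[OF h p] C.cocycle_mapD(4)[OF h' p] by simp
  then show "h p x = h' p x"
    using C'.cls_eq_same_iff[OF p] C.cocycle_mapD(4)[OF h p] C.cocycle_mapD(4)[OF h' p] by blast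
qed

lemma cons_map_full:
  assumes \<phi>: "bundle_map G C.B C'.B \<phi>"
  shows "\<exists>h. cocycle_map X G g g' h \<and> cons_map \<iota> X G g g' h = \<phi>"
proof -
  interpret B': principal_bundle_loc G X C'.B
    by unfold_locales (rule C'.principal_bundle_B)
  note \<phi>D = bundle_mapD[OF \<phi>, unfolded C.total_B C'.total_B]
  define h where "h p x = bundle_div G C'.B (C'.cls p x \<one>) (\<phi> (C.cls p x \<one>))" for p x
  have h: "h p x \<in> carrier G" "\<phi> (C.cls p x \<one>) = C'.cls p x (h p x)" if p: "p \<in> plots X" "x \<in> fst p" for p x
  proof -
    note c = C.cls_in[OF p C.one_closed] C'.cls_in[OF p C.one_closed]
    have "bproj C'.B (C'.cls p x \<one>) = bproj C'.B (\<phi> (C.cls p x \<one>))"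
      using \<phi>D(3)[OF c(1)] C.bproj_cls[OF p] C'.bproj_cls[OF p] by simp
    note d = B'.bundle_div[unfolded C'.total_B, OF c(2) \<phi>D(2)[OF c(1)] this]
    show "h p x \<in> carrier G" unfolding h_def by (rule d(1))
    then show "\<phi> (C.cls p x \<one>) = C'.cls p x (h p x)"
      using d(2) C'.act_cls[OF p C.one_closed, of "h p x"] by (simp add: h_def)
  qed
  have \<phi>_cls: "\<phi> (C.cls p x k) = C'.cls p x (h p x \<otimes> k)"
    if p: "p \<in> plots X" "x \<in> fst p" and k: "k \<in> carrier G" for p x k
    using \<phi>D(4)[OF C.cls_in[OF p C.one_closed] k] C.act_cls[OF p C.one_closed k] k
      C'.act_cls[OF p h(1)[OF p] k] h(2)[OF p] by simp
  have hm: "cocycle_map X G g g' (\<lambda>p\<in>plots X. \<lambda>x\<in>fst p. h p x)"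
  proof (rule C.cocycle_mapI)
    fix p assume p: "p \<in> plots X"
    note one = C.plot_on_one[OF C.plot_cartesian[OF p]]
    show "plot_on (gspace G) (fst p) (h p)"
      unfolding h_def
    proof (rule B'.plot_on_bundle_div)
      show "plot_on (total C'.B) (fst p) (\<lambda>x. C'.cls p x \<one>)"
        using C'.plot_on_cls_id[OF p one] by simp
      show "plot_on (total C'.B) (fst p) (\<lambda>x. \<phi> (C.cls p x \<one>))"
        using dsmooth_plot_on[OF \<phi>D(1) C.plot_on_cls_id[OF p one]] by simp
      show "bproj C'.B (C'.cls p x \<one>) = bproj C'.B (\<phi> (C.cls p x \<one>))" if "x \<in> fst p" for x
        using h[OF p that] C'.bproj_cls[OF p that] by simp
    qed
  next
    fix p1 p0 f x assume f: "(p1, p0, f) \<in> plot_maps X" and x: "x \<in> fst p1"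
    note m = plot_mapsD(1,2)[OF f] plot_mapsD(4)[OF f x]
    note c = C.cocycleD(3)[OF C.cocycle f x] C.cocycleD(3)[OF C'.cocycle f x] h(1)[OF m(1) x] h(1)[OF m(2,3)]
    \<comment> \<open>Both sides of the morphism condition name \<open>\<phi> [x, 1]\<close> in the
      summand of \<open>p0\<close>: the left one moves the image along \<open>f\<close>, the right
      one moves the argument and then applies \<open>\<phi>\<close>. Second components in one
      summand are unique.\<close>
    have "C'.cls p0 (f x) (g' (p1, p0, f) x \<otimes> h p1 x) = \<phi> (C.cls p1 x \<one>)"
      using C'.cls_step[OF f x c(3)] h(2)[OF m(1) x] by simp
    also have "\<dots> = C'.cls p0 (f x) (h p0 (f x) \<otimes> g (p1, p0, f) x)"
      using C.cls_step[OF f x C.one_closed] \<phi>_cls[OF m(2,3) c(1)] c(1) by simp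
    finally show "g' (p1, p0, f) x \<otimes> h p1 x = h p0 (f x) \<otimes> g (p1, p0, f) x"
      using C'.cls_eq_same_iff[OF m(2,3)] c by simp
  qed
  have "cons_map \<iota> X G g g' (\<lambda>p\<in>plots X. \<lambda>x\<in>fst p. h p x) = \<phi>"
  proof (rule extensionalityI)
    show "cons_map \<iota> X G g g' (\<lambda>p\<in>plots X. \<lambda>x\<in>fst p. h p x) \<in> extensional (points C.C)"
      by (simp add: cons_map_def)
    show "\<phi> \<in> extensional (points C.C)" using dsmooth_ext[OF \<phi>D(1)] by (simp add: PiE_iff)
    show "cons_map \<iota> X G g g' (\<lambda>p\<in>plots X. \<lambda>x\<in>fst p. h p x) u = \<phi> u" if "u \<in> points C.C" for u
      using that unfolding C.points_C by (auto simp: cons_map_cls[OF hm] \<phi>_cls)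
  qed
  then show ?thesis using hm by blast
qed

end

section \<open>Functoriality\<close>

locale cons_functor_loc = dgroup_base G X for G :: "'g dgroup" (structure) and X :: "'x dspace" +
  fixes \<iota> :: "('x, 'g) prebundle_pt set \<Rightarrow> 'p"
  assumes inj: "inj \<iota>"
begin

lemma cons_locI: "cocycle X G g \<Longrightarrow> cons_loc G X \<iota> g"
  using inj by unfold_locales

lemma cons_map_locI: "cocycle X G g \<Longrightarrow> cocycle X G g' \<Longrightarrow> cons_map_loc G X \<iota> g g'"
  using cons_locI by (simp add: cons_map_loc_def)

lemma is_functor_Cons: "is_functor (Coc X G) (DiffPrin X G) (Cons_functor \<iota> X G)"
  unfolding is_functor_def
proof (intro conjI ballI)
  fix g1 assume "g1 \<in> Ob (Coc X G)"
  then have g1: "cocycle X G g1" by (simp add: Coc_def)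
  interpret C1: cons_loc G X \<iota> g1 by (rule cons_locI[OF g1])
  interpret M11: cons_map_loc G X \<iota> g1 g1 by (rule cons_map_locI[OF g1 g1])
  show "on_Ob (Cons_functor \<iota> X G) g1 \<in> Ob (DiffPrin X G)"
    using C1.principal_bundle_B by (simp add: Cons_functor_def DiffPrin_def)
  have "cons_map \<iota> X G g1 g1 (\<lambda>p\<in>plots X. \<lambda>x\<in>fst p. \<one>) = (\<lambda>p\<in>points C1.C. p)"
  proof (rule extensionalityI)
    show "cons_map \<iota> X G g1 g1 (\<lambda>p\<in>plots X. \<lambda>x\<in>fst p. \<one>) \<in> extensional (points C1.C)"
      by (simp add: cons_map_def)
    show "cons_map \<iota> X G g1 g1 (\<lambda>p\<in>plots X. \<lambda>x\<in>fst p. \<one>) u = (\<lambda>p\<in>points C1.C. p) u"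
      if u: "u \<in> points C1.C" for u
      using u u[unfolded C1.points_C] by (auto simp: M11.cons_map_cls[OF cocycle_map_id[OF g1]])
  qed simp
  then show "on_Hom (Cons_functor \<iota> X G) g1 g1 (Ident (Coc X G) g1) =
      Ident (DiffPrin X G) (on_Ob (Cons_functor \<iota> X G) g1)"
    by (simp add: Cons_functor_def Coc_def DiffPrin_def)
  fix g2 assume "g2 \<in> Ob (Coc X G)"
  then have g2: "cocycle X G g2" by (simp add: Coc_def)
  interpret C2: cons_loc G X \<iota> g2 by (rule cons_locI[OF g2])
  interpret M12: cons_map_loc G X \<iota> g1 g2 by (rule cons_map_locI[OF g1 g2])
  fix h assume "h \<in> Hom (Coc X G) g1 g2"
  then have h: "cocycle_map X G g1 g2 h" by (simp add: Coc_def)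
  show "on_Hom (Cons_functor \<iota> X G) g1 g2 h \<in>
      Hom (DiffPrin X G) (on_Ob (Cons_functor \<iota> X G) g1) (on_Ob (Cons_functor \<iota> X G) g2)"
    using M12.bundle_map_cons_map[OF h] by (simp add: Cons_functor_def DiffPrin_def)
  fix g3 assume "g3 \<in> Ob (Coc X G)"
  then have g3: "cocycle X G g3" by (simp add: Coc_def)
  interpret M23: cons_map_loc G X \<iota> g2 g3 by (rule cons_map_locI[OF g2 g3])
  interpret M13: cons_map_loc G X \<iota> g1 g3 by (rule cons_map_locI[OF g1 g3])
  fix h' assume "h' \<in> Hom (Coc X G) g2 g3"
  then have h': "cocycle_map X G g2 g3 h'" by (simp add: Coc_def)
  have "cons_map \<iota> X G g1 g3 (\<lambda>p\<in>plots X. \<lambda>x\<in>fst p. h' p x \<otimes> h p x) =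
      compose (points C1.C) (cons_map \<iota> X G g2 g3 h') (cons_map \<iota> X G g1 g2 h)"
  proof (rule extensionalityI)
    show "cons_map \<iota> X G g1 g3 (\<lambda>p\<in>plots X. \<lambda>x\<in>fst p. h' p x \<otimes> h p x) \<in> extensional (points C1.C)"
      by (simp add: cons_map_def)
    show "cons_map \<iota> X G g1 g3 (\<lambda>p\<in>plots X. \<lambda>x\<in>fst p. h' p x \<otimes> h p x) u =
        compose (points C1.C) (cons_map \<iota> X G g2 g3 h') (cons_map \<iota> X G g1 g2 h) u"
      if u: "u \<in> points C1.C" for u
      using u u[unfolded C1.points_C] cocycle_mapD(4)[OF h] cocycle_mapD(4)[OF h']
      by (auto simp: compose_eq M13.cons_map_cls[OF cocycle_map_comp[OF g1 g2 g3 h h']]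
          M12.cons_map_cls[OF h] M23.cons_map_cls[OF h'] m_assoc)
  qed simp
  then show "on_Hom (Cons_functor \<iota> X G) g1 g3 (Comp (Coc X G) g1 g2 g3 h' h) =
      Comp (DiffPrin X G) (on_Ob (Cons_functor \<iota> X G) g1) (on_Ob (Cons_functor \<iota> X G) g2)
        (on_Ob (Cons_functor \<iota> X G) g3) (on_Hom (Cons_functor \<iota> X G) g2 g3 h')
        (on_Hom (Cons_functor \<iota> X G) g1 g2 h)"
    by (simp add: Cons_functor_def Coc_def DiffPrin_def)
qed

end

section \<open>Plots of the base lift to the total space\<close>

text \<open>
  With \<open>s = t - c\<close>, the flat factor \<open>exp (- 1 / s)\<close> makes the transition at \<open>c\<close> smooth, and the constant
  is chosen such that the denominator exceeds \<open>s / (d - c)\<close> for \<open>s \<ge> d - c\<close>, so that values stay below \<open>d\<close>.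
\<close>

definition clamp :: "real \<Rightarrow> real \<Rightarrow> real \<Rightarrow> real" where
  "clamp c d t = c + (t - c) * inverse (1 + exp (1 / (d - c)) / (d - c) * ((t - c) * flat 0 (t - c)))"

lemma clamp_below: "t \<le> c \<Longrightarrow> clamp c d t = t"
  by (simp add: clamp_def flat_def)

lemma clamp_denominator:
  assumes "c < d"
  shows "exp (1 / (d - c)) / (d - c) * (s * flat 0 s) \<ge> 0"
  using assms by (auto simp: flat_def)

lemma clamp_above:
  assumes "c < d" "c \<le> t"
  shows "c \<le> clamp c d t" "clamp c d t < d"
proof -
  define s where "s = t - c"
  define K where "K = exp (1 / (d - c)) / (d - c)"
  have den: "1 + K * (s * flat 0 s) > 0"
    using clamp_denominator[OF assms(1), of s] by (simp add: K_def)
  have eq: "clamp c d t = c + s / (1 + K * (s * flat 0 s))"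
    by (simp add: clamp_def s_def K_def divide_inverse)
  show "c \<le> clamp c d t" unfolding eq using den assms by (simp add: s_def)
  have "s < (d - c) * (1 + K * (s * flat 0 s))"
  proof (cases "s < d - c")
    case True
    have "(d - c) * (K * (s * flat 0 s)) \<ge> 0"
      using clamp_denominator[OF assms(1), of s, folded K_def] assms(1)
        mult_nonneg_nonneg[of "d - c" "K * (s * flat 0 s)"] by linarith
    then show ?thesis using True by (simp add: distrib_left)
  next
    case False
    then have s: "s \<ge> d - c" "s > 0" using assms by auto
    \<comment> \<open>The origin of the constant: \<open>exp (1 / (d - c))\<close> is the reciprocal
      of the value of \<open>flat 0\<close> at \<open>d - c\<close>, and \<open>s\<close> is at
      least \<open>d - c\<close> here.\<close>
    have "exp (1 / (d - c)) * flat 0 s \<ge> 1"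
    proof -
      have "1 / s \<le> 1 / (d - c)" using s assms(1) by (intro divide_left_mono) auto
      then have "exp 0 \<le> exp (1 / (d - c) - 1 / s)" by simp
      also have "\<dots> = exp (1 / (d - c)) * flat 0 s"
        using s(2) by (simp add: flat_def exp_diff exp_minus divide_inverse)
      finally show ?thesis by simp
    qed
    then have "s * 1 \<le> s * (exp (1 / (d - c)) * flat 0 s)"
      using s(2) by (intro mult_left_mono) auto
    then have "s \<le> (d - c) * (K * (s * flat 0 s))"
      using assms(1) by (simp add: K_def mult.left_commute)
    then show ?thesis using assms(1) by (simp add: distrib_left)
  qed
  then have "s / (1 + K * (s * flat 0 s)) < d - c"
    using pos_divide_less_eq[OF den, of s "d - c"] by blast
  then show "clamp c d t < d" unfolding eq by simp
qed

lemma Ck_clamp: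
  assumes W: "openin (Euclidean_space n) W" and f: "Ck n k W f" and "c < d"
  shows "Ck n k W (\<lambda>x. clamp c d (f x))"
proof -
  have "1 + exp (1 / (d - c)) / (d - c) * (s * flat 0 s) \<noteq> 0" for s
    using clamp_denominator[OF assms(3), of s] by linarith
  then show ?thesis
    unfolding clamp_def
    by (intro Ck_add[OF W] Ck_mult[OF W] Ck_inverse[OF W] Ck_diff[OF W] Ck_flat[OF W] Ck_const[OF W] f)
qed

text \<open>An upper clamp followed by a lower one, the latter being the upper clamp conjugated with
  negation.\<close>

definition clamp2 :: "real \<Rightarrow> real \<Rightarrow> real" where
  "clamp2 M t = - clamp (M - 1) M (- clamp (M - 1) M t)"

lemma clamp2_id: "\<bar>t\<bar> \<le> M - 1 \<Longrightarrow> clamp2 M t = t"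
  by (simp add: clamp2_def clamp_below abs_le_iff)

text \<open>The second clamp must preserve the upper bound that the first one established. It does:
  its argument exceeds \<open>- M\<close>, and clamping keeps it so because the transition point
  \<open>M - 1\<close> lies above \<open>- M\<close>.\<close>

lemma clamp2_bound:
  assumes "M \<ge> 1"
  shows "- M < clamp2 M t" "clamp2 M t < M"
proof -
  have *: "clamp (M - 1) M s < M" for s
    using clamp_above(2)[of "M - 1" M s] clamp_below[of s "M - 1" M] by (cases "s \<le> M - 1") auto
  have "- M < clamp (M - 1) M s" if "- M < s" for s
    using clamp_above(1)[of "M - 1" M s] clamp_below[of s "M - 1" M] assms that
    by (cases "s \<le> M - 1") auto
  from this[of "- clamp (M - 1) M t"] *[of t] show "clamp2 M t < M" by (simp add: clamp2_def)
  show "- M < clamp2 M t" using *[of "- clamp (M - 1) M t"] by (simp add: clamp2_def)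
qed

lemma Ck_clamp2:
  assumes W: "openin (Euclidean_space n) W" and f: "Ck n k W f"
  shows "Ck n k W (\<lambda>x. clamp2 M (f x))"
  unfolding clamp2_def by (intro Ck_minus[OF W] Ck_clamp[OF W] f) auto

lemma open_box_mono:
  assumes "\<And>i. i < n \<Longrightarrow> a i \<le> a' i \<and> b' i \<le> b i"
  shows "open_box n a' b' \<subseteq> open_box n a b"
  using assms unfolding open_box_def by (auto intro: le_less_trans less_le_trans)

lemma openin_box_subset:
  assumes "open_box n a b \<subseteq> S" "S \<subseteq> Rn n"
  shows "openin (top_of_set S) (open_box n a b)"
  using openin_subset_trans[OF openin_open_box[unfolded openin_Rn_iff] assms] .

section \<open>Lifts over boxes, cubes and Euclidean spaces\<close>

context principal_bundle_loc
begin

definition lift_on :: "(pt \<Rightarrow> 'x) \<Rightarrow> pt set \<Rightarrow> (pt \<Rightarrow> 'p) \<Rightarrow> bool" where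
  "lift_on p U s \<longleftrightarrow> plot_on (total B) U s \<and> (\<forall>x\<in>U. bproj B (s x) = p x)"

lemma lift_on_subset: "lift_on p U s \<Longrightarrow> V \<subseteq> U \<Longrightarrow> cartesian V \<Longrightarrow> lift_on p V s"
  unfolding lift_on_def using plot_on_subset[OF total] by blast

lemma lift_on_eq: "lift_on p U s \<Longrightarrow> (\<And>x. x \<in> U \<Longrightarrow> s x = s' x) \<Longrightarrow> lift_on p U s'"
  unfolding lift_on_def using plot_on_eq[of "total B" U s s'] by auto

lemma lift_on_local:
  assumes "cartesian U" "\<And>x. x \<in> U \<Longrightarrow> \<exists>N. openin (top_of_set U) N \<and> x \<in> N \<and> lift_on p N s"
  shows "lift_on p U s"
  unfolding lift_on_def
proof
  show "plot_on (total B) U s"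
    using plot_on_local[OF total assms(1)] assms(2) unfolding lift_on_def by blast
  show "\<forall>x\<in>U. bproj B (s x) = p x" using assms(2) unfolding lift_on_def by blast
qed

lemma lift_on_cartesian: "lift_on p U s \<Longrightarrow> cartesian U"
  unfolding lift_on_def using plot_on_cartesian[OF total] by blast

lemma lift_on_in: "lift_on p U s \<Longrightarrow> x \<in> U \<Longrightarrow> s x \<in> points (total B)"
  unfolding lift_on_def using plot_on_in[OF total] by blast

lemma lift_on_act:
  assumes "lift_on p U s" "plot_on (gspace G) U k"
  shows "lift_on p U (\<lambda>x. act B (s x, k x))"
  using assms plot_on_act bproj_act lift_on_in[OF assms(1)] plot_on_carrier[OF assms(2)]
  unfolding lift_on_def by simp

lemma lift_on_div:
  assumes "lift_on p U s" "lift_on p U s'"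
  shows "plot_on (gspace G) U (\<lambda>x. bundle_div G B (s x) (s' x))"
    and "x \<in> U \<Longrightarrow> bundle_div G B (s x) (s' x) \<in> carrier G"
    and "x \<in> U \<Longrightarrow> act B (s x, bundle_div G B (s x) (s' x)) = s' x"
proof -
  have *: "bproj B (s x) = bproj B (s' x)" if "x \<in> U" for x
    using assms that unfolding lift_on_def by simp
  show "plot_on (gspace G) U (\<lambda>x. bundle_div G B (s x) (s' x))"
    using assms * unfolding lift_on_def by (intro plot_on_bundle_div) auto
  show "x \<in> U \<Longrightarrow> bundle_div G B (s x) (s' x) \<in> carrier G"
    "x \<in> U \<Longrightarrow> act B (s x, bundle_div G B (s x) (s' x)) = s' x"
    using bundle_div[OF lift_on_in[OF assms(1)] lift_on_in[OF assms(2)] *] by auto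
qed

text \<open>
  On the overlap, \<open>s2 = s1 \<cdot> \<gamma>\<close>. Composing \<open>\<gamma>\<close> with a retraction onto the overlap that fixes the
  part \<open>x i < c\<close> extends it to all of the second box, where \<open>s2 \<cdot> \<gamma>\<^sup>-\<^sup>1\<close> then continues \<open>s1\<close>.
\<close>

lemma lift_on_glue:
  assumes i: "i < n" and l: "a i \<le> l" "l < m" "m \<le> b i"
    and s1: "lift_on p (open_box n a (b(i := m))) s1" and s2: "lift_on p (open_box n (a(i := l)) b) s2"
  shows "\<exists>s. lift_on p (open_box n a b) s"
proof -
  \<comment> \<open>Any value strictly between \<open>l\<close> and \<open>m\<close> would do: the
    retraction must fix a nonempty part of the overlap and still have room to bend before
    \<open>m\<close>.\<close>
  define c where "c = (l + m) / 2"
  have c: "l < c" "c < m" using l by (auto simp: c_def)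
  let ?A1 = "open_box n a (b(i := m))" and ?A2 = "open_box n (a(i := l)) b"
  let ?I = "open_box n (a(i := l)) (b(i := m))" and ?A = "open_box n a b"
  have ab: "a j < b j" if "j < n" for j
    using cartesian_nonempty[OF lift_on_cartesian[OF s1], THEN open_box_nonempty, OF that] l
    by (cases "j = i") auto
  have cI: "cartesian ?I" "cartesian ?A" "cartesian (open_box n a (b(i := c)))"
    using ab l c by (auto intro!: cartesian_open_box)
  have I1: "?I \<subseteq> ?A1" and I2: "?I \<subseteq> ?A2" using l by (auto intro!: open_box_mono)
  note s1' = lift_on_subset[OF s1 I1 cI(1)] and s2' = lift_on_subset[OF s2 I2 cI(1)]
  define \<gamma> where "\<gamma> x = bundle_div G B (s1 x) (s2 x)" for x
  note \<gamma> = lift_on_div[OF s1' s2', folded \<gamma>_def]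
  define R where "R x = x(i := clamp c m (x i))" for x :: pt
  note A2 = openin_open_box[of n "a(i := l)" b]
  have clamp_I: "l < clamp c m t \<and> clamp c m t < m" if "l < t" for t
    using clamp_above[of c m t] clamp_below[of t c m] that c by (cases "t \<le> c") auto
  have R: "smooth_map ?A2 ?I (restrict R ?A2)"
  proof (rule smooth_map_openI[OF A2])
    show "Ck n k ?A2 (\<lambda>x. R x j)" for j k
      by (cases "j = i") (simp_all add: R_def Ck_coord[OF A2] Ck_clamp[OF A2 Ck_coord[OF A2] c(2)])
    show "R x \<in> ?I" if "x \<in> ?A2" for x
      using that i clamp_I[of "x i"] by (auto simp: open_box_def R_def Rn_iff)
  qed
  define s where "s x = (if x i < c then s1 x else act B (s2 x, inv\<^bsub>G\<^esub> (\<gamma> (R x))))" for x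
  have "plot_on (gspace G) ?A2 (\<lambda>x. \<gamma> (restrict R ?A2 x))"
    by (rule plot_on_compose[OF gspace \<gamma>(1) lift_on_cartesian[OF s2] R])
  then have "plot_on (gspace G) ?A2 (\<lambda>x. \<gamma> (R x))" by (rule plot_on_eq) simp
  from lift_on_act[OF s2 plot_on_inv[OF this]] have L2: "lift_on p ?A2 s"
  proof (rule lift_on_eq)
    fix x assume x: "x \<in> ?A2"
    show "act B (s2 x, inv\<^bsub>G\<^esub> (\<gamma> (R x))) = s x"
    proof (cases "x i < c")
      case True
      then have Rx: "R x = x" by (simp add: R_def clamp_below)
      have "x \<in> ?I" using x True c unfolding open_box_def by auto
      have "act B (s2 x, inv\<^bsub>G\<^esub> (\<gamma> x)) = act B (act B (s1 x, \<gamma> x), inv\<^bsub>G\<^esub> (\<gamma> x))"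
        using \<gamma>(3)[OF \<open>x \<in> ?I\<close>] by simp
      also have "\<dots> = s1 x"
        using \<gamma>(2)[OF \<open>x \<in> ?I\<close>] lift_on_in[OF s1' \<open>x \<in> ?I\<close>] by (simp add: act_act act_one)
      finally show ?thesis using True Rx by (simp add: s_def)
    qed (simp add: s_def)
  qed
  have sub1: "open_box n a (b(i := c)) \<subseteq> ?A1" "open_box n a (b(i := c)) \<subseteq> ?A"
    using c l by (auto intro!: open_box_mono)
  have L1: "lift_on p (open_box n a (b(i := c))) s"
    by (rule lift_on_eq[OF lift_on_subset[OF s1 sub1(1) cI(3)]]) (use i in \<open>auto simp: s_def open_box_def\<close>)
  have sub2: "?A2 \<subseteq> ?A"
    using l by (auto intro!: open_box_mono)
  have "?A \<subseteq> Rn n" by (auto simp: open_box_def)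
  note o1 = openin_box_subset[OF sub1(2) this] and o2 = openin_box_subset[OF sub2 this]
  have "lift_on p ?A s"
  proof (rule lift_on_local[OF cI(2)])
    fix x assume x: "x \<in> ?A"
    show "\<exists>N. openin (top_of_set ?A) N \<and> x \<in> N \<and> lift_on p N s"
    proof (cases "x i < c")
      case True
      then have "x \<in> open_box n a (b(i := c))" using x by (auto simp: open_box_def)
      then show ?thesis using o1 L1 by blast
    next
      case False
      then have "x \<in> ?A2" using x c by (auto simp: open_box_def)
      then show ?thesis using o2 L2 by blast
    qed
  qed
  then show ?thesis by blast
qed

lemma lift_on_open_box_subset:
  assumes "lift_on p (open_box n a b) s" "\<And>i. i < n \<Longrightarrow> a i \<le> a' i \<and> a' i < b' i \<and> b' i \<le> b i"
  shows "lift_on p (open_box n a' b') s"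
proof (rule lift_on_subset[OF assms(1)])
  show "open_box n a' b' \<subseteq> open_box n a b" using assms(2) by (intro open_box_mono) auto
  show "cartesian (open_box n a' b')" using assms(2) by (intro cartesian_open_box) auto
qed

lemma lift_on_small_box:
  assumes p: "plot_on X (Rn n) p" and x: "x \<in> Rn n"
  shows "\<exists>e>0. \<exists>s. lift_on p (open_box n (\<lambda>i. x i - e) (\<lambda>i. x i + e)) s"
proof -
  obtain N q where N: "openin (top_of_set (Rn n)) N" "x \<in> N" "plot_on (total B) N q"
    "\<And>y. y \<in> N \<Longrightarrow> bproj B (q y) = p y"
    using subduction_lift[OF total subduction p x] by blast
  obtain e where e: "e > 0" "open_box n (\<lambda>i. x i - e) (\<lambda>i. x i + e) \<subseteq> N"
    using open_box_nbhd[OF N(1)[folded openin_Rn_iff] N(2)] by blast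
  have "lift_on p N q" using N(3,4) by (simp add: lift_on_def)
  then have "lift_on p (open_box n (\<lambda>i. x i - e) (\<lambda>i. x i + e)) q"
    by (rule lift_on_subset[OF _ e(2)]) (use e(1) in \<open>auto intro: cartesian_open_box\<close>)
  then show ?thesis using e(1) by blast
qed

text \<open>Induction over the number \<open>j\<close> of coordinates that already run through the
  whole range, while the others stay near \<open>x\<close>. For the next coordinate, Bolzano
  bisection of the interval from \<open>- M\<close> to \<open>M\<close> takes the place of a finite
  subcover: lifts over adjacent intervals glue, and the induction hypothesis at
  \<open>x(j := t)\<close> provides a lift near each \<open>t\<close>. The margin \<open>e\<close>
  makes boxes over adjacent intervals overlap.\<close>

lemma lift_on_slab:
  assumes p: "plot_on X (Rn n) p" and M: "M > 0" and "j \<le> n" and "x \<in> Rn n"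
  shows "\<exists>e>0. \<exists>s. lift_on p (open_box n (\<lambda>i. if i < j then - M - e else x i - e)
      (\<lambda>i. if i < j then M + e else x i + e)) s"
  using assms(3,4)
proof (induction j arbitrary: x)
  case 0
  then show ?case using lift_on_small_box[OF p, of x] by simp
next
  case (Suc j)
  \<comment> \<open>Lower and upper corners, with margin \<open>e\<close>, when coordinate
    \<open>j\<close> runs from \<open>u\<close> to \<open>v\<close>.\<close>
  define lo where "lo u e = (\<lambda>i. if i < j then - M - e else if i = j then u - e else x i - e)" for u e :: real
  define hi where "hi v e = (\<lambda>i. if i < j then M + e else if i = j then v + e else x i + e)" for v e :: real
  define P where "P u v \<longleftrightarrow> (\<exists>e>0. \<exists>s. lift_on p (open_box n (lo u e) (hi v e)) s)" for u v
  have "P (- M) M"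
  proof (rule Bolzano)
    show "- M \<le> M" using M by simp
    fix u v w assume uv: "P u v" and vw: "P v w" and le: "u \<le> v" "v \<le> w"
    obtain e1 s1 where 1: "e1 > 0" "lift_on p (open_box n (lo u e1) (hi v e1)) s1" using uv P_def by blast
    obtain e2 s2 where 2: "e2 > 0" "lift_on p (open_box n (lo v e2) (hi w e2)) s2" using vw P_def by blast
    define e where "e = min e1 e2"
    have e: "e > 0" "e \<le> e1" "e \<le> e2" using 1 2 by (auto simp: e_def)
    have "\<exists>s. lift_on p (open_box n (lo u e) (hi w e)) s"
    proof (rule lift_on_glue[of j n _ "v - e" "v + e"])
      show "j < n" using Suc.prems by simp
      show "lo u e j \<le> v - e" "v - e < v + e" "v + e \<le> hi w e j"
        using le e by (auto simp: lo_def hi_def)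
      show "lift_on p (open_box n (lo u e) ((hi w e)(j := v + e))) s1"
        by (rule lift_on_open_box_subset[OF 1(2)]) (use e M le in \<open>auto simp: lo_def hi_def\<close>)
      show "lift_on p (open_box n ((lo u e)(j := v - e)) (hi w e)) s2"
        by (rule lift_on_open_box_subset[OF 2(2)]) (use e M le in \<open>auto simp: lo_def hi_def\<close>)
    qed
    then show "P u w" using e(1) P_def by blast
  next
    fix t assume "- M \<le> t" "t \<le> M"
    have "x(j := t) \<in> Rn n" using Suc.prems by (auto simp: Rn_iff)
    from Suc.IH[OF Suc_leD[OF Suc.prems(1)] this]
    obtain e s where e: "e > 0" "lift_on p (open_box n (\<lambda>i. if i < j then - M - e else (x(j := t)) i - e)
      (\<lambda>i. if i < j then M + e else (x(j := t)) i + e)) s" by blast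
    \<comment> \<open>Half of the margin around \<open>t\<close> absorbs the length of the interval
      from \<open>u\<close> to \<open>v\<close>; the other half remains as the margin of the new
      box.\<close>
    have "P u v" if "u \<le> t" "t \<le> v" "v - u < e / 2" for u v
    proof -
      have "lift_on p (open_box n (lo u (e / 2)) (hi v (e / 2))) s"
        by (rule lift_on_open_box_subset[OF e(2)]) (use e(1) that M in \<open>auto simp: lo_def hi_def\<close>)
      then show ?thesis using e(1) unfolding P_def by (intro exI[of _ "e / 2"]) auto
    qed
    then show "\<exists>d>0. \<forall>a b. a \<le> t \<and> t \<le> b \<and> b - a < d \<longrightarrow> P a b"
      using e(1) by (intro exI[of _ "e / 2"]) auto
  qed
  then obtain e s where "e > 0" "lift_on p (open_box n (lo (- M) e) (hi M e)) s" using P_def by blast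
  moreover have "lo (- M) e = (\<lambda>i. if i < Suc j then - M - e else x i - e)"
    "hi M e = (\<lambda>i. if i < Suc j then M + e else x i + e)"
    by (auto simp: lo_def hi_def less_Suc_eq)
  ultimately show ?case by auto
qed

abbreviation cube :: "nat \<Rightarrow> real \<Rightarrow> pt set" where
  "cube n M \<equiv> open_box n (\<lambda>_. - M) (\<lambda>_. M)"

lemma lift_on_cube:
  assumes p: "plot_on X (Rn n) p" and M: "M > 0"
  shows "\<exists>s. lift_on p (cube n M) s"
proof -
  obtain e s where "e > 0" "lift_on p (open_box n (\<lambda>i. if i < n then - M - e else 0 - e)
      (\<lambda>i. if i < n then M + e else 0 + e)) s"
    using lift_on_slab[OF p M, of n "\<lambda>_. 0"] by (auto simp: Rn_iff)
  then have "lift_on p (cube n M) s"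
    using M by (auto elim!: lift_on_open_box_subset)
  then show ?thesis by blast
qed

text \<open>Divide \<open>s\<close> by a lift \<open>u\<close> on the larger cube. The quotient
  lives on the cube of radius \<open>M\<close>, and precomposition with the coordinatewise
  \<open>clamp2 M\<close> carries it to the larger cube. The clamp needs the layer between
  \<open>M - 1\<close> and \<open>M\<close> to bend, so agreement with \<open>s\<close> is kept only
  inside that layer.\<close>

lemma lift_on_cube_extend:
  assumes p: "plot_on X (Rn n) p" and M: "M \<ge> 1" and s: "lift_on p (cube n M) s"
  shows "\<exists>s'. lift_on p (cube n (M + 1)) s' \<and> (\<forall>x\<in>cube n (M - 1). s' x = s x)"
proof -
  let ?C = "cube n (M + 1)"
  obtain u where u: "lift_on p ?C u" using lift_on_cube[OF p, of "M + 1"] M by auto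
  have u': "lift_on p (cube n M) u" using M by (auto intro: lift_on_open_box_subset[OF u])
  define \<gamma> where "\<gamma> x = bundle_div G B (u x) (s x)" for x
  note \<gamma> = lift_on_div[OF u' s, folded \<gamma>_def]
  define r where "r x = (\<lambda>i. if i < n then clamp2 M (x i) else 0)" for x :: pt
  note C = openin_open_box[of n "\<lambda>_. - (M + 1)" "\<lambda>_. M + 1"]
  have r: "smooth_map ?C (cube n M) (restrict r ?C)"
  proof (rule smooth_map_openI[OF C])
    show "Ck n k ?C (\<lambda>x. r x j)" for j k
      using Ck_const[OF C, of k 0] Ck_clamp2[OF C Ck_coord[OF C], of k M j] by (cases "j < n") (simp_all add: r_def)
    show "r x \<in> cube n M" for x
      using clamp2_bound[OF M] by (auto simp: open_box_def r_def Rn_iff)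
  qed
  have "plot_on (gspace G) ?C (\<lambda>x. \<gamma> (restrict r ?C x))"
    by (rule plot_on_compose[OF gspace \<gamma>(1) lift_on_cartesian[OF u] r])
  then have "plot_on (gspace G) ?C (\<lambda>x. \<gamma> (r x))" by (rule plot_on_eq) simp
  from lift_on_act[OF u this] have "lift_on p ?C (\<lambda>x. act B (u x, \<gamma> (r x)))" .
  moreover have "act B (u x, \<gamma> (r x)) = s x" if x: "x \<in> cube n (M - 1)" for x
  proof -
    have "r x = x"
    proof
      fix i show "r x i = x i"
      proof (cases "i < n")
        case True
        then have "- (M - 1) < x i" "x i < M - 1" using x by (auto simp: open_box_def)
        then have "\<bar>x i\<bar> \<le> M - 1" by linarith
        then show ?thesis using True by (simp add: r_def clamp2_id)
      qed (use x in \<open>auto simp: r_def open_box_def Rn_iff\<close>)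
    qed
    moreover have "x \<in> cube n M" using x open_box_mono[of n "\<lambda>_. - M" "\<lambda>_. - (M - 1)" "\<lambda>_. M - 1" "\<lambda>_. M"] by auto
    ultimately show ?thesis using \<gamma>(3) by simp
  qed
  ultimately show ?thesis by blast
qed

lemma lift_on_Rn:
  assumes p: "plot_on X (Rn n) p"
  shows "\<exists>s. lift_on p (Rn n) s"
proof -
  \<comment> \<open>The extension step for \<open>M = k + 2\<close> yields a lift on radius
    \<open>k + 3\<close> that agrees with the old one on radius \<open>k + 1\<close>. The lag of one
    unit is harmless, since the cubes of radius \<open>k + 1\<close> still exhaust
    \<open>Rn n\<close>; on each of them all lifts from index \<open>k\<close> on coincide.\<close>
  have "\<exists>S. \<forall>k. lift_on p (cube n (real k + 2)) (S k) \<and>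
      (\<forall>x\<in>cube n (real k + 1). S (Suc k) x = S k x)"
  proof (rule dependent_nat_choice)
    show "\<exists>s. lift_on p (cube n (real 0 + 2)) s" using lift_on_cube[OF p, of 2] by simp
    show "\<exists>s'. lift_on p (cube n (real (Suc k) + 2)) s' \<and> (\<forall>x\<in>cube n (real k + 1). s' x = s x)"
      if "lift_on p (cube n (real k + 2)) s" for s k
      using lift_on_cube_extend[OF p _ that] by (simp add: add.commute add.left_commute)
  qed
  then obtain S where S: "\<And>k. lift_on p (cube n (real k + 2)) (S k)"
    "\<And>k x. x \<in> cube n (real k + 1) \<Longrightarrow> S (Suc k) x = S k x" by blast
  have mono: "cube n a \<subseteq> cube n b" if "a \<le> b" for a b
    using that by (intro open_box_mono) auto
  have S_eq: "S (k + m) x = S k x" if "x \<in> cube n (real k + 1)" for k m x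
  proof (induction m)
    case (Suc m)
    have "x \<in> cube n (real (k + m) + 1)" using that mono[of "real k + 1" "real (k + m) + 1"] by auto
    then show ?case using S(2) Suc by simp
  qed simp
  have ex: "\<exists>k. x \<in> cube n (real k + 1)" if "x \<in> Rn n" for x
  proof -
    obtain k :: nat where k: "(\<Sum>i<n. \<bar>x i\<bar>) < real k" using reals_Archimedean2 by blast
    have "- (real k + 1) < x i \<and> x i < real k + 1" if "i < n" for i
      using member_le_sum[of i "{..<n}" "\<lambda>i. \<bar>x i\<bar>"] k that by auto
    then show ?thesis using \<open>x \<in> Rn n\<close> by (auto simp: open_box_def)
  qed
  define K where "K x = (LEAST k. x \<in> cube n (real k + 1))" for x
  define s where "s x = S (K x) x" for x
  have s: "S k x = s x" if "x \<in> cube n (real k + 1)" for k x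
  proof -
    have "x \<in> cube n (real (K x) + 1)" unfolding K_def by (rule LeastI[of _ k]) (rule that)
    moreover have "K x \<le> k" unfolding K_def by (rule Least_le) (rule that)
    ultimately show ?thesis using S_eq[of x "K x" "k - K x"] by (simp add: s_def)
  qed
  have "lift_on p (Rn n) s"
  proof (rule lift_on_local[OF cartesian_Rn_self])
    fix x assume x: "x \<in> Rn n"
    obtain k where k: "x \<in> cube n (real k + 1)" using ex[OF x] by blast
    have "lift_on p (cube n (real k + 1)) (S k)"
      by (rule lift_on_open_box_subset[OF S(1)]) auto
    then have "lift_on p (cube n (real k + 1)) s" by (rule lift_on_eq) (rule s)
    then show "\<exists>N. openin (top_of_set (Rn n)) N \<and> x \<in> N \<and> lift_on p N s"
      using k openin_open_box[unfolded openin_Rn_iff] by (intro exI[of _ "cube n (real k + 1)"] conjI)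
  qed
  then show ?thesis by blast
qed

text \<open>A chart of \<open>U\<close> pulls the problem back to a Euclidean space, and the inverse
  chart carries the lift over to \<open>U\<close>.\<close>

lemma global_lift:
  assumes p: "plot_on X U p"
  obtains s where "plot_on (total B) U s" "\<And>x. x \<in> U \<Longrightarrow> bproj B (s x) = p x"
proof -
  have U: "cartesian U" by (rule plot_on_cartesian[OF base p])
  obtain n f h where fh: "smooth_map (Rn n) U f" "smooth_map U (Rn n) h" "\<forall>y\<in>U. f (h y) = y"
    using U unfolding cartesian_def by blast
  obtain s where s: "lift_on (\<lambda>x. p (f x)) (Rn n) s"
    using lift_on_Rn[OF plot_on_compose[OF base p cartesian_Rn_self fh(1)]] by blast
  have "plot_on (total B) U (\<lambda>y. s (h y))"
    using plot_on_compose[OF total _ U fh(2)] s unfolding lift_on_def by blast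
  moreover have "bproj B (s (h y)) = p y" if "y \<in> U" for y
    using s fh(3) smooth_map_in[OF fh(2) that] that unfolding lift_on_def by simp
  ultimately show ?thesis using that by blast
qed

end

section \<open>The functor is essentially surjective\<close>

text \<open>The lifts \<open>\<sigma>\<close> come from a choice for each plot separately. Whatever
  the choices, \<open>g\<close> measures the deviation between \<open>\<sigma> p1\<close> and the
  pullback of \<open>\<sigma> p0\<close>. The cocycle identity is forced because both sides move one
  point to the same point and the action is free, while smoothness is that of division. The bundle
  map sends \<open>[x, k]\<close> to \<open>\<sigma> p x\<close> moved by \<open>k\<close>.\<close>

lemma (in principal_bundle_loc) ex_cocycle_bundle_map:
  assumes \<iota>: "inj (\<iota> :: ('x, 'g) prebundle_pt set \<Rightarrow> 'p)"
  shows "\<exists>g e. cocycle X G g \<and> bundle_map G (cons_bundle \<iota> X G g) B e"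
proof -
  have "\<exists>\<sigma>. \<forall>p\<in>plots X. plot_on (total B) (fst p) (\<sigma> p) \<and> (\<forall>x\<in>fst p. bproj B (\<sigma> p x) = snd p x)"
  proof (intro bchoice ballI)
    fix p assume "p \<in> plots X"
    then have "plot_on X (fst p) (snd p)" using plots_plot_on(1)[OF base, of "fst p" "snd p"] by simp
    from global_lift[OF this]
    show "\<exists>s. plot_on (total B) (fst p) s \<and> (\<forall>x\<in>fst p. bproj B (s x) = snd p x)" by metis
  qed
  then obtain \<sigma> where \<sigma>: "\<And>p. p \<in> plots X \<Longrightarrow> plot_on (total B) (fst p) (\<sigma> p)"
    and \<sigma>_proj: "\<And>p x. p \<in> plots X \<Longrightarrow> x \<in> fst p \<Longrightarrow> bproj B (\<sigma> p x) = snd p x" by blast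
  note \<sigma>_in = plot_on_in[OF total \<sigma>]
  define g where "g = (\<lambda>(p1, p0, f)\<in>plot_maps X. \<lambda>x\<in>fst p1. bundle_div G B (\<sigma> p0 (f x)) (\<sigma> p1 x))"
  have g_eq: "g (p1, p0, f) = (\<lambda>x\<in>fst p1. bundle_div G B (\<sigma> p0 (f x)) (\<sigma> p1 x))"
    if "(p1, p0, f) \<in> plot_maps X" for p1 p0 f
    using that by (simp add: g_def)
  have g: "g (p1, p0, f) x \<in> carrier G" "act B (\<sigma> p0 (f x), g (p1, p0, f) x) = \<sigma> p1 x"
    if f: "(p1, p0, f) \<in> plot_maps X" and x: "x \<in> fst p1" for p1 p0 f x
  proof -
    note m = plot_mapsD(1,2)[OF f] plot_mapsD(4,5)[OF f x]
    show "g (p1, p0, f) x \<in> carrier G" "act B (\<sigma> p0 (f x), g (p1, p0, f) x) = \<sigma> p1 x"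
      using bundle_div[OF \<sigma>_in[OF m(2,3)] \<sigma>_in[OF m(1) x]] \<sigma>_proj[OF m(2,3)] \<sigma>_proj[OF m(1) x] m(4) x
      by (simp_all add: g_eq[OF f])
  qed
  have cocycle: "cocycle X G g"
  proof (rule cocycleI)
    show "g \<in> extensional (plot_maps X)" by (simp add: g_def)
    fix p1 p0 f assume f: "(p1, p0, f) \<in> plot_maps X"
    note m = plot_mapsD(1-3)[OF f]
    have "plot_on (gspace G) (fst p1) (\<lambda>x. bundle_div G B (\<sigma> p0 (f x)) (\<sigma> p1 x))"
    proof (rule plot_on_bundle_div[OF _ \<sigma>[OF m(1)]])
      show "plot_on (total B) (fst p1) (\<lambda>x. \<sigma> p0 (f x))"
        by (rule plot_on_compose[OF total \<sigma>[OF m(2)] plot_cartesian[OF m(1)] m(3)])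
      show "bproj B (\<sigma> p0 (f x)) = bproj B (\<sigma> p1 x)" if x: "x \<in> fst p1" for x
        using \<sigma>_proj[OF m(2) plot_mapsD(4)[OF f x]] \<sigma>_proj[OF m(1) x] plot_mapsD(5)[OF f x] by simp
    qed
    then show "plot_on (gspace G) (fst p1) (g (p1, p0, f)) \<and> g (p1, p0, f) \<in> extensional (fst p1)"
      by (simp add: g_eq[OF f])
  next
    fix p2 p1 p0 f1 f0 x
    assume f1: "(p2, p1, f1) \<in> plot_maps X" and f0: "(p1, p0, f0) \<in> plot_maps X" and x: "x \<in> fst p2"
    note fc = plot_maps_compose[OF f1 f0]
    note x1 = plot_mapsD(4)[OF f1 x] and x0 = plot_mapsD(4)[OF f0 plot_mapsD(4)[OF f1 x]]
    note c = g(1)[OF f1 x] g(1)[OF f0 x1] g(1)[OF fc x]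
    note \<sigma>0 = \<sigma>_in[OF plot_mapsD(2)[OF f0] x0]
    have "act B (\<sigma> p0 (f0 (f1 x)), g (p2, p0, compose (fst p2) f0 f1) x) = \<sigma> p2 x"
      using g(2)[OF fc x] unfolding compose_eq[OF x] .
    also have "\<dots> = act B (act B (\<sigma> p0 (f0 (f1 x)), g (p1, p0, f0) (f1 x)), g (p2, p1, f1) x)"
      using g(2)[OF f1 x] g(2)[OF f0 x1] by simp
    also have "\<dots> = act B (\<sigma> p0 (f0 (f1 x)), g (p1, p0, f0) (f1 x) \<otimes> g (p2, p1, f1) x)"
      by (rule act_act[OF \<sigma>0 c(2,1)])
    finally show "g (p2, p0, compose (fst p2) f0 f1) x = g (p1, p0, f0) (f1 x) \<otimes> g (p2, p1, f1) x"
      by (rule act_cancel[OF \<sigma>0 c(3) m_closed[OF c(2,1)]])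
  qed
  interpret C: cons_loc G X \<iota> g by unfold_locales (rule \<iota>, rule cocycle)
  \<comment> \<open>Coordinates give a definition that depends on the class alone; the next fact
    recovers the expected formula on every representative.\<close>
  define e where
    "e = (\<lambda>u\<in>points C.C. act B (\<sigma> (point_plot (fst (C.coord u))) origin, snd (C.coord u)))"
  have e: "e (C.cls p x k) = act B (\<sigma> p x, k)"
    if p: "p \<in> plots X" "x \<in> fst p" and k: "k \<in> carrier G" for p x k
  proof -
    let ?a = "g (point_map p x) origin" and ?q = "point_plot (snd p x)"
    have o: "origin \<in> fst ?q" by (simp add: point_plot_def origin_in)
    note m = point_map_in[OF p, unfolded point_map_def]
    note a = C.g_point_in[OF p]
    have "act B (\<sigma> p x, ?a) = \<sigma> ?q origin"
      using g(2)[OF m o] by (simp add: point_map_def origin_in)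
    then have "act B (\<sigma> ?q origin, inv\<^bsub>G\<^esub> ?a \<otimes> k) = act B (act B (\<sigma> p x, ?a), inv\<^bsub>G\<^esub> ?a \<otimes> k)"
      by simp
    also have "\<dots> = act B (\<sigma> p x, k)"
      using a k \<sigma>_in[OF p] by (simp add: act_act m_assoc[symmetric])
    finally show ?thesis
      using C.cls_in[OF p k] by (simp add: e_def C.coord_cls[OF p k] C.normal_def)
  qed
  have "bundle_map G C.B B e"
    unfolding bundle_map_def C.total_B
  proof (intro conjI ballI)
    show "dsmooth C.C (total B) e"
    proof (rule C.dsmooth_CI[OF total, where \<Phi> = "\<lambda>p x k. act B (\<sigma> p x, k)"])
      show "e \<in> extensional (points C.C)" by (simp add: e_def)
      fix p N s k
      assume p: "p \<in> plots X" "smooth_map N (fst p) s" "plot_on (gspace G) N k"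
      show "plot_on (total B) N (\<lambda>v. act B (\<sigma> p (s v), k v))"
        by (rule plot_on_act[OF plot_on_compose[OF total \<sigma>[OF p(1)] plot_on_cartesian[OF gspace p(3)] p(2)] p(3)])
    qed (rule e)
    fix u assume u: "u \<in> points C.C"
    then show "bproj B (e u) = bproj C.B u"
      unfolding C.points_C by (auto simp: e C.bproj_cls bproj_act \<sigma>_in \<sigma>_proj)
    fix k assume "k \<in> carrier G"
    with u show "e (act C.B (u, k)) = act B (e u, k)"
      unfolding C.points_C by (auto simp: e C.act_cls act_act \<sigma>_in)
  qed
  then show ?thesis using cocycle by blast
qed

theorem theorem3p15:
  fixes X :: "'x dspace" and G :: "'g dgroup"
    and \<iota> :: "('x, 'g) prebundle_pt set \<Rightarrow> 'p"
  assumes "diffeological_space X"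
    and "diffeological_group G"
    and "inj \<iota>"
  shows "equivalence_of_groupoids (Coc X G) (DiffPrin X G) (Cons_functor \<iota> X G)"
proof -
  interpret cons_functor_loc G X \<iota> by unfold_locales (use assms in auto)
  show ?thesis
  proof (rule equivalence_of_groupoidsI[OF groupoid_Coc groupoid_DiffPrin[OF assms(1,2)] is_functor_Cons])
    fix g g' assume "g \<in> Ob (Coc X G)" "g' \<in> Ob (Coc X G)"
    then interpret cons_map_loc G X \<iota> g g' by (intro cons_map_locI) (simp_all add: Coc_def)
    show "\<exists>h\<in>Hom (Coc X G) g g'. on_Hom (Cons_functor \<iota> X G) g g' h = \<phi>"
      if "\<phi> \<in> Hom (DiffPrin X G) (on_Ob (Cons_functor \<iota> X G) g) (on_Ob (Cons_functor \<iota> X G) g')" for \<phi>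
      using cons_map_full[of \<phi>] that by (auto simp: Coc_def DiffPrin_def Cons_functor_def)
    show "h = h'"
      if "h \<in> Hom (Coc X G) g g'" "h' \<in> Hom (Coc X G) g g'"
        "on_Hom (Cons_functor \<iota> X G) g g' h = on_Hom (Cons_functor \<iota> X G) g g' h'" for h h'
      using cons_map_faithful[of h h'] that by (simp add: Coc_def Cons_functor_def)
  next
    fix B :: "('p, 'x, 'g) gbundle" assume "B \<in> Ob (DiffPrin X G)"
    then interpret principal_bundle_loc G X B by unfold_locales (simp add: DiffPrin_def)
    show "\<exists>g\<in>Ob (Coc X G). \<exists>e. e \<in> Hom (DiffPrin X G) (on_Ob (Cons_functor \<iota> X G) g) B"
      using ex_cocycle_bundle_map[OF assms(3)] by (auto simp: Coc_def DiffPrin_def Cons_functor_def)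
  qed
qed

end
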